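(* Let $\alpha>0$, $s>1$ and $c>0$. Then each of the two functions $$\tau\mapsto \frac{\theta(\alpha,\tau)}{\big(\sqrt{\operatorname{Im}(\tau)}\,|\eta(\tau)|^2\big)^c},\qquad \tau\mapsto \frac{\zeta(s,\tau)}{\big(\sqrt{\operatorname{Im}(\tau)}\,|\eta(\tau)|^2\big)^c}$$ attains its minimum over $\mathbb{H}$ at $\tau=e^{i\pi/3}$, and this minimizer is unique up to the action of the modular group. Namely, the point $e^{i\pi/3}$ (hexagonal lattice) minimizes over $\tau\in\mathbb{H}$ the partition functions $$\mathbf{Z}(R,\tau)=\frac{R}{\sqrt2}\,\frac{\theta(R^2/2,\tau)}{\sqrt{\operatorname{Im}(\tau)}\,|\eta(\tau)|^2}\quad (R>0)\qquad\text{and}\qquad \mathbf{Z}_{T^c}(\tau)=\frac{\zeta(c/2,\tau)}{\big(\sqrt{\operatorname{Im}(\tau)}\,|\eta(\tau)|^2\big)^c}\quad (c>2).$$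
   Context: $\mathbb{H}=\{z\in\mathbb{C}:\operatorname{Im}(z)>0\}$. For $z\in\mathbb{H}$, $\alpha>0$ and $s>1$, $$\theta(\alpha,z)=\sum_{(m,n)\in\mathbb{Z}^2}e^{-\pi\alpha\frac{|mz+n|^2}{\operatorname{Im}(z)}},\qquad \zeta(s,z)=\sum_{(m,n)\in\mathbb{Z}^2\setminus\{0\}}\frac{\operatorname{Im}(z)^s}{|mz+n|^{2s}}.$$ The Dedekind eta function is $\eta(\tau)=q^{1/24}\prod_{n=1}^\infty(1-q^n)$, $q=e^{2\pi i\tau}$. The modular group is $\mathrm{SL}_2(\mathbb{Z})$ acting on $\mathbb{H}$ by $z\mapsto\frac{az+b}{cz+d}$; all functions considered are invariant under it. *)

theory Defs
  imports "HOL-Analysis.Analysis"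
begin

definition upper_half_plane :: "complex set" where
  "upper_half_plane = {z. Im z > 0}"

definition lattice_theta :: "real \<Rightarrow> complex \<Rightarrow> real" where
  "lattice_theta \<alpha> z =
     (\<Sum>\<^sub>\<infinity>(m, n) \<in> (UNIV :: (int \<times> int) set).
        exp (- pi * \<alpha> * (cmod (of_int m * z + of_int n))\<^sup>2 / Im z))"

definition epstein_zeta :: "real \<Rightarrow> complex \<Rightarrow> real" where
  "epstein_zeta s z =
     (\<Sum>\<^sub>\<infinity>(m, n) \<in> (UNIV :: (int \<times> int) set) - {(0, 0)}.
        Im z powr s / cmod (of_int m * z + of_int n) powr (2 * s))"

text \<open>The factor \<open>q\<close> to the power 1/24 is read as \<open>exp (2 * pi * \<i> * \<tau> / 24)\<close>, not as
  a principal power of \<open>q\<close>; the two differ by a root of unity when \<open>\<bar>Re \<tau>\<bar>\<close> is large.\<close>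

definition dedekind_eta :: "complex \<Rightarrow> complex" where
  "dedekind_eta \<tau> =
     exp (2 * of_real pi * \<i> * \<tau> / 24) *
     (\<Prod>n. 1 - exp (2 * of_real pi * \<i> * \<tau>) ^ Suc n)"

definition SL2Z :: "(int ^ 2 ^ 2) set" where
  "SL2Z = {A. det A = 1}"

definition moebius_action :: "int ^ 2 ^ 2 \<Rightarrow> complex \<Rightarrow> complex" where
  "moebius_action A z =
     (of_int (A $ 1 $ 1) * z + of_int (A $ 1 $ 2)) / (of_int (A $ 2 $ 1) * z + of_int (A $ 2 $ 2))"

definition hexagonal_point :: complex where
  "hexagonal_point = exp (\<i> * of_real (pi / 3))"

definition minimizes_on_half_plane :: "(complex \<Rightarrow> real) \<Rightarrow> complex \<Rightarrow> bool" where
  "minimizes_on_half_plane f = is_arg_min f (\<lambda>\<tau>. \<tau> \<in> upper_half_plane)"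

definition partition_function :: "real \<Rightarrow> complex \<Rightarrow> real" where
  "partition_function R \<tau> =
     R / sqrt 2 * (lattice_theta (R\<^sup>2 / 2) \<tau> / (sqrt (Im \<tau>) * (cmod (dedekind_eta \<tau>))\<^sup>2))"

definition torus_partition_function :: "real \<Rightarrow> complex \<Rightarrow> real" where
  "torus_partition_function c \<tau> =
     epstein_zeta (c / 2) \<tau> / (sqrt (Im \<tau>) * (cmod (dedekind_eta \<tau>))\<^sup>2) powr c"

end

theory Submission
  imports Defs "HOL-Probability.Probability"
begin

text \<open>
  Write \<open>Q(m,n) = |m z + n|\<^sup>2 / Im z\<close> and \<open>h = sqrt (Im z) |eta|\<^sup>2\<close>. Everything rests on Montgomery's theorem:
  for each \<open>\<alpha> > 0\<close>, the sum of \<open>exp (- pi \<alpha> Q)\<close> is smallest exactly on the orbit of the hexagonal point.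
  Poisson summation in \<open>n\<close> gives the symmetry \<open>\<alpha> \<mapsto> 1/\<alpha>\<close>, so that \<open>\<alpha> \<ge> 1\<close> may be assumed, and a modular
  transformation moves \<open>z\<close> to the strip \<open>0 \<le> x \<le> 1\<close>, \<open>y\<^sup>2 \<ge> 3/4\<close>. There theta first decreases when \<open>x\<close> is replaced by
  \<open>1/2\<close>; on the line \<open>x = 1/2\<close> it is a convex function of \<open>1/y\<close> (the few non-convex summands are compensated by
  those with \<open>m = 0\<close>, \<open>n = \<plusminus>1\<close>) whose derivative vanishes at the hexagonal point by symmetry.

  The Mellin transform carries strict minimality over to the zeta functions for \<open>s > 1\<close>. Finally, Kronecker's limit formula
  says that \<open>\<zeta>(s, z)\<close> minus a quantity independent of \<open>z\<close> tends to \<open>- 2 pi ln h(z)\<close> as \<open>s \<rightarrow> 1\<close>. Hence \<open>h\<close> inherits the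
  modular invariance of zeta, and \<open>h\<close> is largest at the hexagonal point.
\<close>

subsection \<open>Poisson summation for Gaussians\<close>

text \<open>The variable 1/y is chosen because the summands with m = 0 are convex in it and can pay
  for the others. The reduction to \<open>\<alpha> \<ge> 1\<close> matters twice. It makes this
  compensation uniform in \<alpha>, since for m nonzero the exponents that remain after extracting
  the decay of the pair (0, 1) have a fixed sign; and on the strip it keeps y \<alpha> at least 1/2.
  Only y/\<alpha> can then be small, and this splits the horizontal move. The series after Poisson
  summation has weights exp (-pi y \<alpha> m^2) exp (-pi y r^2 / \<alpha>) and is governed by its
  first terms if y/\<alpha> is at least 1/2; otherwise the rows themselves are sharply peaked Gauss
  sums and are compared directly.

  The maximality of h passes through a limit and is therefore a weak inequality. Strictness of the
  quotients, for every exponent c, comes from the numerators: off the orbit theta is strictly larger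
  for all \<alpha> at the same point, which is the form that the Mellin transform can
  integrate.\<close>

lemma has_sum_int_split:
  fixes f :: "int \<Rightarrow> 'a :: {topological_comm_monoid_add, t2_space}"
  assumes "((\<lambda>n. f (int n)) has_sum a) {1..}" and "((\<lambda>n. f (- int n)) has_sum b) {1..}"
  shows "(f has_sum (f 0 + (a + b))) UNIV"
proof -
  have 1: "(f has_sum a) {1..}"
    using assms(1) by (subst has_sum_reindex_bij_witness[where j = nat and i = int and T = "{1..}" and h = "\<lambda>n. f (int n)"]) auto
  have 2: "(f has_sum b) {..-1}"
    using assms(2) by (subst has_sum_reindex_bij_witness[where j = "\<lambda>n. nat (-n)" and i = "\<lambda>n. - int n" and T = "{1..}" and h = "\<lambda>n. f (- int n)"]) auto
  have 3: "(f has_sum f 0) {0}" by (rule has_sum_finiteI) auto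
  have "(f has_sum (f 0 + (a + b))) ({0} \<union> ({1..} \<union> {..-1}))"
    by (intro has_sum_Un_disjoint 1 2 3) auto
  also have "{0} \<union> ({1..} \<union> {..-1}) = (UNIV :: int set)" by auto
  finally show ?thesis .
qed

lemma has_sum_int_geometric:
  fixes r :: real
  assumes "0 \<le> r" "r < 1"
  shows "((\<lambda>n::int. r ^ nat \<bar>n\<bar>) has_sum ((1 + r) / (1 - r))) UNIV"
proof -
  have "((\<lambda>n::int. r ^ nat \<bar>n\<bar>) has_sum (r ^ nat \<bar>0\<bar> + (r / (1 - r) + r / (1 - r)))) UNIV"
    using assms has_sum_geometric_from_1[of r] by (intro has_sum_int_split) auto
  also have "r ^ nat \<bar>0\<bar> + (r / (1 - r) + r / (1 - r)) = (1 + r) / (1 - r)"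
    using assms by (simp add: divide_simps)
  finally show ?thesis .
qed

lemma has_sum_product_nonneg:
  fixes f g :: "_ \<Rightarrow> real"
  assumes "(f has_sum a) A" "(g has_sum b) B"
    and "\<And>x. x \<in> A \<Longrightarrow> f x \<ge> 0" "\<And>x. x \<in> B \<Longrightarrow> g x \<ge> 0"
  shows "((\<lambda>(x, y). f x * g y) has_sum (a * b)) (A \<times> B)"
proof (rule has_sum_SigmaI)
  show "((\<lambda>y. case (x, y) of (x, y) \<Rightarrow> f x * g y) has_sum (f x * b)) B" for x
    using assms(2) by (simp add: has_sum_cmult_right)
  show "((\<lambda>x. f x * b) has_sum a * b) A"
    using assms(1) by (rule has_sum_cmult_left)
  have "(\<lambda>x. f x * b) summable_on A"
    using assms(1) summable_on_cmult_left summable_on_def by blast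
  then show "(\<lambda>(x, y). f x * g y) summable_on A \<times> B"
    by (rule summable_on_SigmaI[rotated]) (use assms in \<open>auto intro!: has_sum_cmult_right\<close>)
qed

text \<open>The bound u^2 >= 2 |u| - 1 turns the Gaussian into a geometric majorant in |n|.\<close>

lemma summable_gaussian:
  fixes a x :: real
  assumes "a > 0"
  shows "(\<lambda>n::int. exp (- a * (of_int n + x)\<^sup>2)) summable_on UNIV"
proof (rule summable_on_comparison_test)
  let ?r = "exp (- 2 * a)"
  show "(\<lambda>n::int. exp (a * (2 * \<bar>x\<bar> + 1)) * ?r ^ nat \<bar>n\<bar>) summable_on UNIV"
    using has_sum_int_geometric[of ?r] assms
    by (intro summable_on_cmult_right) (auto simp: summable_on_def)
  fix n :: int
  have "2 * \<bar>of_int n\<bar> - 2 * \<bar>x\<bar> - 1 \<le> 2 * \<bar>of_int n + x\<bar> - 1"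
    using abs_triangle_ineq4[of "of_int n + x" x] by simp
  also have "\<dots> \<le> (of_int n + x)\<^sup>2"
    using zero_le_power2[of "\<bar>of_int n + x\<bar> - 1"] by (simp add: power2_eq_square algebra_simps)
  finally have "a * (2 * \<bar>of_int n\<bar> - 2 * \<bar>x\<bar> - 1) \<le> a * (of_int n + x)\<^sup>2"
    using assms by simp
  moreover have "exp (a * (2 * \<bar>x\<bar> + 1)) * ?r ^ nat \<bar>n\<bar> = exp (- a * (2 * \<bar>of_int n\<bar> - 2 * \<bar>x\<bar> - 1))"
    by (simp add: exp_of_nat_mult[symmetric] exp_add[symmetric] algebra_simps)
  ultimately show "exp (- a * (of_int n + x)\<^sup>2) \<le> exp (a * (2 * \<bar>x\<bar> + 1)) * ?r ^ nat \<bar>n\<bar>"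
    by simp
qed auto

text \<open>Rescaling by c = sqrt (2 pi / t) turns the Gaussian into the standard normal density up
  to a constant; the cosine integral is then the real part of its characteristic function at w = 2
  pi s / c.\<close>

lemma gaussian_fourier_transform:
  fixes t s :: real
  assumes "t > 0"
  shows "integrable lborel (\<lambda>u. exp (- pi * u\<^sup>2 / t) * cos (2 * pi * s * u))" (is ?A)
    and "(\<integral>u. exp (- pi * u\<^sup>2 / t) * cos (2 * pi * s * u) \<partial>lborel) = sqrt t * exp (- pi * t * s\<^sup>2)" (is ?B)
proof -
  define c where "c = sqrt (2 * pi / t)"
  define w where "w = 2 * pi * s / c"
  have c: "c > 0" "c\<^sup>2 = 2 * pi / t" using assms by (auto simp: c_def)
  interpret real_distribution std_normal_distribution by (rule real_dist_normal_dist)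
  have ie: "integrable std_normal_distribution (\<lambda>x. iexp (w * x))"
    by (rule integrable_iexp) auto
  have "(\<integral>x. cos (w * x) \<partial>std_normal_distribution) = Re (char std_normal_distribution w)"
    unfolding char_def using integral_Re[OF ie] by (simp add: Re_exp)
  also have "\<dots> = exp (- (w\<^sup>2) / 2)"
    by (simp only: char_std_normal_distribution Re_complex_of_real)
  finally have 1: "(\<integral>x. cos (w * x) \<partial>std_normal_distribution) = exp (- (w\<^sup>2) / 2)" .
  have ic: "integrable std_normal_distribution (\<lambda>x. cos (w * x))"
    using integrable_Re[OF ie] by (simp add: Re_exp)
  have "integrable lborel (\<lambda>x. std_normal_density x *\<^sub>R cos (w * x))"
    using ic by (subst (asm) integrable_density) (auto simp: normal_density_nonneg)
  then have ii: "integrable lborel (\<lambda>x. std_normal_density x * cos (w * x))" by simp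
  have 2: "(\<integral>x. std_normal_density x * cos (w * x) \<partial>lborel) = exp (- (w\<^sup>2) / 2)"
    using 1 by (subst (asm) integral_density) (auto simp: normal_density_nonneg)
  have dens: "std_normal_density (0 + c * u) * cos (w * (0 + c * u)) =
      (exp (- pi * u\<^sup>2 / t) * cos (2 * pi * s * u)) / sqrt (2 * pi)" for u
    using c by (simp add: normal_density_def w_def power_mult_distrib field_simps)
  have 3: "integrable lborel (\<lambda>u. (exp (- pi * u\<^sup>2 / t) * cos (2 * pi * s * u)) / sqrt (2 * pi))"
    using lborel_integrable_real_affine[OF ii, of c 0] c unfolding dens by simp
  then have "integrable lborel (\<lambda>u. sqrt (2 * pi) * ((exp (- pi * u\<^sup>2 / t) * cos (2 * pi * s * u)) / sqrt (2 * pi)))"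
    by (rule integrable_mult_right)
  then show ?A by simp
  have "exp (- (w\<^sup>2) / 2) = c * (\<integral>u. (exp (- pi * u\<^sup>2 / t) * cos (2 * pi * s * u)) / sqrt (2 * pi) \<partial>lborel)"
    unfolding 2[symmetric] using c
    by (subst lborel_integral_real_affine[where c = c and t = 0]) (auto simp only: dens, auto)
  also have "\<dots> = c / sqrt (2 * pi) * (\<integral>u. (exp (- pi * u\<^sup>2 / t) * cos (2 * pi * s * u)) \<partial>lborel)"
    by simp
  also have "c / sqrt (2 * pi) = 1 / sqrt t"
    by (simp add: c_def real_sqrt_divide)
  finally have "(\<integral>u. (exp (- pi * u\<^sup>2 / t) * cos (2 * pi * s * u)) \<partial>lborel) = sqrt t * exp (- (w\<^sup>2) / 2)"
    using assms by (simp add: field_simps)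
  also have "w\<^sup>2 / 2 = pi * t * s\<^sup>2"
    using c assms by (simp add: w_def power_divide power_mult_distrib) (simp add: power2_eq_square field_simps)
  then have "- (w\<^sup>2) / 2 = - pi * t * s\<^sup>2" by simp
  finally show ?B by simp
qed

text \<open>A Gaussian made periodic with period 1. Up to a factor, row m of theta is this sum with
  t = Im z / \<alpha> and b = m Re z.\<close>

definition gauss_sum :: "real \<Rightarrow> real \<Rightarrow> real" where
  "gauss_sum t b = (\<Sum>\<^sub>\<infinity>n\<in>(UNIV::int set). exp (- pi * (of_int n + b)\<^sup>2 / t))"

lemma summable_gauss_sum:
  assumes "t > 0"
  shows "(\<lambda>n::int. exp (- pi * (of_int n + b)\<^sup>2 / t)) summable_on UNIV"
  using summable_gaussian[of "pi / t" b] assms by simp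

lemma has_sum_gauss_sum:
  assumes "t > 0"
  shows "((\<lambda>n::int. exp (- pi * (of_int n + b)\<^sup>2 / t)) has_sum gauss_sum t b) UNIV"
  unfolding gauss_sum_def using summable_gauss_sum[OF assms] by (rule has_sum_infsum)

lemma gauss_sum_periodic:
  "gauss_sum t (b + of_int k) = gauss_sum t b"
  unfolding gauss_sum_def
  by (rule infsum_reindex_bij_witness[where i = "\<lambda>n. n - k" and j = "\<lambda>n. n + k"]) (auto simp: algebra_simps)

lemma gauss_sum_minus: "gauss_sum t (- b) = gauss_sum t b"
  unfolding gauss_sum_def
  by (rule infsum_reindex_bij_witness[where i = uminus and j = uminus]) (auto simp: power2_eq_square algebra_simps)

text \<open>The Fourier side of Poisson summation; cosines suffice because \<open>gauss_sum\<close>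
  is even in b.\<close>

definition gauss_series :: "real \<Rightarrow> real \<Rightarrow> real" where
  "gauss_series t b = sqrt t * (\<Sum>\<^sub>\<infinity>r\<in>(UNIV::int set). exp (- pi * t * (of_int r)\<^sup>2) * cos (2 * pi * of_int r * b))"

lemma uniform_limit_gauss_sum:
  assumes "t > 0"
  shows "uniform_limit {0..1} (\<lambda>X b. \<Sum>n\<in>X. exp (- pi * (of_int n + b)\<^sup>2 / t)) (gauss_sum t)
           (finite_subsets_at_top (UNIV :: int set))"
  unfolding gauss_sum_def
proof (rule Weierstrass_m_test_general)
  let ?r = "exp (- 2 * (pi / t))"
  \<comment> \<open>For b in [0, 1] one has (n + b)^2 >= 2 |n + b| - 1 >= 2 |n| - 3, whence the
    3.\<close>
  show "(\<lambda>n::int. exp (3 * (pi / t)) * ?r ^ nat \<bar>n\<bar>) summable_on UNIV"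
    using has_sum_int_geometric[of ?r] assms
    by (intro summable_on_cmult_right) (auto simp: summable_on_def)
  fix n :: int and b :: real assume b: "b \<in> {0..1}"
  have "2 * \<bar>of_int n\<bar> - 3 \<le> 2 * \<bar>of_int n + b\<bar> - 1"
    using b abs_triangle_ineq4[of "of_int n + b" b] by simp
  also have "\<dots> \<le> (of_int n + b)\<^sup>2"
    using zero_le_power2[of "\<bar>of_int n + b\<bar> - 1"] by (simp add: power2_eq_square algebra_simps)
  finally have "pi / t * (2 * \<bar>of_int n\<bar> - 3) \<le> pi / t * (of_int n + b)\<^sup>2"
    using assms by (intro mult_left_mono) auto
  moreover have "exp (3 * (pi / t)) * ?r ^ nat \<bar>n\<bar> = exp (- (pi / t * (2 * \<bar>of_int n\<bar> - 3)))"
    by (simp add: exp_of_nat_mult[symmetric] exp_add[symmetric] algebra_simps)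
  ultimately show "norm (exp (- pi * (of_int n + b)\<^sup>2 / t)) \<le> exp (3 * (pi / t)) * ?r ^ nat \<bar>n\<bar>"
    by simp
qed

lemma uniform_limit_gauss_series:
  assumes "t > 0"
  shows "uniform_limit UNIV (\<lambda>X b. \<Sum>r\<in>X. exp (- pi * t * (of_int r)\<^sup>2) * cos (2 * pi * of_int r * b))
           (\<lambda>b. \<Sum>\<^sub>\<infinity>r\<in>(UNIV::int set). exp (- pi * t * (of_int r)\<^sup>2) * cos (2 * pi * of_int r * b))
           (finite_subsets_at_top (UNIV :: int set))"
proof (rule Weierstrass_m_test_general)
  show "(\<lambda>r::int. exp (- (pi * t) * (of_int r + 0)\<^sup>2)) summable_on UNIV"
    using assms by (intro summable_gaussian) auto
qed (auto simp: abs_mult)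

text \<open>Half-open intervals are used because the unit intervals [n, n + 1] with -N <= n < N fill
  exactly [-N, N], and because n and -n - 1 enter together.\<close>

lemma filterlim_int_intervals:
  "filterlim (\<lambda>N::nat. {- int N..<int N}) (finite_subsets_at_top UNIV) sequentially"
  unfolding filterlim_finite_subsets_at_top
proof (intro allI impI)
  fix X :: "int set" assume "finite X \<and> X \<subseteq> UNIV"
  then have X: "finite X" by simp
  define B where "B = nat (Max (insert 0 (abs ` X))) + 1"
  have "X \<subseteq> {- int N..<int N}" if "N \<ge> B" for N
  proof
    fix x assume "x \<in> X"
    then have "\<bar>x\<bar> \<le> Max (insert 0 (abs ` X))" using X by (intro Max_ge) auto
    then show "x \<in> {- int N..<int N}" using that unfolding B_def by auto
  qed
  then show "\<forall>\<^sub>F N in sequentially. finite {- int N..<int N} \<and> X \<subseteq> {- int N..<int N} \<and> {- int N..<int N} \<subseteq> UNIV"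
    unfolding eventually_sequentially by auto
qed

lemma has_sum_int_intervals_limit:
  assumes "(f has_sum a) (UNIV :: int set)"
  shows "(\<lambda>N. \<Sum>n\<in>{- int N..<int N}. f n) \<longlonglongrightarrow> a"
  using filterlim_compose[OF assms[unfolded has_sum_def] filterlim_int_intervals] .

text \<open>The unfolding step: gluing the unit intervals gives the integrals over [-N, N], which
  tend both to the sum and to the integral over the line.\<close>

lemma has_sum_unit_interval_integrals:
  fixes \<psi> :: "real \<Rightarrow> real"
  assumes "(\<psi> has_integral I) UNIV"
    and "\<And>n::int. ((\<lambda>b. \<psi> (of_int n + b)) has_integral c n) {0..1}"
    and "(c has_sum J) UNIV"
  shows "J = I"
proof (rule LIMSEQ_unique)
  show "(\<lambda>N. \<Sum>n\<in>{- int N..<int N}. c n) \<longlonglongrightarrow> J"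
    using assms(3) by (rule has_sum_int_intervals_limit)
  have c: "(\<psi> has_integral c n) {of_int n..of_int n + 1}" for n
    using assms(2)[of n]
    by (subst has_integral_shift_real_ivl_iff[where c = "of_int n"]) (simp add: add.commute)
  have fin: "(\<psi> has_integral (\<Sum>n\<in>{- int N..<int N}. c n)) {- real N..real N}" for N
  proof (induction N)
    case 0
    then show ?case by (auto intro: has_integral_refl)
  next
    case (Suc N)
    have "{- int (Suc N)..<int (Suc N)} = insert (- int N - 1) (insert (int N) {- int N..<int N})"
      by auto
    then have s: "(\<Sum>n\<in>{- int (Suc N)..<int (Suc N)}. c n) = (c (- int N - 1) + (\<Sum>n\<in>{- int N..<int N}. c n)) + c (int N)"
      by (simp add: ac_simps)
    have h1: "(\<psi> has_integral c (- int N - 1)) {- real N - 1..- real N}"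
      using c[of "- int N - 1"] by simp
    have h2: "(\<psi> has_integral c (int N)) {real N..real N + 1}"
      using c[of "int N"] by simp
    have "(\<psi> has_integral c (- int N - 1) + (\<Sum>n\<in>{- int N..<int N}. c n)) {- real N - 1..real N}"
      by (rule has_integral_combine[OF _ _ h1 Suc]) auto
    then have "(\<psi> has_integral (c (- int N - 1) + (\<Sum>n\<in>{- int N..<int N}. c n)) + c (int N)) {- real N - 1..real N + 1}"
      by (rule has_integral_combine[rotated 2, OF _ h2]) auto
    moreover have "- real (Suc N) = - real N - 1" "real (Suc N) = real N + 1" by auto
    ultimately show ?case unfolding s by (simp only:)
  qed
  show "(\<lambda>N. \<Sum>n\<in>{- int N..<int N}. c n) \<longlonglongrightarrow> I"
  proof (rule LIMSEQ_I)
    fix e :: real assume "e > 0"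
    \<comment> \<open>The line is not a box, so an integral over it is a limit over boxes containing
      a large ball.\<close>
    have "\<nexists>a b. (UNIV :: real set) = cbox a b"
      by (metis bounded_cbox not_bounded_UNIV)
    then obtain B where B: "B > 0" "\<And>a b. ball 0 B \<subseteq> cbox a b \<Longrightarrow>
        (\<exists>z. (\<psi> has_integral z) (cbox a b) \<and> norm (z - I) < e)"
      using has_integral_altD[OF assms(1) _ \<open>e > 0\<close>, of thesis] by auto
    obtain N0 where N0: "B \<le> real N0" using real_arch_simple by blast
    have "norm ((\<Sum>n\<in>{- int N..<int N}. c n) - I) < e" if "N \<ge> N0" for N
    proof -
      have "ball 0 B \<subseteq> cbox (- real N) (real N)"
        using N0 that by (auto simp: dist_real_def)
      from B(2)[OF this] obtain z where z: "(\<psi> has_integral z) (cbox (- real N) (real N))" "norm (z - I) < e"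
        by blast
      have "z = (\<Sum>n\<in>{- int N..<int N}. c n)"
        using z(1) fin[of N] by (intro has_integral_unique[of \<psi> z]) auto
      with z(2) show ?thesis by simp
    qed
    then show "\<exists>no. \<forall>n\<ge>no. norm ((\<Sum>n\<in>{- int n..<int n}. c n) - I) < e" by blast
  qed
qed

text \<open>Uniform convergence survives multiplication by the bounded factor c, later a cosine, and
  a uniform limit may be integrated over a compact interval.\<close>

lemma has_sum_integral_exchange:
  fixes h :: "int \<Rightarrow> real \<Rightarrow> real"
  assumes ul: "uniform_limit {0..1} (\<lambda>X b. \<Sum>n\<in>X. h n b) S (finite_subsets_at_top UNIV)"
    and cont: "\<And>n. continuous_on {0..1} (h n)" "continuous_on {0..1} c"
    and c: "\<And>b. \<bar>c b\<bar> \<le> 1"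
    and I: "\<And>n. ((\<lambda>b. h n b * c b) has_integral I n) {0..1}"
  obtains J where "(I has_sum J) UNIV" "((\<lambda>b. S b * c b) has_integral J) {0..1}"
proof -
  let ?F = "finite_subsets_at_top (UNIV :: int set)"
  have "uniform_limit {0..1} (\<lambda>X b. (\<Sum>n\<in>X. h n b) * c b) (\<lambda>b. S b * c b) ?F"
    unfolding uniform_limit_iff
  proof (intro allI impI)
    fix e :: real assume "e > 0"
    with ul have "\<forall>\<^sub>F X in ?F. \<forall>b\<in>{0..1}. dist (\<Sum>n\<in>X. h n b) (S b) < e"
      unfolding uniform_limit_iff by blast
    then show "\<forall>\<^sub>F X in ?F. \<forall>b\<in>{0..1}. dist ((\<Sum>n\<in>X. h n b) * c b) (S b * c b) < e"
    proof eventually_elim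
      case (elim X)
      show ?case
      proof
        fix b :: real assume "b \<in> {0..1}"
        have "dist ((\<Sum>n\<in>X. h n b) * c b) (S b * c b) = dist (\<Sum>n\<in>X. h n b) (S b) * \<bar>c b\<bar>"
          by (simp add: dist_real_def left_diff_distrib[symmetric] abs_mult)
        also have "\<dots> \<le> dist (\<Sum>n\<in>X. h n b) (S b) * 1" using c by (intro mult_left_mono) auto
        also have "\<dots> < e" using elim \<open>b \<in> _\<close> by simp
        finally show "dist ((\<Sum>n\<in>X. h n b) * c b) (S b * c b) < e" .
      qed
    qed
  qed
  then obtain I' J where IJ: "\<And>X. ((\<lambda>b. (\<Sum>n\<in>X. h n b) * c b) has_integral I' X) {0..1}"
    "((\<lambda>b. S b * c b) has_integral J) {0..1}" "(I' \<longlongrightarrow> J) ?F"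
    by (rule uniform_limit_integral) (auto intro!: continuous_intros cont)
  have "sum I X = I' X" if "finite X" for X
  proof -
    have "((\<lambda>b. \<Sum>n\<in>X. h n b * c b) has_integral sum I X) {0..1}"
      using that by (intro has_integral_sum I)
    then show ?thesis using has_integral_unique IJ(1)[of X] by (simp add: sum_distrib_right)
  qed
  then have "(I has_sum J) UNIV"
    unfolding has_sum_def using IJ(3)
    by (rule_tac Lim_transform_eventually) (auto intro!: eventually_finite_subsets_at_top_weakI)
  then show ?thesis using IJ(2) by (rule that)
qed

lemma cos_2pi_int_add: "cos (2 * pi * of_int j * (b + of_int n)) = cos (2 * pi * of_int j * b)"
proof -
  have "cos (2 * pi * of_int j * (b + of_int n)) = cos (2 * pi * of_int j * b + 2 * pi * of_int (j * n))"
    by (rule arg_cong[of _ _ cos]) (simp add: algebra_simps)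
  also have "\<dots> = cos (2 * pi * of_int j * b)"
    by (simp only: cos_add cos_int_2pin sin_int_2pin)
  finally show ?thesis .
qed

text \<open>The cosine has period 1, so it may be moved inside the periodisation; the integral over
  [0, 1] then unfolds to the Fourier transform of one Gaussian over the line.\<close>

lemma gauss_sum_fourier_coeff:
  fixes j :: int
  assumes t: "t > 0"
  shows "((\<lambda>b. gauss_sum t b * cos (2 * pi * of_int j * b)) has_integral sqrt t * exp (- pi * t * (of_int j)\<^sup>2)) {0..1}"
proof -
  let ?c = "\<lambda>b. cos (2 * pi * of_int j * b)"
  define \<psi> where "\<psi> u = exp (- pi * u\<^sup>2 / t) * ?c u" for u
  have shift: "(\<lambda>b. exp (- pi * (of_int n + b)\<^sup>2 / t) * ?c b) = (\<lambda>b. \<psi> (of_int n + b))" for n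
    using cos_2pi_int_add[of j _ n] by (simp add: \<psi>_def add.commute)
  have "continuous_on {0..1} (\<lambda>b. \<psi> (of_int n + b))" for n :: int
    unfolding \<psi>_def using t by (intro continuous_intros) auto
  then have each: "((\<lambda>b. \<psi> (of_int n + b)) has_integral integral {0..1} (\<lambda>b. \<psi> (of_int n + b))) {0..1}" for n :: int
    by (intro integrable_integral integrable_continuous_real)
  obtain J where J: "((\<lambda>n. integral {0..1} (\<lambda>b. \<psi> (of_int n + b))) has_sum J) UNIV"
    "((\<lambda>b. gauss_sum t b * ?c b) has_integral J) {0..1}"
  proof (rule has_sum_integral_exchange[OF uniform_limit_gauss_sum[OF t]])
    show "((\<lambda>b. exp (- pi * (of_int n + b)\<^sup>2 / t) * ?c b) has_integral integral {0..1} (\<lambda>b. \<psi> (of_int n + b))) {0..1}" for n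
      unfolding shift by (rule each)
  qed (use t in \<open>auto intro!: continuous_intros\<close>)
  have "J = sqrt t * exp (- pi * t * (of_int j)\<^sup>2)"
  proof (rule has_sum_unit_interval_integrals[OF _ each J(1)])
    show "(\<psi> has_integral sqrt t * exp (- pi * t * (of_int j)\<^sup>2)) UNIV"
      unfolding \<psi>_def gaussian_fourier_transform(2)[OF t, symmetric]
      by (rule has_integral_integral_lborel, rule gaussian_fourier_transform(1)[OF t])
  qed
  with J(2) show ?thesis by simp
qed

section \<open>Uniqueness of Fourier coefficients for even functions of period one\<close>

inductive_set even_trig :: "(real \<Rightarrow> real) set" where
  cos: "(\<lambda>x. cos (2 * pi * of_int j * x)) \<in> even_trig"
| add: "f \<in> even_trig \<Longrightarrow> g \<in> even_trig \<Longrightarrow> (\<lambda>x. f x + g x) \<in> even_trig"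
| scale: "f \<in> even_trig \<Longrightarrow> (\<lambda>x. c * f x) \<in> even_trig"

lemma even_trig_mult_cos:
  "f \<in> even_trig \<Longrightarrow> (\<lambda>x. cos (2 * pi * of_int i * x) * f x) \<in> even_trig"
proof (induction rule: even_trig.induct)
  case (cos j)
  have "(\<lambda>x. (1/2) * (cos (2 * pi * of_int (i - j) * x) + cos (2 * pi * of_int (i + j) * x))) \<in> even_trig"
    by (intro even_trig.intros)
  also have "(\<lambda>x. (1/2) * (cos (2 * pi * of_int (i - j) * x) + cos (2 * pi * of_int (i + j) * x)))
      = (\<lambda>x. cos (2 * pi * of_int i * x) * cos (2 * pi * of_int j * x))"
    by (simp add: cos_times_cos algebra_simps add_divide_distrib)
  finally show ?case .
next
  case (add f g)
  then show ?case using even_trig.add[OF add.IH] by (simp add: algebra_simps)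
next
  case (scale f c)
  then show ?case using even_trig.scale[OF scale.IH, of c] by (simp add: algebra_simps)
qed

lemma even_trig_mult:
  "f \<in> even_trig \<Longrightarrow> g \<in> even_trig \<Longrightarrow> (\<lambda>x. f x * g x) \<in> even_trig"
proof (induction rule: even_trig.induct)
  case (cos j)
  then show ?case by (rule even_trig_mult_cos)
next
  case (add f h)
  then show ?case using even_trig.add[OF add.IH] by (simp add: algebra_simps)
next
  case (scale f c)
  then show ?case using even_trig.scale[OF scale.IH, of c] by (simp add: algebra_simps)
qed

lemma even_trig_continuous: "f \<in> even_trig \<Longrightarrow> continuous_on A f"
  by (induction rule: even_trig.induct) (auto intro!: continuous_intros)

lemma cos_2pi_int_reflect: "cos (2 * pi * of_int j * (1 - x)) = cos (2 * pi * of_int j * x)"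
proof -
  have "cos (2 * pi * of_int j * (1 - x)) = cos (2 * pi * of_int j - 2 * pi * of_int j * x)"
    by (rule arg_cong[of _ _ cos]) (simp add: algebra_simps)
  also have "\<dots> = cos (2 * pi * of_int j * x)"
    by (simp only: cos_diff cos_int_2pin sin_int_2pin)
  finally show ?thesis .
qed

lemma even_trig_reflect: "f \<in> even_trig \<Longrightarrow> f (1 - x) = f x"
  by (induction rule: even_trig.induct) (auto simp: cos_2pi_int_reflect)

text \<open>Stone-Weierstrass is applied on [0, 1/2], where cos (2 pi x) is injective and so
  separates points. Both d and the approximant are invariant under x to 1 - x, which extends the
  estimate to [0, 1].\<close>

lemma even_trig_approx:
  assumes "continuous_on {0..1} d" "\<And>x. d (1 - x) = d x" "e > 0"
  obtains g where "g \<in> even_trig" "\<And>x. x \<in> {0..1} \<Longrightarrow> \<bar>d x - g x\<bar> < e"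
proof -
  interpret function_ring_on even_trig "{0..1/2}"
  proof
    show "(\<lambda>_. c) \<in> even_trig" for c
      using even_trig.scale[OF even_trig.cos[of 0], of c] by simp
    fix x y :: real assume "x \<in> {0..1/2}" "y \<in> {0..1/2}" "x \<noteq> y"
    then have "cos (2 * pi * x) \<noteq> cos (2 * pi * y)"
      using cos_inj_pi[of "2 * pi * x" "2 * pi * y"] by auto
    then show "\<exists>f\<in>even_trig. f x \<noteq> f y"
      using even_trig.cos[of 1] by (intro bexI[of _ "\<lambda>x. cos (2 * pi * of_int 1 * x)"]) auto
  qed (auto intro: even_trig_continuous even_trig_mult even_trig.add)
  obtain g where g: "g \<in> even_trig" "\<And>x. x \<in> {0..1/2} \<Longrightarrow> \<bar>d x - g x\<bar> < e"
    using Stone_Weierstrass_basic[of d e] assms continuous_on_subset[of "{0..1}" d "{0..1/2}"] by auto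
  have "\<bar>d x - g x\<bar> < e" if "x \<in> {0..1}" for x
  proof (cases "x \<le> 1/2")
    case False
    then show ?thesis
      using g(2)[of "1 - x"] that assms(2)[of x] even_trig_reflect[OF g(1), of x] by auto
  qed (use g that in auto)
  with g(1) show ?thesis by (rule that)
qed

text \<open>By orthogonality the integral of d^2 equals that of d (d - g) for every even
  trigonometric polynomial g, hence is at most e' times the integral of |d| once g is e'-close to
  d.\<close>

lemma zero_if_even_fourier_coeffs_zero:
  assumes d: "continuous_on {0..1} d" "\<And>x. d (1 - x) = d x"
    and orth: "\<And>j::int. ((\<lambda>b. d b * cos (2 * pi * of_int j * b)) has_integral 0) {0..1}"
    and x: "x \<in> {0..1}"
  shows "d x = 0"
proof -
  have orth': "((\<lambda>b. d b * g b) has_integral 0) {0..1}" if "g \<in> even_trig" for g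
    using that
  proof (induction rule: even_trig.induct)
    case (cos j)
    then show ?case by (rule orth)
  next
    case (add f g)
    then show ?case using has_integral_add[OF add.IH] by (simp add: algebra_simps)
  next
    case (scale f c)
    then show ?case using has_integral_mult_right[OF scale.IH, of c] by (simp add: algebra_simps)
  qed
  have cont: "continuous_on {0..1} (\<lambda>b. d b * d b)" "continuous_on {0..1} (\<lambda>b. \<bar>d b\<bar>)"
    by (intro continuous_intros d)+
  define M where "M = integral {0..1} (\<lambda>b. \<bar>d b\<bar>)"
  have "M \<ge> 0" unfolding M_def by (rule integral_nonneg) (auto intro!: integrable_continuous_real cont)
  have "integral {0..1} (\<lambda>b. d b * d b) \<le> 0"
  proof (rule field_le_epsilon)
    fix e :: real assume "e > 0"
    define e' where "e' = e / (M + 1)"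
    have "e' > 0" using \<open>e > 0\<close> \<open>M \<ge> 0\<close> by (simp add: e'_def)
    then obtain g where g: "g \<in> even_trig" "\<And>x. x \<in> {0..1} \<Longrightarrow> \<bar>d x - g x\<bar> < e'"
      using even_trig_approx[OF d] by metis
    have "((\<lambda>b. d b * d b - d b * g b) has_integral integral {0..1} (\<lambda>b. d b * d b) - 0) {0..1}"
      by (intro has_integral_diff orth' g integrable_integral integrable_continuous_real cont)
    moreover have "((\<lambda>b. e' * \<bar>d b\<bar>) has_integral e' * M) {0..1}"
      unfolding M_def by (intro has_integral_mult_right integrable_integral integrable_continuous_real cont)
    moreover have "d b * d b - d b * g b \<le> e' * \<bar>d b\<bar>" if "b \<in> {0..1}" for b
    proof -
      have "d b * d b - d b * g b = d b * (d b - g b)" by (simp add: algebra_simps)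
      also have "\<dots> \<le> \<bar>d b\<bar> * \<bar>d b - g b\<bar>" by (metis abs_mult abs_ge_self)
      also have "\<dots> \<le> \<bar>d b\<bar> * e'" using g(2)[OF that] by (intro mult_left_mono) auto
      finally show ?thesis by (simp add: mult.commute)
    qed
    ultimately have "integral {0..1} (\<lambda>b. d b * d b) - 0 \<le> e' * M"
      by (rule has_integral_le)
    also have "\<dots> \<le> e" using \<open>e > 0\<close> \<open>M \<ge> 0\<close> by (simp add: e'_def field_simps)
    finally show "integral {0..1} (\<lambda>b. d b * d b) \<le> 0 + e" by simp
  qed
  moreover have "integral {0..1} (\<lambda>b. d b * d b) \<ge> 0"
    by (rule integral_nonneg) (auto intro!: integrable_continuous_real cont)
  ultimately have "integral {0..1} (\<lambda>b. d b * d b) = 0" by simp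
  then show ?thesis
    using x integral_eq_0_iff[OF cont(1)] by auto
qed

text \<open>Both sides are continuous, even and of period 1 with the same cosine coefficients, so
  their difference vanishes on [0, 1]; periodicity does the rest.\<close>

theorem gauss_sum_poisson:
  assumes t: "t > 0"
  shows "gauss_sum t b = gauss_series t b"
proof -
  define f where "f = (\<lambda>b. \<Sum>\<^sub>\<infinity>r\<in>(UNIV::int set). exp (- pi * t * (of_int r)\<^sup>2) * cos (2 * pi * of_int r * b))"
  have gs: "gauss_series t b = sqrt t * f b" for b by (simp add: gauss_series_def f_def)
  have cf: "continuous_on UNIV f" unfolding f_def
    by (rule uniform_limit_theorem[OF _ uniform_limit_gauss_series[OF t]]) (auto intro!: always_eventually continuous_intros)
  have cg: "continuous_on {0..1} (gauss_sum t)"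
    by (rule uniform_limit_theorem[OF _ uniform_limit_gauss_sum[OF t]]) (use t in \<open>auto intro!: always_eventually continuous_intros\<close>)
  define d where "d = (\<lambda>b. gauss_sum t b - sqrt t * f b)"
  have cd: "continuous_on {0..1} d" unfolding d_def
    by (intro continuous_intros cg continuous_on_subset[OF cf]) auto
  have refl_g: "gauss_sum t (1 - x) = gauss_sum t x" for x
    using gauss_sum_periodic[of t "- x" 1] gauss_sum_minus[of t x] by (simp add: add.commute)
  have refl_f: "f (1 - x) = f x" for x
    unfolding f_def by (simp only: cos_2pi_int_reflect)
  have sf: "((\<lambda>b. f b * cos (2 * pi * of_int j * b)) has_integral exp (- pi * t * (of_int j)\<^sup>2)) {0..1}" for j :: int
  proof -
    let ?c = "\<lambda>b. cos (2 * pi * of_int j * b)"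
    let ?h = "\<lambda>(r::int) b. exp (- pi * t * (of_int r)\<^sup>2) * cos (2 * pi * of_int r * b)"
    have cosint: "((\<lambda>b. cos (2 * pi * of_int k * b)) has_integral (if k = 0 then 1 else 0)) {0..1}" for k :: int
    proof (cases "k = 0")
      case True then show ?thesis using has_integral_const_real[of "1::real" 0 1] by simp
    next
      case False
      have "((\<lambda>b. cos (2 * pi * of_int k * b)) has_integral
          (sin (2 * pi * of_int k * 1) / (2 * pi * of_int k) - sin (2 * pi * of_int k * 0) / (2 * pi * of_int k))) {0..1}"
        by (rule fundamental_theorem_of_calculus)
           (use False in \<open>auto intro!: derivative_eq_intros simp: has_real_derivative_iff_has_vector_derivative[symmetric]\<close>)
      then show ?thesis using False by (simp only: mult_1_right sin_int_2pin) simp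
    qed
    \<comment> \<open>By the product formula only r = j and r = -j contribute, one half each. For j
      = 0 the two coincide and both indicators are 1.\<close>
    define A where "A r = exp (- pi * t * (of_int r)\<^sup>2) * (((if r - j = 0 then 1 else 0) + (if r + j = 0 then 1 else 0)) / 2)" for r :: int
    have A: "((\<lambda>b. ?h r b * ?c b) has_integral A r) {0..1}" for r
    proof -
      have "((\<lambda>b. exp (- pi * t * (of_int r)\<^sup>2) * ((cos (2 * pi * of_int (r - j) * b) + cos (2 * pi * of_int (r + j) * b)) / 2))
         has_integral A r) {0..1}"
        unfolding A_def by (intro has_integral_mult_right has_integral_divide has_integral_add cosint)
      also have "(\<lambda>b. exp (- pi * t * (of_int r)\<^sup>2) * ((cos (2 * pi * of_int (r - j) * b) + cos (2 * pi * of_int (r + j) * b)) / 2))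
         = (\<lambda>b. ?h r b * ?c b)"
        by (intro ext, unfold mult.assoc cos_times_cos) (simp add: algebra_simps)
      finally show ?thesis .
    qed
    obtain J where J: "(A has_sum J) UNIV" "((\<lambda>b. f b * ?c b) has_integral J) {0..1}"
    proof (rule has_sum_integral_exchange[OF _ _ _ _ A])
      show "uniform_limit {0..1} (\<lambda>X b. \<Sum>r\<in>X. ?h r b) f (finite_subsets_at_top UNIV)"
        unfolding f_def by (rule uniform_limit_on_subset[OF uniform_limit_gauss_series[OF t]]) simp
    qed (auto intro!: continuous_intros)
    have "(A has_sum exp (- pi * t * (of_int j)\<^sup>2)) UNIV"
      by (rule has_sum_finite_neutralI[where B = "{j, -j}"]; cases "j = 0") (auto simp: A_def)
    with J show ?thesis using has_sum_unique by blast
  qed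
  have zero: "d x = 0" if "x \<in> {0..1}" for x
  proof (rule zero_if_even_fourier_coeffs_zero[OF cd _ _ that])
    show "d (1 - x) = d x" for x by (simp add: d_def refl_f refl_g)
    fix j :: int
    have "((\<lambda>b. gauss_sum t b * cos (2 * pi * of_int j * b) - sqrt t * (f b * cos (2 * pi * of_int j * b)))
       has_integral (sqrt t * exp (- pi * t * (of_int j)\<^sup>2) - sqrt t * exp (- pi * t * (of_int j)\<^sup>2))) {0..1}"
      by (intro has_integral_diff has_integral_mult_right gauss_sum_fourier_coeff[OF t] sf)
    then show "((\<lambda>b. d b * cos (2 * pi * of_int j * b)) has_integral 0) {0..1}"
      by (simp add: d_def algebra_simps)
  qed
  have per_f: "f (x + of_int k) = f x" for x k
    unfolding f_def by (simp only: cos_2pi_int_add)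
  have "frac b \<in> {0..1}" using frac_lt_1[of b] by (auto simp: less_imp_le)
  from zero[OF this] have "gauss_sum t (frac b) = sqrt t * f (frac b)" by (simp add: d_def)
  moreover have "frac b = b + of_int (- \<lfloor>b\<rfloor>)" by (simp add: frac_def)
  ultimately show ?thesis using gauss_sum_periodic[of t b "- \<lfloor>b\<rfloor>"] per_f[of b "- \<lfloor>b\<rfloor>"] by (simp add: gs)
qed

subsection \<open>Fourier expansions of theta\<close>

definition qform :: "complex \<Rightarrow> int \<times> int \<Rightarrow> real" where
  "qform z p = (cmod (of_int (fst p) * z + of_int (snd p)))\<^sup>2 / Im z"

lemma qform_eq:
  assumes "Im z > 0"
  shows "qform z (m, n) = of_int m ^ 2 * Im z + (of_int n + of_int m * Re z)\<^sup>2 / Im z"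
  using assms by (simp add: qform_def cmod_power2 power_mult_distrib add_divide_distrib)
    (simp add: power2_eq_square add.commute)

lemma lattice_theta_qform: "lattice_theta \<alpha> z = (\<Sum>\<^sub>\<infinity>p. exp (- pi * \<alpha> * qform z p))"
  unfolding lattice_theta_def qform_def by (rule infsum_cong) auto

lemma qform_lower_bound:
  assumes "Im z > 0"
  obtains c where "c > 0" "\<And>m n. c * (of_int m ^ 2 + of_int n ^ 2) \<le> qform z (m, n)"
proof -
  define x y where "x = Re z" and "y = Im z"
  have y: "y > 0" using assms by (simp add: y_def)
  \<comment> \<open>With u = n + m x one has n^2 <= 2 u^2 + 2 (m x)^2. The summand 2 y of K pays for
    u^2, the other one for m^2.\<close>
  define K where "K = 2 * y + (2 * x\<^sup>2 + 1) / y"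
  have K: "K > 0" unfolding K_def using y by (simp add: add_pos_nonneg)
  have "of_int m ^ 2 + of_int n ^ 2 \<le> K * qform z (m, n)" for m n :: int
  proof -
    let ?m = "of_int m :: real" and ?u = "of_int n + of_int m * x :: real"
    have "(of_int n :: real)^2 = (?u - ?m * x)\<^sup>2" by simp
    also have "\<dots> \<le> 2 * ?u\<^sup>2 + 2 * (?m * x)\<^sup>2"
      using zero_le_power2[of "?u + ?m * x"] by (simp add: power2_eq_square algebra_simps)
    finally have "?m ^ 2 + of_int n ^ 2 \<le> 2 * ?u\<^sup>2 + (2 * x\<^sup>2 + 1) * ?m\<^sup>2"
      by (simp add: power_mult_distrib algebra_simps)
    also have "\<dots> = 2 * y * (?u\<^sup>2 / y) + ((2 * x\<^sup>2 + 1) / y) * (?m\<^sup>2 * y)"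
      using y by simp
    also have "\<dots> \<le> K * (?u\<^sup>2 / y) + K * (?m\<^sup>2 * y)"
      using y unfolding K_def by (intro add_mono mult_right_mono) auto
    also have "\<dots> = K * qform z (m, n)"
      using y by (subst qform_eq) (auto simp: x_def y_def algebra_simps)
    finally show ?thesis .
  qed
  then have "(1 / K) * (of_int m ^ 2 + of_int n ^ 2) \<le> qform z (m, n)" for m n :: int
    using K by (simp add: field_simps)
  then show ?thesis using K by (intro that[of "1 / K"]) auto
qed

lemma summable_gaussian_product:
  fixes a b :: real
  assumes "a > 0" "b > 0"
  shows "(\<lambda>(m, n). exp (- a * (of_int m)\<^sup>2) * exp (- b * (of_int n)\<^sup>2)) summable_on (UNIV :: (int \<times> int) set)"
proof -
  have "((\<lambda>m::int. exp (- a * (of_int m)\<^sup>2)) has_sum (\<Sum>\<^sub>\<infinity>m::int. exp (- a * (of_int m)\<^sup>2))) UNIV"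
       "((\<lambda>m::int. exp (- b * (of_int m)\<^sup>2)) has_sum (\<Sum>\<^sub>\<infinity>m::int. exp (- b * (of_int m)\<^sup>2))) UNIV"
    using summable_gaussian[of a 0] summable_gaussian[of b 0] assms by (auto intro!: has_sum_infsum)
  from has_sum_product_nonneg[OF this] show ?thesis
    by (auto simp: summable_on_def)
qed

lemma summable_lattice_theta:
  assumes "Im z > 0" "\<alpha> > 0"
  shows "(\<lambda>p. exp (- pi * \<alpha> * qform z p)) summable_on UNIV"
proof -
  obtain c where c: "c > 0" "\<And>m n. c * (of_int m ^ 2 + of_int n ^ 2) \<le> qform z (m, n)"
    using qform_lower_bound[OF assms(1)] by blast
  show ?thesis
  proof (rule summable_on_comparison_test)
    show "(\<lambda>(m, n). exp (- (pi * \<alpha> * c) * (of_int m)\<^sup>2) * exp (- (pi * \<alpha> * c) * (of_int n)\<^sup>2)) summable_on (UNIV :: (int \<times> int) set)"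
      using assms c by (intro summable_gaussian_product) auto
    fix p :: "int \<times> int"
    obtain m n where p: "p = (m, n)" by (cases p)
    have "pi * \<alpha> * (c * (of_int m ^ 2 + of_int n ^ 2)) \<le> pi * \<alpha> * qform z (m, n)"
      using assms c by (intro mult_left_mono) auto
    then show "exp (- pi * \<alpha> * qform z p) \<le> (case p of (m, n) \<Rightarrow> exp (- (pi * \<alpha> * c) * (of_int m)\<^sup>2) * exp (- (pi * \<alpha> * c) * (of_int n)\<^sup>2))"
      by (simp add: p exp_add[symmetric] algebra_simps)
  qed auto
qed

lemma has_sum_lattice_theta:
  assumes "Im z > 0" "\<alpha> > 0"
  shows "((\<lambda>p. exp (- pi * \<alpha> * qform z p)) has_sum lattice_theta \<alpha> z) UNIV"
  unfolding lattice_theta_qform using summable_lattice_theta[OF assms] by (rule has_sum_infsum)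

lemma lattice_theta_rows:
  assumes "Im z > 0" "\<alpha> > 0"
  shows "((\<lambda>m::int. exp (- pi * \<alpha> * Im z * (of_int m)\<^sup>2) * gauss_sum (Im z / \<alpha>) (of_int m * Re z)) has_sum lattice_theta \<alpha> z) UNIV"
proof (rule has_sum_SigmaD)
  show "((\<lambda>p. exp (- pi * \<alpha> * qform z p)) has_sum lattice_theta \<alpha> z) (Sigma UNIV (\<lambda>_. UNIV))"
    using has_sum_lattice_theta[OF assms] by simp
  fix m :: int
  have "((\<lambda>n. exp (- pi * \<alpha> * Im z * (of_int m)\<^sup>2) * exp (- pi * (of_int n + of_int m * Re z)\<^sup>2 / (Im z / \<alpha>))) has_sum
     (exp (- pi * \<alpha> * Im z * (of_int m)\<^sup>2) * gauss_sum (Im z / \<alpha>) (of_int m * Re z))) UNIV"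
    using assms by (intro has_sum_cmult_right has_sum_gauss_sum) auto
  also have "(\<lambda>n. exp (- pi * \<alpha> * Im z * (of_int m)\<^sup>2) * exp (- pi * (of_int n + of_int m * Re z)\<^sup>2 / (Im z / \<alpha>)))
     = (\<lambda>n. exp (- pi * \<alpha> * qform z (m, n)))"
    using assms by (simp add: qform_eq exp_add[symmetric] algebra_simps)
  finally show "((\<lambda>n. exp (- pi * \<alpha> * qform z (m, n))) has_sum
     (exp (- pi * \<alpha> * Im z * (of_int m)\<^sup>2) * gauss_sum (Im z / \<alpha>) (of_int m * Re z))) UNIV" .
qed

text \<open>
  The summands of theta after Poisson summation in each row; they are invariant under swapping the two indices
  together with \<open>\<alpha> \<mapsto> 1/\<alpha>\<close>.
\<close>

definition cos_theta :: "real \<Rightarrow> real \<Rightarrow> real \<Rightarrow> int \<times> int \<Rightarrow> real" where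
  "cos_theta \<alpha> x y p = exp (- pi * y * \<alpha> * (of_int (fst p))\<^sup>2) * exp (- pi * y / \<alpha> * (of_int (snd p))\<^sup>2)
      * cos (2 * pi * of_int (fst p) * of_int (snd p) * x)"

lemma summable_cos_theta:
  assumes "\<alpha> > 0" "y > 0"
  shows "cos_theta \<alpha> x y summable_on UNIV"
proof (rule abs_summable_summable, rule Infinite_Sum.abs_summable_on_comparison_test')
  show "(\<lambda>(m, n). exp (- (pi * y * \<alpha>) * (of_int m)\<^sup>2) * exp (- (pi * y / \<alpha>) * (of_int n)\<^sup>2)) summable_on (UNIV :: (int \<times> int) set)"
    using assms by (intro summable_gaussian_product) auto
  show "norm (cos_theta \<alpha> x y p) \<le> (case p of (m, n) \<Rightarrow> exp (- (pi * y * \<alpha>) * (of_int m)\<^sup>2) * exp (- (pi * y / \<alpha>) * (of_int n)\<^sup>2))" for p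
    by (cases p) (auto simp: cos_theta_def abs_mult mult.assoc intro!: mult_left_le)
qed

lemma lattice_theta_cos:
  assumes "Im z > 0" "\<alpha> > 0"
  shows "lattice_theta \<alpha> z = sqrt (Im z / \<alpha>) * (\<Sum>\<^sub>\<infinity>p. cos_theta \<alpha> (Re z) (Im z) p)"
proof -
  define y where "y = Im z"
  have y: "y > 0" using assms by (simp add: y_def)
  have row: "sqrt (y / \<alpha>) * (\<Sum>\<^sub>\<infinity>r. cos_theta \<alpha> (Re z) y (m, r))
      = exp (- pi * \<alpha> * y * (of_int m)\<^sup>2) * gauss_sum (y / \<alpha>) (of_int m * Re z)" for m
  proof -
    have "(\<Sum>\<^sub>\<infinity>r. cos_theta \<alpha> (Re z) y (m, r)) = (\<Sum>\<^sub>\<infinity>r. exp (- pi * \<alpha> * y * (of_int m)\<^sup>2) *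
        (exp (- pi * (y / \<alpha>) * (of_int r)\<^sup>2) * cos (2 * pi * of_int r * (of_int m * Re z))))"
      by (rule infsum_cong) (simp add: cos_theta_def algebra_simps)
    also have "\<dots> = exp (- pi * \<alpha> * y * (of_int m)\<^sup>2) *
       (\<Sum>\<^sub>\<infinity>r::int. exp (- pi * (y / \<alpha>) * (of_int r)\<^sup>2) * cos (2 * pi * of_int r * (of_int m * Re z)))"
      by (rule infsum_cmult_right')
    finally show ?thesis
      using y assms by (simp add: gauss_sum_poisson gauss_series_def)
  qed
  have "lattice_theta \<alpha> z = (\<Sum>\<^sub>\<infinity>m. sqrt (y / \<alpha>) * (\<Sum>\<^sub>\<infinity>r. cos_theta \<alpha> (Re z) y (m, r)))"
    unfolding row unfolding y_def by (rule infsumI[symmetric, OF lattice_theta_rows[OF assms]])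
  also have "\<dots> = sqrt (y / \<alpha>) * (\<Sum>\<^sub>\<infinity>m. \<Sum>\<^sub>\<infinity>r. cos_theta \<alpha> (Re z) y (m, r))"
    by (rule infsum_cmult_right')
  also have "(\<Sum>\<^sub>\<infinity>m. \<Sum>\<^sub>\<infinity>r. cos_theta \<alpha> (Re z) y (m, r)) = (\<Sum>\<^sub>\<infinity>p. cos_theta \<alpha> (Re z) y p)"
    using infsum_Sigma_banach[of "cos_theta \<alpha> (Re z) y" UNIV "\<lambda>_. UNIV"] summable_cos_theta[OF assms(2) y] by simp
  finally show ?thesis by (simp add: y_def)
qed

lemma lattice_theta_inverse:
  assumes "Im z > 0" "\<alpha> > 0"
  shows "lattice_theta (1 / \<alpha>) z = \<alpha> * lattice_theta \<alpha> z"
proof -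
  have "(\<Sum>\<^sub>\<infinity>p. cos_theta (1 / \<alpha>) (Re z) (Im z) p) = (\<Sum>\<^sub>\<infinity>p. cos_theta \<alpha> (Re z) (Im z) p)"
    by (rule infsum_reindex_bij_witness[where i = prod.swap and j = prod.swap])
       (auto simp: cos_theta_def algebra_simps)
  then have "lattice_theta (1 / \<alpha>) z = sqrt (Im z * \<alpha>) * (\<Sum>\<^sub>\<infinity>p. cos_theta \<alpha> (Re z) (Im z) p)"
    using assms by (simp add: lattice_theta_cos)
  also have "sqrt (Im z * \<alpha>) = \<alpha> * sqrt (Im z / \<alpha>)"
    using assms by (simp add: real_sqrt_mult real_sqrt_divide field_simps)
  finally show ?thesis using assms by (simp add: lattice_theta_cos)
qed

subsection \<open>Moving to the line of real part one half\<close>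

lemma has_sum_diff:
  fixes f g :: "_ \<Rightarrow> 'a :: topological_ab_group_add"
  assumes "(f has_sum a) A" "(g has_sum b) A"
  shows "((\<lambda>x. f x - g x) has_sum (a - b)) A"
  using has_sum_add[OF assms(1), of "\<lambda>x. - g x" "- b"] assms(2) by (simp add: has_sum_uminus)

section \<open>The horizontal move for large y/\<alpha>: variation of cosines against Gaussian
  moments\<close>

lemma abs_sin_int_mult_le: "\<bar>sin (of_int k * u)\<bar> \<le> \<bar>of_int k\<bar> * \<bar>sin (u::real)\<bar>"
proof -
  have nat: "\<bar>sin (of_nat n * u)\<bar> \<le> of_nat n * \<bar>sin u\<bar>" for n
  proof (induction n)
    case (Suc n)
    have "\<bar>sin (of_nat (Suc n) * u)\<bar> = \<bar>sin (of_nat n * u) * cos u + cos (of_nat n * u) * sin u\<bar>"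
      by (simp add: sin_add algebra_simps)
    also have "\<dots> \<le> \<bar>sin (of_nat n * u)\<bar> * \<bar>cos u\<bar> + \<bar>cos (of_nat n * u)\<bar> * \<bar>sin u\<bar>"
      by (metis abs_mult abs_triangle_ineq)
    also have "\<dots> \<le> \<bar>sin (of_nat n * u)\<bar> * 1 + 1 * \<bar>sin u\<bar>"
      by (intro add_mono mult_left_mono mult_right_mono) auto
    finally show ?case using Suc by (simp add: algebra_simps)
  qed simp
  show ?thesis
  proof (cases "k \<ge> 0")
    case True
    then show ?thesis using nat[of "nat k"] by simp
  next
    case False
    then show ?thesis using nat[of "nat (- k)"] by simp
  qed
qed

text \<open>The difference is twice a product of two sines of k times an angle whose sine is cos (pi
  x). Each factor costs |k|, and 2 cos^2 (pi x) = 1 + cos (2 pi x) is exactly the variation for k =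
  1: every other frequency is measured against the main one.\<close>

lemma cos_diff_half_le:
  "\<bar>cos (2 * pi * of_int k * x) - cos (2 * pi * of_int k * (1/2))\<bar> \<le> (of_int k)\<^sup>2 * (1 + cos (2 * pi * x))"
proof -
  have "cos (2 * pi * of_int k * x) - cos (2 * pi * of_int k * (1/2))
      = 2 * sin (of_int k * (pi * x + pi / 2)) * sin (of_int k * (pi / 2 - pi * x))"
    by (subst cos_diff_cos) (simp add: algebra_simps add_divide_distrib diff_divide_distrib)
  also have "\<bar>\<dots>\<bar> = 2 * (\<bar>sin (of_int k * (pi * x + pi / 2))\<bar> * \<bar>sin (of_int k * (pi / 2 - pi * x))\<bar>)"
    by (simp add: abs_mult)
  also have "\<dots> \<le> 2 * ((\<bar>of_int k\<bar> * \<bar>sin (pi * x + pi / 2)\<bar>) * (\<bar>of_int k\<bar> * \<bar>sin (pi / 2 - pi * x)\<bar>))"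
    by (intro mult_left_mono mult_mono abs_sin_int_mult_le) auto
  also have "sin (pi * x + pi / 2) = cos (pi * x)" by (simp add: sin_add)
  also have "sin (pi / 2 - pi * x) = cos (pi * x)" by (simp add: sin_diff)
  also have "2 * ((\<bar>of_int k\<bar> * \<bar>cos (pi * x)\<bar>) * (\<bar>of_int k\<bar> * \<bar>cos (pi * x)\<bar>)) = (of_int k)\<^sup>2 * (2 * (cos (pi * x))\<^sup>2)"
    by (simp add: power2_eq_square abs_mult[symmetric] algebra_simps)
  also have "2 * (cos (pi * x))\<^sup>2 = 1 + cos (2 * pi * x)"
    using cos_double_cos[of "pi * x"] by (simp add: mult.assoc)
  finally show ?thesis .
qed

lemma exp_neg_2pi_le: "exp (- 2 * pi) \<le> 1 / 25"
proof -
  have "25 \<le> 1 + (6::real) + 6\<^sup>2 / 2" by simp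
  also have "\<dots> \<le> exp 6" by (rule exp_lower_Taylor_quadratic) simp
  also have "\<dots> \<le> exp (2 * pi)" using pi_gt3 by simp
  finally have "1 / exp (2 * pi) \<le> 1 / 25" by (intro divide_left_mono) auto
  then show ?thesis by (simp add: exp_minus inverse_eq_divide)
qed

text \<open>Put |m| = k + 2. Then m^2 <= 4 * 4^k, and a >= 1/2 gives a m^2 >= 4 a + 2 k, so each
  step in k costs exp (-2 pi) <= 1/8. What remains is geometric with ratio 4/8 = 1/2, and the sum of
  (1/2)^|m| over |m| >= 2 is 1.\<close>

lemma gaussian_moment_tail:
  assumes "a \<ge> 1/2"
  obtains T where "((\<lambda>m::int. if \<bar>m\<bar> \<ge> 2 then (of_int m)\<^sup>2 * exp (- pi * a * (of_int m)\<^sup>2) else 0) has_sum T) UNIV"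
    "T \<le> 16 * exp (- 4 * pi * a)"
proof -
  let ?f = "\<lambda>m::int. if \<bar>m\<bar> \<ge> 2 then (of_int m)\<^sup>2 * exp (- pi * a * (of_int m)\<^sup>2) else 0"
  let ?g = "\<lambda>m::int. 16 * exp (- 4 * pi * a) * (if \<bar>m\<bar> \<ge> 2 then (1/2) ^ nat \<bar>m\<bar> else (0::real))"
  have 1: "((\<lambda>m::int. (1/2) ^ nat \<bar>m\<bar>) has_sum (3::real)) UNIV"
    using has_sum_int_geometric[of "1/2"] by simp
  have 2: "((\<lambda>m::int. if \<bar>m\<bar> \<ge> 2 then 0 else (1/2) ^ nat \<bar>m\<bar>) has_sum (2::real)) UNIV"
    by (rule has_sum_finite_neutralI[where B = "{-1, 0, 1}"]) auto
  have "((\<lambda>m::int. (1/2) ^ nat \<bar>m\<bar> - (if \<bar>m\<bar> \<ge> 2 then 0 else (1/2) ^ nat \<bar>m\<bar>)) has_sum (3 - 2 :: real)) UNIV"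
    by (intro has_sum_diff 1 2)
  also have "(\<lambda>m::int. (1/2) ^ nat \<bar>m\<bar> - (if \<bar>m\<bar> \<ge> 2 then 0 else (1/2) ^ nat \<bar>m\<bar>)) =
      (\<lambda>m::int. if \<bar>m\<bar> \<ge> 2 then (1/2) ^ nat \<bar>m\<bar> else (0::real))" by auto
  finally have g: "(?g has_sum (16 * exp (- 4 * pi * a) * 1)) UNIV"
    by (intro has_sum_cmult_right) simp
  have le: "?f m \<le> ?g m" for m
  proof (cases "\<bar>m\<bar> \<ge> 2")
    case True
    define k where "k = nat \<bar>m\<bar> - 2"
    have k: "nat \<bar>m\<bar> = k + 2" "\<bar>of_int m :: real\<bar> = real k + 2"
      using True by (auto simp: k_def)
    have "(of_int m)\<^sup>2 = (real k + 2)\<^sup>2" by (metis k(2) power2_abs)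
    also have "\<dots> \<le> (2 * 2 ^ k)\<^sup>2"
    proof (rule power_mono)
      have "Suc k < 2 ^ Suc k" by (rule less_exp)
      then have "real (Suc (Suc k)) \<le> real (2 ^ Suc k)" by (intro of_nat_mono) simp
      then show "real k + 2 \<le> 2 * 2 ^ k" by simp
    qed auto
    also have "\<dots> = 4 * 4 ^ k" by (simp add: power_mult_distrib power2_eq_square power_mult_distrib[symmetric])
    finally have s: "(of_int m)\<^sup>2 \<le> (4 * 4 ^ k :: real)" .
    have msq: "(of_int m)\<^sup>2 = (4 + real k * (real k + 4))"
      unfolding \<open>(of_int m)\<^sup>2 = (real k + 2)\<^sup>2\<close> by (simp add: power2_eq_square algebra_simps)
    have "real k * 2 \<le> a * (real k * (real k + 4))"
    proof -
      have "real k * 2 \<le> (1/2) * (real k * (real k + 4))" by (simp add: algebra_simps)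
      also have "\<dots> \<le> a * (real k * (real k + 4))" using assms by (intro mult_right_mono) auto
      finally show ?thesis .
    qed
    then have "pi * (real k * 2) \<le> pi * (a * (real k * (real k + 4)))" by (intro mult_left_mono) auto
    then have "exp (- pi * a * (of_int m)\<^sup>2) \<le> exp (- 4 * pi * a + real k * (- 2 * pi))"
      unfolding msq by (simp add: algebra_simps)
    also have "\<dots> = exp (- 4 * pi * a) * exp (- 2 * pi) ^ k"
      by (simp add: exp_add exp_of_nat_mult[symmetric] exp_diff field_simps exp_minus)
    also have "\<dots> \<le> exp (- 4 * pi * a) * (1/8) ^ k"
      using exp_neg_2pi_le by (intro mult_left_mono power_mono) auto
    finally have e: "exp (- pi * a * (of_int m)\<^sup>2) \<le> exp (- 4 * pi * a) * (1/8) ^ k" .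
    have "(of_int m)\<^sup>2 * exp (- pi * a * (of_int m)\<^sup>2) \<le> 4 * 4 ^ k * (exp (- 4 * pi * a) * (1/8) ^ k)"
      by (intro mult_mono s e) auto
    also have "\<dots> = 4 * exp (- 4 * pi * a) * (4 * (1/8)) ^ k"
      by (simp only: power_mult_distrib) simp
    also have "\<dots> = ?g m" using True k by (simp add: power_add)
    finally show ?thesis using True by simp
  qed auto
  have f: "?f summable_on UNIV"
    by (rule summable_on_comparison_test[of ?g]) (use g le in \<open>auto simp: summable_on_def\<close>)
  show ?thesis
  proof (rule that)
    show "(?f has_sum infsum ?f UNIV) UNIV" using f by simp
    then show "infsum ?f UNIV \<le> 16 * exp (- 4 * pi * a)"
      using has_sum_mono[OF _ g] le by (metis (no_types, lifting) mult.right_neutral)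
  qed
qed

text \<open>The terms m = 1 and m = -1 give 2, the tail at most 16/20. Two such moments are later
  multiplied and compared with 8, so the constant must stay below sqrt 8; (14/5)^2 = 7.84.\<close>

lemma gaussian_second_moment:
  assumes "a \<ge> 1/2"
  obtains U where "((\<lambda>m::int. (of_int m)\<^sup>2 * exp (- pi * a * (of_int m)\<^sup>2)) has_sum U) UNIV"
    "U \<le> (14/5) * exp (- pi * a)" "U \<ge> 0"
proof -
  obtain T where T: "((\<lambda>m::int. if \<bar>m\<bar> \<ge> 2 then (of_int m)\<^sup>2 * exp (- pi * a * (of_int m)\<^sup>2) else 0) has_sum T) UNIV"
    "T \<le> 16 * exp (- 4 * pi * a)"
    using gaussian_moment_tail[OF assms] by blast
  have "((\<lambda>m::int. if \<bar>m\<bar> \<ge> 2 then 0 else (of_int m)\<^sup>2 * exp (- pi * a * (of_int m)\<^sup>2)) has_sum (2 * exp (- pi * a))) UNIV"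
    by (rule has_sum_finite_neutralI[where B = "{-1, 0, 1}"]) auto
  from has_sum_add[OF T(1) this]
  have U: "((\<lambda>m::int. (of_int m)\<^sup>2 * exp (- pi * a * (of_int m)\<^sup>2)) has_sum (T + 2 * exp (- pi * a))) UNIV"
    by (rule back_subst[of "\<lambda>f. (f has_sum _) _"]) auto
  have "exp (- 4 * pi * a) = exp (- pi * a) * exp (- 3 * pi * a)"
    by (simp add: exp_add[symmetric])
  also have "exp (- 3 * pi * a) \<le> 1 / 20"
  proof -
    have "20 \<le> (1 + (9/4) + (9/4)\<^sup>2 / 2 :: real) ^ 2" by (simp add: power2_eq_square)
    also have "\<dots> \<le> exp (9/4) ^ 2" by (intro power_mono exp_lower_Taylor_quadratic) auto
    also have "\<dots> = exp (9 * (1 / 2))" by (simp add: exp_of_nat_mult[symmetric])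
    also have "\<dots> \<le> exp (3 * pi * a)"
    proof -
      have "9 * (1 / 2) \<le> (3 * pi) * a" using pi_gt3 assms by (intro mult_mono) auto
      then show ?thesis by simp
    qed
    finally have "1 / exp (3 * pi * a) \<le> 1 / 20" by (intro divide_left_mono) auto
    then show ?thesis by (simp add: exp_minus inverse_eq_divide)
  qed
  finally have "exp (- 4 * pi * a) \<le> exp (- pi * a) * (1 / 20)" by simp
  then have "T + 2 * exp (- pi * a) \<le> (14/5) * exp (- pi * a)" using T(2) by simp
  moreover have "T + 2 * exp (- pi * a) \<ge> 0" by (rule has_sum_nonneg[OF U]) auto
  ultimately show ?thesis using U that by blast
qed


lemma qform_Complex:
  assumes "y > 0"
  shows "qform (Complex x y) (m, n) = of_int m ^ 2 * y + (of_int n + of_int m * x)\<^sup>2 / y"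
  using qform_eq[of "Complex x y"] assms by simp

text \<open>
  Only the four summands with \<open>|m| = |r| = 1\<close> are needed: the variation of each other summand is at most
  \<open>(m r)\<^sup>2 (1 + cos (2 pi x))\<close> times its weight, and these weights sum to less than the main terms.
\<close>

lemma lattice_theta_horizontal_large:
  assumes \<alpha>: "\<alpha> > 0" and "y * \<alpha> \<ge> 1/2" and "y / \<alpha> \<ge> 1/2"
  obtains c where "c > 0" "c * (1 + cos (2 * pi * x)) \<le> lattice_theta \<alpha> (Complex x y) - lattice_theta \<alpha> (Complex (1/2) y)"
proof -
  have "y / \<alpha> > 0" using assms(3) by linarith
  then have y: "y > 0" using \<alpha> by (simp add: zero_less_divide_iff)
  define w where "w = 1 + cos (2 * pi * x)"
  have w: "w \<ge> 0" unfolding w_def using cos_ge_minus_one[of "2 * pi * x"] by linarith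
  obtain U where U: "((\<lambda>m::int. (of_int m)\<^sup>2 * exp (- pi * (y * \<alpha>) * (of_int m)\<^sup>2)) has_sum U) UNIV"
    "U \<le> (14/5) * exp (- pi * (y * \<alpha>))" "U \<ge> 0"
    using gaussian_second_moment[OF assms(2)] by blast
  obtain V where V: "((\<lambda>m::int. (of_int m)\<^sup>2 * exp (- pi * (y / \<alpha>) * (of_int m)\<^sup>2)) has_sum V) UNIV"
    "V \<le> (14/5) * exp (- pi * (y / \<alpha>))" "V \<ge> 0"
    using gaussian_second_moment[OF assms(3)] by blast
  define E where "E = exp (- pi * (y * \<alpha>)) * exp (- pi * (y / \<alpha>))"
  define W where "W p = exp (- pi * (y * \<alpha>) * (of_int (fst p))\<^sup>2) * exp (- pi * (y / \<alpha>) * (of_int (snd p))\<^sup>2)" for p :: "int \<times> int"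
  \<comment> \<open>\<open>w * L p\<close> is a lower bound for the change of the summand p. The
    subtracted moments run over all pairs and so remove E also at the four main pairs, whose exact
    gain is E; hence the 2 E there.\<close>
  define L where "L p = (if \<bar>fst p\<bar> = 1 \<and> \<bar>snd p\<bar> = 1 then 2 * E else 0) - (of_int (fst p))\<^sup>2 * (of_int (snd p))\<^sup>2 * W p" for p :: "int \<times> int"
  have "((\<lambda>p. if \<bar>fst p\<bar> = 1 \<and> \<bar>snd p\<bar> = 1 then 2 * E else 0) has_sum (8 * E)) (UNIV :: (int \<times> int) set)"
    by (rule has_sum_finite_neutralI[where B = "{(1,1),(1,-1),(-1,1),(-1,-1)}"]) (auto simp: abs_if split: if_splits)
  moreover have "((\<lambda>p. (of_int (fst p))\<^sup>2 * (of_int (snd p))\<^sup>2 * W p) has_sum (U * V)) UNIV"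
    using has_sum_product_nonneg[OF U(1) V(1)] by (simp add: W_def case_prod_unfold algebra_simps)
  ultimately have L: "(L has_sum (8 * E - U * V)) UNIV"
    unfolding L_def by (intro has_sum_diff)
  have "U * V \<le> ((14/5) * exp (- pi * (y * \<alpha>))) * ((14/5) * exp (- pi * (y / \<alpha>)))"
    using U V by (intro mult_mono) auto
  also have "\<dots> = 7.84 * E" by (simp add: E_def)
  also have "\<dots> < 8 * E" by (simp add: E_def)
  finally have pos: "8 * E - U * V > 0" by simp
  let ?D = "\<lambda>p. cos_theta \<alpha> x y p - cos_theta \<alpha> (1/2) y p"
  have "(?D has_sum ((\<Sum>\<^sub>\<infinity>p. cos_theta \<alpha> x y p) - (\<Sum>\<^sub>\<infinity>p. cos_theta \<alpha> (1/2) y p))) UNIV"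
    using summable_cos_theta[OF \<alpha> y] by (intro has_sum_diff has_sum_infsum)
  moreover have "w * L p \<le> ?D p" for p
  proof -
    obtain m n where p: "p = (m, n)" by (cases p)
    have D: "?D p = W p * (cos (2 * pi * of_int (m * n) * x) - cos (2 * pi * of_int (m * n) * (1/2)))"
      by (simp add: p cos_theta_def W_def algebra_simps)
    have W: "W p > 0" by (simp add: W_def)
    show ?thesis
    proof (cases "\<bar>m\<bar> = 1 \<and> \<bar>n\<bar> = 1")
      case True
      then have mn: "m = 1 \<or> m = -1" "n = 1 \<or> n = -1" by auto
      have "W p = E" using mn by (auto simp: W_def E_def p)
      moreover have "cos (2 * pi * of_int (m * n) * x) - cos (2 * pi * of_int (m * n) * (1/2)) = w"
        using mn by (auto simp: w_def)
      ultimately have "?D p = w * E" unfolding D by simp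
      moreover have "L p = E" using True mn \<open>W p = E\<close> by (auto simp: L_def p)
      ultimately show ?thesis by simp
    next
      case False
      have "w * L p = W p * - ((of_int (m * n))\<^sup>2 * w)"
        using False by (auto simp: L_def p power_mult_distrib)
      also have "\<dots> \<le> ?D p" unfolding D
        using W cos_diff_half_le[of "m * n" x, folded w_def] by (intro mult_left_mono) linarith+
      finally show ?thesis .
    qed
  qed
  ultimately have "w * (8 * E - U * V) \<le> (\<Sum>\<^sub>\<infinity>p. cos_theta \<alpha> x y p) - (\<Sum>\<^sub>\<infinity>p. cos_theta \<alpha> (1/2) y p)"
    using has_sum_cmult_right[OF L, of w] by (rule_tac has_sum_mono) auto
  then have "sqrt (y / \<alpha>) * (w * (8 * E - U * V)) \<le> sqrt (y / \<alpha>) * ((\<Sum>\<^sub>\<infinity>p. cos_theta \<alpha> x y p) - (\<Sum>\<^sub>\<infinity>p. cos_theta \<alpha> (1/2) y p))"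
    by (intro mult_left_mono) (use y \<alpha> in auto)
  also have "\<dots> = lattice_theta \<alpha> (Complex x y) - lattice_theta \<alpha> (Complex (1/2) y)"
    using y \<alpha> by (simp add: lattice_theta_cos algebra_simps)
  finally have "(sqrt (y / \<alpha>) * (8 * E - U * V)) * w \<le> lattice_theta \<alpha> (Complex x y) - lattice_theta \<alpha> (Complex (1/2) y)"
    by (simp add: mult_ac)
  moreover have "sqrt (y / \<alpha>) * (8 * E - U * V) > 0" using pos y \<alpha> by simp
  ultimately show ?thesis using that unfolding w_def by blast
qed

section \<open>The horizontal move for small y/\<alpha>: Gauss sums near 1/2 and near 0\<close>

lemma sinh_real_ge: "sinh u \<ge> u" if "u \<ge> 0" for u :: real
proof -
  have a: "exp u \<ge> 1 + u + u\<^sup>2 / 2" by (rule exp_lower_Taylor_quadratic[OF that])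
  have pos: "1 + u + u\<^sup>2 / 2 > 0" using that by (simp add: add_pos_nonneg)
  have "exp (- u) \<le> 1 / (1 + u + u\<^sup>2 / 2)"
    using divide_left_mono[OF a, of 1] pos by (simp add: exp_minus inverse_eq_divide)
  also have "\<dots> \<le> 1 - u + u\<^sup>2 / 2"
  proof -
    \<comment> \<open>The Taylor polynomials of exp u and exp (-u) have product 1 + u^4 / 4, so each
      dominates the reciprocal of the other.\<close>
    have "1 \<le> 1 + u ^ 4 / 4" by simp
    also have "\<dots> = (1 - u + u\<^sup>2 / 2) * (1 + u + u\<^sup>2 / 2)"
      by (simp add: algebra_simps power2_eq_square power4_eq_xxxx)
    finally show ?thesis using pos by (simp add: pos_divide_le_eq)
  qed
  finally show ?thesis using a by (simp add: sinh_def)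
qed

lemma cosh_real_ge_quadratic: "cosh v \<ge> 1 + v\<^sup>2 / 2" if "v \<ge> 0" for v :: real
proof -
  have "cosh v = 2 * (cosh (v / 2))\<^sup>2 - 1" using cosh_double_cosh[of "v / 2"] by simp
  also have "\<dots> = 1 + 2 * (sinh (v / 2))\<^sup>2" by (simp add: cosh_square_eq)
  also have "\<dots> \<ge> 1 + 2 * (v / 2)\<^sup>2"
    using that sinh_real_ge[of "v / 2"] by (intro add_left_mono mult_left_mono power_mono) auto
  finally show ?thesis by (simp add: power2_eq_square)
qed

text \<open>The left side is the average of the Gaussian terms at 1/2 - d and 1/2 + d relative to
  the term at 1/2, with v = pi d / t. If v d <= 1/2, the bounds 1 - v d and 1 + v^2 / 2 give at
  least 1 + v d / 2. Otherwise v >= 1.73, and exp (v (1 - d)) / 2 alone exceeds 1.1, the value of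
  the right side at d = 1/2.\<close>

lemma exp_cosh_lower_bound:
  fixes d v :: real
  assumes d: "0 \<le> d" "d \<le> 1/2" and v: "v \<ge> 6 * d"
  shows "exp (- v * d) * cosh v \<ge> 1 + (2/5) * d\<^sup>2"
proof -
  have v0: "v \<ge> 0" using assms by linarith
  have d2: "d\<^sup>2 \<le> 1/4" using power_mono[OF d(2) d(1), of 2] by (simp add: power2_eq_square)
  have vd: "6 * d\<^sup>2 \<le> v * d" using mult_right_mono[OF v d(1)] by (simp add: power2_eq_square)
  show ?thesis
  proof (cases "v * d \<le> 1/2")
    case True
    have "(1 - v * d) * (1 + v\<^sup>2 / 2) = 1 - v * d + v\<^sup>2 / 2 * (1 - v * d)"
      by (simp add: algebra_simps)
    also have "v\<^sup>2 / 2 * (1 - v * d) \<ge> v\<^sup>2 / 2 * (1/2)"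
      using True by (intro mult_left_mono) auto
    then have "1 - v * d + v\<^sup>2 / 2 * (1 - v * d) \<ge> 1 - v * d + v\<^sup>2 / 4" by simp
    moreover have "v\<^sup>2 \<ge> 6 * (v * d)" using mult_left_mono[OF v v0] by (simp add: power2_eq_square algebra_simps)
    ultimately have "(1 - v * d) * (1 + v\<^sup>2 / 2) \<ge> 1 + (v * d) / 2" by linarith
    moreover have "exp (- v * d) * cosh v \<ge> (1 - v * d) * (1 + v\<^sup>2 / 2)"
      using True exp_ge_add_one_self[of "- v * d"] cosh_real_ge_quadratic[OF v0] by (intro mult_mono) auto
    moreover have "(v * d) / 2 \<ge> (2/5) * d\<^sup>2" using vd zero_le_power2[of d] by linarith
    ultimately show ?thesis by linarith
  next
    case False
    have "v * v \<ge> 6 * (v * d)" using mult_left_mono[OF v v0] by (simp add: algebra_simps)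
    then have "v * v > 3" using False by linarith
    then have "1.73\<^sup>2 \<le> v\<^sup>2" by (simp add: power2_eq_square)
    then have "v \<ge> 1.73" using v0 by (rule power2_le_imp_le)
    define a where "a = v * (1 - d)"
    have "a \<ge> 1.73 * (1/2)" unfolding a_def using \<open>v \<ge> 1.73\<close> d by (intro mult_mono) auto
    then have a: "a \<ge> 0.865" by simp
    have "2.23 \<le> 1 + 0.865 + (0.865::real)\<^sup>2 / 2" by (simp add: power2_eq_square)
    also have "\<dots> \<le> 1 + a + a\<^sup>2 / 2" using a by (intro add_mono divide_right_mono power_mono) auto
    also have "\<dots> \<le> exp a" using a by (intro exp_lower_Taylor_quadratic) auto
    finally have ea: "exp a \<ge> 2.23" .
    have "exp (- v * d) * cosh v = (exp a + exp (- v * d - v)) / 2"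
      by (simp add: cosh_def a_def exp_add[symmetric] distrib_left algebra_simps)
    also have "\<dots> \<ge> exp a / 2" by simp
    finally show ?thesis using ea d2 by simp
  qed
qed

lemma gauss_sum_at_half_lower:
  assumes "t > 0"
  shows "gauss_sum t (1/2) \<ge> 2 * exp (- pi / (4 * t))"
proof -
  have "(\<Sum>n\<in>{0, -1::int}. exp (- pi * (of_int n + 1/2)\<^sup>2 / t)) \<le> gauss_sum t (1/2)"
    by (rule finite_sum_le_has_sum[OF has_sum_gauss_sum[OF assms]]) auto
  then show ?thesis by (simp add: power2_eq_square)
qed

text \<open>The shifts 1/2 - d and 1/2 + d give the same sum and may be averaged term by term.
  Relative to the term at 1/2 the average is exp (-v d) cosh (2 u v) with u = n + 1/2. Since |u| >=
  1/2, cosh v is the worst case, and t <= 1/2 makes v at least 6 d.\<close>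

lemma gauss_sum_ge_half_aux:
  assumes t: "t > 0" "t \<le> 1/2" and d: "0 \<le> d" "d \<le> 1/2"
  shows "gauss_sum t (1/2 - d) \<ge> (1 + (2/5) * d\<^sup>2) * gauss_sum t (1/2)"
proof -
  define v where "v = pi * d / t"
  have v: "v \<ge> 6 * d"
  proof -
    have "pi / t \<ge> 3 / (1/2)" using t pi_gt3 by (intro frac_le) auto
    then show ?thesis unfolding v_def using d mult_right_mono[of 6 "pi / t" d] by simp
  qed
  let ?e = "\<lambda>b (n::int). exp (- pi * (of_int n + b)\<^sup>2 / t)"
  have "gauss_sum t (1/2 + d) = gauss_sum t (- (1/2 - d))"
    using gauss_sum_periodic[of t "- (1/2 - d)" 1] by simp
  then have eq: "gauss_sum t (1/2 + d) = gauss_sum t (1/2 - d)" by (simp only: gauss_sum_minus)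
  have "((\<lambda>n. (?e (1/2 - d) n + ?e (1/2 + d) n) * (1/2)) has_sum ((gauss_sum t (1/2 - d) + gauss_sum t (1/2 + d)) * (1/2))) UNIV"
    by (intro has_sum_cmult_left has_sum_add has_sum_gauss_sum t)
  moreover have "((\<lambda>n. (1 + (2/5) * d\<^sup>2) * ?e (1/2) n) has_sum ((1 + (2/5) * d\<^sup>2) * gauss_sum t (1/2))) UNIV"
    by (intro has_sum_cmult_right has_sum_gauss_sum t)
  moreover have "(1 + (2/5) * d\<^sup>2) * ?e (1/2) n \<le> (?e (1/2 - d) n + ?e (1/2 + d) n) * (1/2)" for n
  proof -
    define u where "u = (of_int n + 1/2 :: real)"
    have u: "1 \<le> 2 * \<bar>u\<bar>" unfolding u_def by (cases "n \<ge> 0") (auto simp: abs_if)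
    have e1: "?e (1/2 - d) n = ?e (1/2) n * (exp (- v * d) * exp (2 * u * v))"
      using t by (simp add: u_def v_def exp_add[symmetric] field_simps power2_eq_square)
    have e2: "?e (1/2 + d) n = ?e (1/2) n * (exp (- v * d) * exp (- (2 * u * v)))"
      using t by (simp add: u_def v_def exp_add[symmetric] field_simps power2_eq_square)
    have "(?e (1/2 - d) n + ?e (1/2 + d) n) * (1/2) = ?e (1/2) n * (exp (- v * d) * cosh (2 * u * v))"
      unfolding e1 e2 cosh_def by (simp add: algebra_simps)
    moreover have "cosh v \<le> cosh (2 * u * v)"
    proof -
      have "v \<le> 2 * \<bar>u\<bar> * v" using mult_right_mono[OF u, of v] v d by simp
      then have "cosh v \<le> cosh (\<bar>2 * u * v\<bar>)"
        using v d by (subst cosh_real_nonneg_le_iff) (auto simp: abs_mult)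
      then show ?thesis by (simp only: cosh_real_abs)
    qed
    then have "exp (- v * d) * cosh (2 * u * v) \<ge> exp (- v * d) * cosh v" by simp
    then have "exp (- v * d) * cosh (2 * u * v) \<ge> 1 + (2/5) * d\<^sup>2"
      using exp_cosh_lower_bound[OF d v] by linarith
    ultimately show ?thesis by (simp add: mult.commute)
  qed
  ultimately have "(1 + (2/5) * d\<^sup>2) * gauss_sum t (1/2) \<le> (gauss_sum t (1/2 - d) + gauss_sum t (1/2 + d)) * (1/2)"
    by (rule_tac has_sum_mono) auto
  then show ?thesis by (simp add: eq)
qed

lemma gauss_sum_ge_half:
  assumes t: "t > 0" "t \<le> 1/2" and d: "\<bar>d\<bar> \<le> 1/2"
  shows "gauss_sum t (1/2 - d) \<ge> (1 + (2/5) * d\<^sup>2) * gauss_sum t (1/2)"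
proof (cases "d \<ge> 0")
  case True
  then show ?thesis using gauss_sum_ge_half_aux[OF t, of d] d by simp
next
  case False
  have "gauss_sum t (1/2 - d) = gauss_sum t (- (1/2 + d))"
    using gauss_sum_periodic[of t "- (1/2 + d)" 1] by simp
  also have "\<dots> = gauss_sum t (1/2 - (- d))" by (simp only: gauss_sum_minus) simp
  finally show ?thesis using gauss_sum_ge_half_aux[OF t, of "- d"] False d by simp
qed

lemma gauss_sum_minimum:
  assumes t: "t > 0" "t \<le> 1/2"
  shows "gauss_sum t b \<ge> gauss_sum t (1/2)"
proof -
  define d where "d = 1/2 - frac b"
  have "\<bar>d\<bar> \<le> 1/2" using frac_ge_0[of b] frac_lt_1[of b] unfolding d_def abs_le_iff by linarith
  then have "gauss_sum t (1/2 - d) \<ge> (1 + (2/5) * d\<^sup>2) * gauss_sum t (1/2)"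
    by (rule gauss_sum_ge_half[OF t])
  moreover have "(1 + (2/5) * d\<^sup>2) * gauss_sum t (1/2) \<ge> 1 * gauss_sum t (1/2)"
    by (intro mult_right_mono) (auto simp: gauss_sum_def infsum_nonneg)
  moreover have "gauss_sum t (1/2 - d) = gauss_sum t b"
    using gauss_sum_periodic[of t b "- \<lfloor>b\<rfloor>"] by (simp add: d_def frac_def)
  ultimately show ?thesis by simp
qed

text \<open>Averaging the shifts b and -b multiplies each term by exp (-pi b^2 / t) times a
  hyperbolic cosine, which is at least 1. This limits the loss in even rows.\<close>

lemma gauss_sum_ge_zero:
  assumes t: "t > 0"
  shows "gauss_sum t b \<ge> (1 - pi * b\<^sup>2 / t) * gauss_sum t 0"
proof -
  let ?e = "\<lambda>b (n::int). exp (- pi * (of_int n + b)\<^sup>2 / t)"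
  have "((\<lambda>n. (?e b n + ?e (- b) n) * (1/2)) has_sum ((gauss_sum t b + gauss_sum t (- b)) * (1/2))) UNIV"
    by (intro has_sum_cmult_left has_sum_add has_sum_gauss_sum t)
  moreover have "((\<lambda>n. (1 - pi * b\<^sup>2 / t) * ?e 0 n) has_sum ((1 - pi * b\<^sup>2 / t) * gauss_sum t 0)) UNIV"
    by (intro has_sum_cmult_right has_sum_gauss_sum t)
  moreover have "(1 - pi * b\<^sup>2 / t) * ?e 0 n \<le> (?e b n + ?e (- b) n) * (1/2)" for n
  proof -
    define v where "v = 2 * pi * of_int n * b / t"
    have e1: "?e b n = ?e 0 n * (exp (- (pi * b\<^sup>2 / t)) * exp (- v))"
      using t by (simp add: v_def exp_add[symmetric] field_simps power2_eq_square)
    have e2: "?e (- b) n = ?e 0 n * (exp (- (pi * b\<^sup>2 / t)) * exp v)"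
      using t by (simp add: v_def exp_add[symmetric] field_simps power2_eq_square)
    have "(?e b n + ?e (- b) n) * (1/2) = ?e 0 n * (exp (- (pi * b\<^sup>2 / t)) * cosh v)"
      unfolding e1 e2 cosh_def by (simp add: algebra_simps)
    moreover have "?e 0 n * (exp (- (pi * b\<^sup>2 / t)) * cosh v) \<ge> ?e 0 n * (exp (- (pi * b\<^sup>2 / t)) * 1)"
      by (intro mult_left_mono cosh_real_ge_1) auto
    moreover have "?e 0 n * (exp (- (pi * b\<^sup>2 / t)) * 1) \<ge> ?e 0 n * (1 - pi * b\<^sup>2 / t)"
      using exp_ge_add_one_self[of "- (pi * b\<^sup>2 / t)"] by (intro mult_left_mono) auto
    ultimately show ?thesis by (simp only: mult.commute[of "?e 0 n"] mult_1_right)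
  qed
  ultimately have "(1 - pi * b\<^sup>2 / t) * gauss_sum t 0 \<le> (gauss_sum t b + gauss_sum t (- b)) * (1/2)"
    by (rule_tac has_sum_mono) auto
  then show ?thesis by (simp add: gauss_sum_minus)
qed

lemma gauss_sum_zero_le:
  assumes t: "t > 0" "t \<le> 1/2"
  shows "gauss_sum t 0 \<le> 2"
proof (rule has_sum_mono[OF has_sum_gauss_sum[OF t(1)]])
  show "((\<lambda>n::int. (1/3) ^ nat \<bar>n\<bar>) has_sum (2::real)) UNIV"
    using has_sum_int_geometric[of "1/3"] by simp
  fix n :: int
  have "\<bar>of_int n\<bar> \<le> (of_int n :: real)\<^sup>2"
  proof (cases "n = 0")
    case False
    then have "1 \<le> \<bar>of_int n :: real\<bar>" by linarith
    from mult_right_mono[OF this, of "\<bar>of_int n\<bar>"] show ?thesis by (simp add: power2_eq_square abs_mult[symmetric])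
  qed auto
  then have "2 * pi * \<bar>of_int n\<bar> \<le> pi / t * (of_int n)\<^sup>2"
    using t by (intro mult_mono) (auto simp: field_simps)
  then have "exp (- pi * (of_int n + 0)\<^sup>2 / t) \<le> exp (real (nat \<bar>n\<bar>) * (- 2 * pi))"
    by (simp add: algebra_simps)
  also have "\<dots> = exp (- 2 * pi) ^ nat \<bar>n\<bar>" by (rule exp_of_nat_mult)
  also have "\<dots> \<le> (1/3) ^ nat \<bar>n\<bar>"
    using exp_neg_2pi_le by (intro power_mono) auto
  finally show "exp (- pi * (of_int n + 0)\<^sup>2 / t) \<le> (1/3) ^ nat \<bar>n\<bar>" .
qed

text \<open>
  Here the rows are compared directly: the rows \<open>m = \<plusminus>1\<close> gain a multiple of \<open>(x - 1/2)\<^sup>2\<close>, odd rows cannot lose since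
  the Gauss sum is smallest at \<open>1/2\<close>, and even rows lose an amount that is exponentially smaller.
\<close>

lemma lattice_theta_horizontal_small:
  assumes \<alpha>: "\<alpha> > 0" and y: "y > 0" "y\<^sup>2 \<ge> 3/4" and t: "y / \<alpha> \<le> 1/2" and x: "0 \<le> x" "x \<le> 1"
  obtains c where "c > 0" "c * (x - 1/2)\<^sup>2 \<le> lattice_theta \<alpha> (Complex x y) - lattice_theta \<alpha> (Complex (1/2) y)"
proof -
  define t d where "t = y / \<alpha>" and "d = 1/2 - x"
  have t: "t > 0" "t \<le> 1/2" using assms by (auto simp: t_def)
  have d: "\<bar>d\<bar> \<le> 1/2" using x unfolding d_def abs_le_iff by linarith
  have xd: "x = 1/2 - d" by (simp add: d_def)
  define a where "a = \<alpha> * y"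
  \<comment> \<open>The product is y^2. A small t thus forces a large a, which makes the rows with
    |m| >= 2 negligible.\<close>
  have at: "a * t \<ge> 3/4" using y \<alpha> by (simp add: a_def t_def power2_eq_square)
  have a: "a \<ge> 3 / (4 * t)" using at t by (simp add: field_simps)
  also have "3 / (4 * t) \<ge> 3 / (4 * (1/2))" using t by (intro divide_left_mono) auto
  finally have a1: "a \<ge> 1/2" by simp
  obtain T where T: "((\<lambda>m::int. if \<bar>m\<bar> \<ge> 2 then (of_int m)\<^sup>2 * exp (- pi * a * (of_int m)\<^sup>2) else 0) has_sum T) UNIV"
    "T \<le> 16 * exp (- 4 * pi * a)"
    using gaussian_moment_tail[OF a1] by blast
  let ?e = "\<lambda>m::int. exp (- pi * a * (of_int m)\<^sup>2)"
  let ?D = "\<lambda>m::int. ?e m * gauss_sum t (of_int m * x) - ?e m * gauss_sum t (of_int m * (1/2))"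
  have D: "(?D has_sum (lattice_theta \<alpha> (Complex x y) - lattice_theta \<alpha> (Complex (1/2) y))) UNIV"
    using lattice_theta_rows[of "Complex x y" \<alpha>] lattice_theta_rows[of "Complex (1/2) y" \<alpha>] y \<alpha>
    by (intro has_sum_diff) (simp_all add: t_def a_def mult_ac)
  \<comment> \<open>A is the gain of each of the rows m = 1 and m = -1: relative gain (2/5) d^2
    times the two nearest terms of \<open>gauss_sum t (1/2)\<close>. An even row loses at most B m^2
    times its weight, because \<open>gauss_sum t 0\<close> is at most 2.\<close>
  define A where "A = exp (- pi * a) * ((4/5) * d\<^sup>2 * exp (- pi / (4 * t)))"
  define B where "B = 2 * pi * d\<^sup>2 / t"
  let ?L = "\<lambda>m::int. (if \<bar>m\<bar> = 1 then A else 0) - B * (if \<bar>m\<bar> \<ge> 2 then (of_int m)\<^sup>2 * ?e m else 0)"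
  have "((\<lambda>m::int. if \<bar>m\<bar> = 1 then A else 0) has_sum (2 * A)) UNIV"
    by (rule has_sum_finite_neutralI[where B = "{-1, 1}"]) (auto simp: abs_if split: if_splits)
  then have L: "(?L has_sum (2 * A - B * T)) UNIV"
    by (intro has_sum_diff has_sum_cmult_right T)
  have "?L m \<le> ?D m" for m
  proof -
    consider "m = 0" | "\<bar>m\<bar> = 1" | "\<bar>m\<bar> \<ge> 2" by linarith
    then show ?thesis
    proof cases
      case 1 then show ?thesis by simp
    next
      case 2
      then have "m = 1 \<or> m = -1" by auto
      then have g: "gauss_sum t (of_int m * x) = gauss_sum t x" "gauss_sum t (of_int m * (1/2)) = gauss_sum t (1/2)" "?e m = exp (- pi * a)"
        using gauss_sum_minus[of t x] gauss_sum_minus[of t "1/2"] by auto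
      have "gauss_sum t x - gauss_sum t (1/2) \<ge> (2/5) * d\<^sup>2 * gauss_sum t (1/2)"
        using gauss_sum_ge_half[OF t d] by (simp add: xd[symmetric] algebra_simps)
      moreover have "(2/5) * d\<^sup>2 * gauss_sum t (1/2) \<ge> (2/5) * d\<^sup>2 * (2 * exp (- pi / (4 * t)))"
        using gauss_sum_at_half_lower[OF t(1)] by (intro mult_left_mono) auto
      ultimately have "gauss_sum t x - gauss_sum t (1/2) \<ge> (4/5) * d\<^sup>2 * exp (- pi / (4 * t))" by simp
      then have "exp (- pi * a) * (gauss_sum t x - gauss_sum t (1/2)) \<ge> A"
        unfolding A_def by (intro mult_left_mono) auto
      then show ?thesis using 2 by (simp only: g) (simp add: algebra_simps)
    next
      case 3
      have "gauss_sum t (of_int m * x) - gauss_sum t (of_int m * (1/2)) \<ge> - (B * (of_int m)\<^sup>2)"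
      proof (cases "even m")
        case True
        then obtain j where j: "m = 2 * j" by blast
        have "gauss_sum t (of_int m * x) = gauss_sum t (- (of_int m * d) + of_int j)"
          by (rule arg_cong[of _ _ "gauss_sum t"]) (simp add: xd j algebra_simps)
        also have "\<dots> = gauss_sum t (of_int m * d)" by (simp only: gauss_sum_periodic gauss_sum_minus)
        finally have 1: "gauss_sum t (of_int m * x) \<ge> (1 - pi * (of_int m * d)\<^sup>2 / t) * gauss_sum t 0"
          using gauss_sum_ge_zero[OF t(1), of "of_int m * d"] by simp
        have 2: "gauss_sum t (of_int m * (1/2)) = gauss_sum t 0"
          using gauss_sum_periodic[of t 0 j] by (simp add: j)
        have "pi * (of_int m * d)\<^sup>2 / t * gauss_sum t 0 \<le> pi * (of_int m * d)\<^sup>2 / t * 2"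
          using gauss_sum_zero_le[OF t] t by (intro mult_left_mono) auto
        with 1 2 show ?thesis by (simp add: B_def algebra_simps power_mult_distrib)
      next
        case False
        then obtain j where j: "m = 2 * j + 1" by (elim oddE)
        have "gauss_sum t (of_int m * (1/2)) = gauss_sum t (1/2 + of_int j)"
          by (rule arg_cong[of _ _ "gauss_sum t"]) (simp add: j)
        then have "gauss_sum t (of_int m * x) \<ge> gauss_sum t (of_int m * (1/2))"
          using gauss_sum_minimum[OF t, of "of_int m * x"] by (simp only: gauss_sum_periodic)
        moreover have "B * (of_int m)\<^sup>2 \<ge> 0" using t by (simp add: B_def)
        ultimately show ?thesis by linarith
      qed
      then have "?e m * (gauss_sum t (of_int m * x) - gauss_sum t (of_int m * (1/2))) \<ge> ?e m * - (B * (of_int m)\<^sup>2)"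
        by (intro mult_left_mono) auto
      then show ?thesis using 3 by (simp add: algebra_simps)
    qed
  qed
  then have main: "2 * A - B * T \<le> lattice_theta \<alpha> (Complex x y) - lattice_theta \<alpha> (Complex (1/2) y)"
    using has_sum_mono[OF L D] by blast
  define w where "w = pi / t"
  have w: "w \<ge> 2 * pi" using t by (simp add: w_def field_simps)
  \<comment> \<open>The loss carries exp (-4 pi a), and a >= 3 / (4 t) bounds its excess over exp
    (-pi a) by exp (-pi / (4 t)) exp (-2 w). Positivity of the bracket amounts to 32 w exp (-2 w) <=
    32 exp (-w) < 32/20 = 8/5.\<close>
  define c where "c = exp (- pi * a) * exp (- pi / (4 * t)) * (8/5 - 32 * w * exp (- 2 * w))"
  have "w \<le> exp w" using exp_ge_add_one_self[of w] by linarith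
  then have "w * exp (- 2 * w) \<le> exp w * exp (- 2 * w)" by (intro mult_right_mono) auto
  also have "\<dots> = exp (- w)" by (simp add: exp_add[symmetric])
  also have "\<dots> \<le> exp (- 2 * pi)" using w by simp
  also have "\<dots> < 1 / 20" using exp_neg_2pi_le by simp
  finally have "c > 0" unfolding c_def by simp
  moreover have "c * (x - 1/2)\<^sup>2 \<le> 2 * A - B * T"
  proof -
    have "B \<ge> 0" using t by (simp add: B_def)
    then have "B * T \<le> B * (16 * exp (- 4 * pi * a))" using T(2) by (intro mult_left_mono) auto
    also have "exp (- 4 * pi * a) = exp (- pi * a) * exp (- 3 * pi * a)" by (simp add: exp_add[symmetric])
    also have "exp (- 3 * pi * a) \<le> exp (- pi / (4 * t)) * exp (- 2 * w)"
    proof -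
      have "3 * pi * (3 / (4 * t)) \<le> 3 * pi * a" using a by (intro mult_left_mono) auto
      moreover have "3 * pi * (3 / (4 * t)) = pi / (4 * t) + 2 * w" by (simp add: w_def field_simps)
      ultimately show ?thesis by (simp add: exp_add[symmetric])
    qed
    finally have "B * T \<le> B * (16 * (exp (- pi * a) * (exp (- pi / (4 * t)) * exp (- 2 * w))))"
      using \<open>B \<ge> 0\<close> by (simp add: mult_left_mono)
    moreover have "B = 2 * w * d\<^sup>2" by (simp add: B_def w_def)
    moreover have "(x - 1/2)\<^sup>2 = d\<^sup>2" by (simp add: d_def power2_commute)
    ultimately show ?thesis by (simp add: A_def c_def algebra_simps)
  qed
  ultimately show ?thesis using main that by (meson order_trans)
qed

subsection \<open>The line of real part one half\<close>

text \<open>For numerical bounds: the quadratic Taylor polynomial is accurate at x / n, and raising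
  it to the power n keeps the accuracy.\<close>

lemma exp_ge_power:
  assumes "0 \<le> x" "n > 0"
  shows "(1 + x / real n + (x / real n)\<^sup>2 / 2) ^ n \<le> exp (x::real)"
proof -
  have "(1 + x / real n + (x / real n)\<^sup>2 / 2) ^ n \<le> exp (x / real n) ^ n"
    using assms by (intro power_mono exp_lower_Taylor_quadratic) auto
  also have "\<dots> = exp x" using assms by (simp add: exp_of_nat_mult[symmetric])
  finally show ?thesis .
qed

lemma exp_neg_pi_le: "exp (- pi) \<le> 1 / 20"
proof -
  have "(20::real) \<le> (1 + 3.14 / 16 + (3.14 / 16)\<^sup>2 / 2) ^ 16" by (simp add: power_numeral_even power2_eq_square)
  also have "\<dots> \<le> exp 3.14" using exp_ge_power[of "3.14" 16] by simp
  also have "\<dots> \<le> exp pi" using pi_approx by simp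
  finally have "1 / exp pi \<le> 1 / 20" by (intro divide_left_mono) auto
  then show ?thesis by (simp add: exp_minus inverse_eq_divide)
qed

text \<open>The cube of u <= exp (u - 1) at u = pi y / 6, sharp at y = 6 / pi; the true maximum is
  (6 / (pi e))^3, about 0.347.\<close>

lemma cube_exp_le:
  assumes "y \<ge> 0"
  shows "y ^ 3 * exp (- pi * y / 2) \<le> (0.36::real)"
proof -
  have "pi * y / 6 \<le> exp (pi * y / 6 - 1)" using exp_ge_add_one_self[of "pi * y / 6 - 1"] by simp
  then have "(pi * y / 6) ^ 3 \<le> exp (pi * y / 6 - 1) ^ 3" using assms by (intro power_mono) auto
  also have "\<dots> = exp (pi * y / 2 - 3)" by (simp add: exp_of_nat_mult[symmetric] algebra_simps)
  finally have 1: "(pi / 6) ^ 3 * y ^ 3 \<le> exp (pi * y / 2 - 3)" by (simp add: power_mult_distrib power_divide)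
  have "(3.14 / 6) ^ 3 * y ^ 3 \<le> (pi / 6) ^ 3 * y ^ 3"
    using assms pi_approx by (intro mult_right_mono power_mono divide_right_mono) auto
  with 1 have "(3.14 / 6) ^ 3 * y ^ 3 \<le> exp (pi * y / 2 - 3)" by linarith
  then have "(3.14 / 6) ^ 3 * y ^ 3 * exp (- pi * y / 2) \<le> exp (pi * y / 2 - 3) * exp (- pi * y / 2)"
    by (intro mult_right_mono) auto
  also have "\<dots> = exp (- 3)" unfolding exp_add[symmetric] by simp
  also have "\<dots> = 1 / exp 3" by (simp add: exp_minus inverse_eq_divide)
  also have "\<dots> \<le> 1 / 19.5"
  proof -
    have "(19.5::real) \<le> (1 + 3 / 16 + (3 / 16)\<^sup>2 / 2) ^ 16" by (simp add: power_numeral_even power2_eq_square)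
    also have "\<dots> \<le> exp 3" using exp_ge_power[of "3" 16] by simp
    finally show ?thesis by (intro divide_left_mono) auto
  qed
  finally show ?thesis by (simp add: power3_eq_cube)
qed

text \<open>
  The hypothesis on \<open>a\<close> makes \<open>exp (- A (M/u + K u)) + a exp (- A u)\<close> convex on \<open>(0, w0]\<close>, so that this sum lies above
  its tangent at \<open>w0\<close>.
\<close>

lemma exp_tangent:
  fixes A M K a w w0 :: real
  assumes A: "A > 0" and w: "0 < w" "w \<le> w0" and M: "M \<ge> 0"
    and a: "\<And>u. 0 < u \<Longrightarrow> u \<le> w0 \<Longrightarrow> 2 * M / u ^ 3 * exp (- A * (M / u + (K - 1) * u)) \<le> a * A"
  shows "exp (- A * (M / w + K * w)) - exp (- A * (M / w0 + K * w0)) - (w - w0) * (- A * (K - M / w0\<^sup>2) * exp (- A * (M / w0 + K * w0)))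
     \<ge> - a * (exp (- A * w) - exp (- A * w0) - (w - w0) * (- A * exp (- A * w0)))"
proof -
  let ?f = "\<lambda>u. exp (- A * (M / u + K * u)) + a * exp (- A * u)"
  let ?f' = "\<lambda>u. - A * (K - M / u\<^sup>2) * exp (- A * (M / u + K * u)) - a * A * exp (- A * u)"
  let ?f'' = "\<lambda>u. (A\<^sup>2 * (K - M / u\<^sup>2)\<^sup>2 - A * (2 * M / u ^ 3)) * exp (- A * (M / u + K * u)) + a * A\<^sup>2 * exp (- A * u)"
  have "?f' w0 * (w - w0) \<le> ?f w - ?f w0"
  proof (rule f''_imp_f'[where C = "{0<..w0}" and f'' = ?f''])
    show "convex {0<..w0}" by (rule convex_real_interval)
    fix u assume "u \<in> {0<..w0}"
    then have u: "0 < u" "u \<le> w0" by auto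
    have "((\<lambda>u. - A * (M / u + K * u)) has_real_derivative - A * (K - M / u\<^sup>2)) (at u)"
      using u by (auto intro!: derivative_eq_intros simp: power2_eq_square)
    note df = DERIV_fun_exp[OF this]
    have "((\<lambda>u. - A * u) has_real_derivative - A) (at u)"
      by (auto intro!: derivative_eq_intros)
    note de = DERIV_fun_exp[OF this]
    have dq: "((\<lambda>u. - A * (K - M / u\<^sup>2)) has_real_derivative - (A * (2 * M / u ^ 3))) (at u)"
      using u by (auto intro!: derivative_eq_intros simp: power2_eq_square power3_eq_cube mult_ac)
    show "(?f has_real_derivative ?f' u) (at u)"
      by (rule DERIV_cong[OF DERIV_add[OF df DERIV_cmult[OF de]]]) simp
    have "- (A * r) * E + E * (- A * q) * (- A * q) - a * A * (e * - A) = (A\<^sup>2 * q\<^sup>2 - A * r) * E + a * A\<^sup>2 * e" for q r E e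
      by (simp add: algebra_simps power2_eq_square)
    then show "(?f' has_real_derivative ?f'' u) (at u)"
      by (rule DERIV_cong[OF DERIV_diff[OF DERIV_mult[OF dq df] DERIV_cmult[OF de]]])
    \<comment> \<open>Splitting off exp (-A u), the decay of the compensating term, turns K into K -
      1; this is the form of the hypothesis on a. The second derivative is then a square plus the
      quantity controlled by that hypothesis.\<close>
    have "exp (- A * (M / u + K * u)) = exp (- A * (M / u + (K - 1) * u)) * exp (- A * u)"
      by (simp add: exp_add[symmetric] algebra_simps)
    then have "?f'' u = A\<^sup>2 * (K - M / u\<^sup>2)\<^sup>2 * exp (- A * (M / u + K * u)) + A * exp (- A * u) * (a * A - 2 * M / u ^ 3 * exp (- A * (M / u + (K - 1) * u)))"
      by (simp add: algebra_simps power2_eq_square)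
    also have "\<dots> \<ge> 0" using a[OF u] A by (intro add_nonneg_nonneg mult_nonneg_nonneg) auto
    finally show "?f'' u \<ge> 0" .
  qed (use w in auto)
  then show ?thesis by (simp add: algebra_simps)
qed

text \<open>
  Bounds for \<open>m\<^sup>2 y\<^sup>3 exp (- pi (m\<^sup>2 y + (k\<^sup>2 - 1) / y))\<close>, uniform in \<open>y\<^sup>2 \<ge> 3/4\<close>, where \<open>k = n\<close> or \<open>k = n + 1/2\<close> according to
  the parity of \<open>m\<close>. The value at the main terms \<open>|m| = 1\<close>, \<open>|k| = 1/2\<close> exceeds \<open>(sqrt 3 / 2)\<^sup>3 = 0.6495...\<close>. The
  convexity argument works because the total stays below \<open>pi\<close>.
\<close>

definition hex_bound :: "int \<Rightarrow> int \<Rightarrow> real" where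
  "hex_bound m n = (if m = 0 then 0 else if \<bar>m\<bar> = 1 \<and> (n = 0 \<or> n = -1) then 0.651
     else 0.36 * (1/8) ^ nat (\<bar>m\<bar> - 1) * (if n \<ge> 0 then (1/20) ^ nat n else 9 * (1/20) ^ nat (- n)))"

text \<open>A product of two one-variable series, corrected at the four main pairs, where 0.651
  replaces 0.36 (n = 0) or 0.36 * 9/20 (n = -1). The total is about 2.82, which leaves room below 3
  < pi.\<close>

lemma hex_bound_sum:
  obtains S where "((\<lambda>(m, n). hex_bound m n) has_sum S) UNIV" "S \<le> 2.9"
proof -
  let ?b = "\<lambda>m::int. if m = 0 then 0 else 0.36 * (1/8) ^ nat (\<bar>m\<bar> - 1) :: real"
  let ?c = "\<lambda>n::int. (if n \<ge> 0 then (1/20) ^ nat n else 9 * (1/20) ^ nat (- n)) :: real"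
  have g8: "((\<lambda>n. 2.88 * (1/8::real) ^ n) has_sum (2.88 * (1/7))) {1..}"
    using has_sum_cmult_right[OF has_sum_geometric_from_1[of "1/8::real"], of "2.88"] by simp
  have g20: "((\<lambda>n. (1/20::real) ^ n) has_sum (1/19)) {1..}"
    using has_sum_geometric_from_1[of "1/20::real"] by simp
  have "((\<lambda>n. ?b (int n)) has_sum (2.88 * (1/7))) {1..} \<longleftrightarrow> ((\<lambda>n. 2.88 * (1/8::real) ^ n) has_sum (2.88 * (1/7))) {1..}"
  proof (rule has_sum_cong)
    fix n :: nat assume "n \<in> {1..}"
    then show "?b (int n) = 2.88 * (1/8::real) ^ n" by (cases n) auto
  qed
  moreover have "((\<lambda>n. ?b (- int n)) has_sum (2.88 * (1/7))) {1..} \<longleftrightarrow> ((\<lambda>n. 2.88 * (1/8::real) ^ n) has_sum (2.88 * (1/7))) {1..}"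
  proof (rule has_sum_cong)
    fix n :: nat assume "n \<in> {1..}"
    then show "?b (- int n) = 2.88 * (1/8::real) ^ n" by (cases n) auto
  qed
  ultimately have "(?b has_sum (?b 0 + (2.88 * (1/7) + 2.88 * (1/7)))) UNIV"
    using g8 by (intro has_sum_int_split) blast+
  then have b: "(?b has_sum (5.76/7)) UNIV" by simp
  have "(?c has_sum (?c 0 + (1/19 + 9 * (1/19)))) UNIV"
  proof (rule has_sum_int_split)
    show "((\<lambda>n. ?c (int n)) has_sum (1/19)) {1..}" using g20 by simp
    show "((\<lambda>n. ?c (- int n)) has_sum (9 * (1/19))) {1..}"
      using has_sum_cmult_right[OF g20, of 9] by (rule has_sum_cong[THEN iffD1, rotated]) auto
  qed
  then have c: "(?c has_sum (29/19)) UNIV" by simp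
  have bc: "((\<lambda>(m, n). ?b m * ?c n) has_sum ((5.76/7) * (29/19))) UNIV"
    using has_sum_product_nonneg[OF b c] by simp
  let ?d = "\<lambda>(m::int, n::int). if \<bar>m\<bar> = 1 \<and> (n = 0 \<or> n = -1) then 0.651 - ?b m * ?c n else 0"
  have d: "(?d has_sum (2 * (0.651 - 0.36) + 2 * (0.651 - 0.36 * 0.45))) UNIV"
    by (rule has_sum_finite_neutralI[where B = "{(1,0),(1,-1),(-1,0),(-1,-1)}"]) (auto simp: abs_if split: if_splits)
  have "((\<lambda>p. (case p of (m, n) \<Rightarrow> ?b m * ?c n) + ?d p) has_sum ((5.76/7) * (29/19) + (2 * (0.651 - 0.36) + 2 * (0.651 - 0.36 * 0.45)))) UNIV"
    by (intro has_sum_add bc d)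
  also have "(\<lambda>p. (case p of (m, n) \<Rightarrow> ?b m * ?c n) + ?d p) = (\<lambda>(m, n). hex_bound m n)"
    by (auto simp: hex_bound_def fun_eq_iff)
  finally show ?thesis by (rule that) simp
qed

text \<open>Writing y = y0 exp v with y0 = sqrt 3 / 2, the exponent is -pi times 2 y0 sinh v, and
  sinh v >= v. Since 2 pi y0 >= 3, it absorbs the growth exp (3 v) of y^3, so the maximum is at v =
  0.\<close>

lemma hex_main_term_le:
  fixes y :: real
  assumes y: "y > 0" "y\<^sup>2 \<ge> 3/4"
  shows "y ^ 3 * exp (- pi * (y - 3 / (4 * y))) \<le> 0.651"
proof -
  define y0 where "y0 = sqrt 3 / 2"
  have y0: "y0 > 0" "y0\<^sup>2 = 3/4" by (auto simp: y0_def power_divide)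
  have "y0 \<le> y"
    by (rule power2_le_imp_le) (unfold y0(2), use y in simp_all)
  define v where "v = ln (y / y0)"
  have v: "v \<ge> 0" "y = y0 * exp v" using y y0 \<open>y0 \<le> y\<close> by (auto simp: v_def)
  have y01: "0.75 \<le> y0"
    by (rule power2_le_imp_le) (unfold y0(2), use y0(1) in \<open>simp_all add: power2_eq_square\<close>)
  have "y - 3 / (4 * y) = y0 * (exp v - exp (- v))"
    using y0 unfolding v(2) by (simp add: exp_minus field_simps power2_eq_square)
  also have "\<dots> = 2 * y0 * sinh v" by (simp add: sinh_def)
  also have "\<dots> \<ge> 2 * y0 * v" using sinh_real_ge[OF v(1)] y0 by (intro mult_left_mono) auto
  finally have "pi * (2 * y0 * v) \<le> pi * (y - 3 / (4 * y))" by (intro mult_left_mono) auto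
  moreover have "3 * v \<le> pi * (2 * y0 * v)"
  proof -
    have "3 * (2 * 0.75) \<le> pi * (2 * y0)" using y01 pi_gt3 by (intro mult_mono) auto
    then have "3 \<le> pi * (2 * y0)" by simp
    from mult_right_mono[OF this v(1)] show ?thesis by (simp add: mult_ac)
  qed
  ultimately have "exp (- pi * (y - 3 / (4 * y))) \<le> exp (- 3 * v)"
    unfolding exp_le_cancel_iff mult_minus_left by linarith
  then have "y ^ 3 * exp (- pi * (y - 3 / (4 * y))) \<le> y ^ 3 * exp (- 3 * v)"
    using y by (intro mult_left_mono) auto
  also have "\<dots> = y0 ^ 3 * (exp v ^ 3 * exp (- 3 * v))" unfolding v(2) by (simp add: power_mult_distrib)
  also have "exp v ^ 3 * exp (- 3 * v) = 1" by (simp add: exp_of_nat_mult[symmetric] exp_add[symmetric])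
  also have "y0 ^ 3 = 3/4 * y0" using y0 by (simp add: power3_eq_cube power2_eq_square)
  also have "y0 \<le> 0.868"
    by (rule power2_le_imp_le) (unfold y0(2), simp_all add: power2_eq_square)
  finally show ?thesis by simp
qed

text \<open>Completing a square bounds the bracket in the exponent below by m^2 y / 2 + |k|: for |m|
  = 1 the excluded n leave |k| >= 3/2, and for |m| >= 2 the bound 4 y^2 >= 3 pays for the -1. With j
  = |m| - 1 this is at least y / 2 + 1.2 j + |k|, and the three parts yield the factors 0.36,
  (4/32)^j and the decay in n.\<close>

lemma hex_other_term_le:
  fixes y :: real and m n :: int
  defines "k \<equiv> of_int n + of_int (m mod 2) / 2"
  assumes y: "y > 0" "y\<^sup>2 \<ge> 3/4" and m: "m \<noteq> 0" and ne: "\<not> (\<bar>m\<bar> = 1 \<and> (n = 0 \<or> n = -1))"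
  shows "(of_int m)\<^sup>2 * y + (k\<^sup>2 - 1) / y \<ge> 0"
    and "(of_int m)\<^sup>2 * y ^ 3 * exp (- pi * ((of_int m)\<^sup>2 * y + (k\<^sup>2 - 1) / y)) \<le> hex_bound m n"
proof -
  define j where "j = nat (\<bar>m\<bar> - 1)"
  have mj: "\<bar>of_int m\<bar> = real j + 1" using m by (auto simp: j_def)
  have msq: "(of_int m)\<^sup>2 = (real j + 1)\<^sup>2" by (metis mj power2_abs)
  have y08: "y \<ge> 0.8"
  proof (rule power2_le_imp_le)
    have "(0.8::real)\<^sup>2 \<le> 3/4" by (simp add: power2_eq_square)
    then show "0.8\<^sup>2 \<le> y\<^sup>2" using y(2) by linarith
  qed (use y in simp)
  have E: "(of_int m)\<^sup>2 * y\<^sup>2 / 2 + k\<^sup>2 - 1 \<ge> \<bar>k\<bar> * y"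
  proof (cases "j = 0")
    case True
    then have m1: "\<bar>m\<bar> = 1" using m by (auto simp: j_def)
    then have "m = 1 \<or> m = -1" by auto
    then have "m mod 2 = 1" by auto
    then have k: "k = of_int n + 1/2" by (simp add: k_def)
    have "n \<ge> 1 \<or> n \<le> -2" using ne m1 by auto
    then have "\<bar>k\<bar> \<ge> 3/2" unfolding k by (auto simp: abs_if)
    then have "k\<^sup>2 \<ge> (3/2)\<^sup>2" by (metis abs_ge_zero power2_abs power_mono zero_le_divide_iff zero_le_numeral)
    moreover have "(y - \<bar>k\<bar>)\<^sup>2 \<ge> 0" by simp
    then have "y\<^sup>2 + k\<^sup>2 \<ge> 2 * (\<bar>k\<bar> * y)" by (simp add: power2_diff algebra_simps)
    ultimately show ?thesis unfolding msq using True by (simp add: power2_eq_square)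
  next
    case False
    then have "(real j + 1)\<^sup>2 \<ge> 2\<^sup>2" by (intro power_mono) auto
    then have "(of_int m)\<^sup>2 * y\<^sup>2 \<ge> 4 * y\<^sup>2" unfolding msq by (intro mult_right_mono) auto
    moreover have "(\<bar>k\<bar> - y / 2)\<^sup>2 \<ge> 0" by simp
    then have "k\<^sup>2 + y\<^sup>2 / 4 \<ge> \<bar>k\<bar> * y" by (simp add: power2_diff algebra_simps power_divide)
    ultimately show ?thesis using y(2) by linarith
  qed
  have E': "(of_int m)\<^sup>2 * y + (k\<^sup>2 - 1) / y \<ge> (of_int m)\<^sup>2 * y / 2 + \<bar>k\<bar>"
  proof -
    have "(of_int m)\<^sup>2 * y + (k\<^sup>2 - 1) / y - ((of_int m)\<^sup>2 * y / 2 + \<bar>k\<bar>) = ((of_int m)\<^sup>2 * y\<^sup>2 / 2 + k\<^sup>2 - 1 - \<bar>k\<bar> * y) / y"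
      using y by (simp add: field_simps power2_eq_square)
    also have "\<dots> \<ge> 0" using E y by simp
    finally show ?thesis by linarith
  qed
  also have "(of_int m)\<^sup>2 * y / 2 + \<bar>k\<bar> \<ge> 0" using y by simp
  finally show "(of_int m)\<^sup>2 * y + (k\<^sup>2 - 1) / y \<ge> 0" .
  have "(of_int m)\<^sup>2 * y / 2 = y / 2 + real j * (real j + 2) * y / 2"
    unfolding msq by (simp add: power2_eq_square algebra_simps)
  moreover have "real j * 1.2 \<le> real j * (real j + 2) * y / 2"
  proof (cases "j = 0")
    case False
    then have "real j * (3 * 0.8) \<le> real j * ((real j + 2) * y)"
      using y08 by (intro mult_left_mono mult_mono) auto
    then show ?thesis by simp
  qed auto
  ultimately have "(of_int m)\<^sup>2 * y + (k\<^sup>2 - 1) / y \<ge> y / 2 + real j * 1.2 + \<bar>k\<bar>" using E' by linarith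
  then have "pi * (y / 2 + real j * 1.2 + \<bar>k\<bar>) \<le> pi * ((of_int m)\<^sup>2 * y + (k\<^sup>2 - 1) / y)"
    by (intro mult_left_mono) auto
  moreover have "pi * (y / 2 + real j * 1.2 + \<bar>k\<bar>) = pi * y / 2 + pi * (real j * 1.2) + pi * \<bar>k\<bar>"
    by (simp add: algebra_simps)
  moreover have "real j * 3.6 \<le> pi * (real j * 1.2)" using pi_gt3 mult_right_mono[of 3 pi "real j * 1.2"] by simp
  ultimately have "exp (- pi * ((of_int m)\<^sup>2 * y + (k\<^sup>2 - 1) / y)) \<le> exp (- pi * y / 2 + real j * (- 3.6) + (- pi * \<bar>k\<bar>))"
    unfolding exp_le_cancel_iff by linarith
  also have "\<dots> = exp (- pi * y / 2) * exp (- 3.6) ^ j * exp (- pi * \<bar>k\<bar>)"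
    by (simp only: exp_add exp_of_nat_mult)
  finally have "(of_int m)\<^sup>2 * y ^ 3 * exp (- pi * ((of_int m)\<^sup>2 * y + (k\<^sup>2 - 1) / y)) \<le>
      (of_int m)\<^sup>2 * y ^ 3 * (exp (- pi * y / 2) * exp (- 3.6) ^ j * exp (- pi * \<bar>k\<bar>))"
    using y by (intro mult_left_mono) auto
  also have "\<dots> = (y ^ 3 * exp (- pi * y / 2)) * ((of_int m)\<^sup>2 * exp (- 3.6) ^ j) * exp (- pi * \<bar>k\<bar>)" by simp
  also have "\<dots> \<le> 0.36 * (1/8) ^ j * (if n \<ge> 0 then (1/20) ^ nat n else 9 * (1/20) ^ nat (- n))"
  proof (intro mult_mono)
    show "y ^ 3 * exp (- pi * y / 2) \<le> 0.36" using cube_exp_le[of y] y by simp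
    have "(of_int m)\<^sup>2 \<le> (4::real) ^ j"
    proof -
      have "real j + 1 \<le> 2 ^ j"
        by (metis Suc_leI less_exp of_nat_Suc of_nat_le_iff of_nat_numeral of_nat_power add.commute)
      then have "(real j + 1)\<^sup>2 \<le> (2 ^ j)\<^sup>2" by (intro power_mono) auto
      also have "(2 ^ j)\<^sup>2 = (4 :: real) ^ j" by (simp add: power2_eq_square power_mult_distrib[symmetric])
      finally show ?thesis unfolding msq .
    qed
    moreover have "exp (- 3.6) \<le> (1 / 32 :: real)"
    proof -
      have "(32::real) \<le> (1 + 3.6 / 8 + (3.6 / 8)\<^sup>2 / 2) ^ 8" by (simp add: power_numeral_even power2_eq_square)
      also have "\<dots> \<le> exp 3.6" using exp_ge_power[of "3.6" 8] by simp
      finally have "1 / exp 3.6 \<le> 1 / (32::real)" by (intro divide_left_mono) auto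
      then show ?thesis by (simp add: exp_minus inverse_eq_divide)
    qed
    then have "exp (- 3.6) ^ j \<le> (1 / 32 :: real) ^ j" by (intro power_mono) auto
    ultimately have "(of_int m)\<^sup>2 * exp (- 3.6) ^ j \<le> 4 ^ j * (1 / 32 :: real) ^ j" by (intro mult_mono) auto
    also have "\<dots> = (1/8) ^ j" by (simp add: power_mult_distrib[symmetric])
    finally show "(of_int m)\<^sup>2 * exp (- 3.6) ^ j \<le> (1/8 :: real) ^ j" .
    have md: "0 \<le> (of_int (m mod 2) / 2 :: real)" "(of_int (m mod 2) / 2 :: real) \<le> 1/2"
      by (auto simp: mod_2_eq_odd)
    show "exp (- pi * \<bar>k\<bar>) \<le> (if n \<ge> 0 then (1/20) ^ nat n else 9 * (1/20) ^ nat (- n))"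
    proof (cases "n \<ge> 0")
      case True
      have "real (nat n) \<le> \<bar>k\<bar>" using True md by (simp add: k_def)
      then have "exp (- pi * \<bar>k\<bar>) \<le> exp (real (nat n) * (- pi))" by (simp add: mult.commute)
      also have "\<dots> = exp (- pi) ^ nat n" by (rule exp_of_nat_mult)
      also have "\<dots> \<le> (1/20) ^ nat n" using exp_neg_pi_le by (intro power_mono) auto
      finally show ?thesis using True by simp
    next
      case False
      \<comment> \<open>For negative n the parity shift may bring k closer to 0 by 1/2; this is the
        factor exp (pi / 2) <= exp 2 <= 9.\<close>
      have "real (nat (- n)) - 1/2 \<le> \<bar>k\<bar>" using False md by (simp add: k_def)
      then have "pi * (real (nat (- n)) - 1/2) \<le> pi * \<bar>k\<bar>" by (intro mult_left_mono) auto
      then have "exp (- pi * \<bar>k\<bar>) \<le> exp (pi / 2 + real (nat (- n)) * (- pi))" by (simp add: algebra_simps)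
      also have "\<dots> = exp (pi / 2) * exp (- pi) ^ nat (- n)" by (simp only: exp_add exp_of_nat_mult)
      also have "\<dots> \<le> 9 * (1/20) ^ nat (- n)"
      proof (intro mult_mono power_mono)
        have "exp (pi / 2) \<le> exp (2 * 1)" using pi_less_4 by simp
        also have "\<dots> = exp 1 * exp (1::real)" by (simp only: mult_2 exp_add)
        also have "\<dots> \<le> 3 * 3" using exp_le by (intro mult_mono) auto
        finally show "exp (pi / 2) \<le> 9" by simp
      qed (use exp_neg_pi_le in auto)
      finally show ?thesis using False by simp
    qed
  qed (use y in auto)
  also have "\<dots> = hex_bound m n" using m ne by (simp add: hex_bound_def j_def)
  finally show "(of_int m)\<^sup>2 * y ^ 3 * exp (- pi * ((of_int m)\<^sup>2 * y + (k\<^sup>2 - 1) / y)) \<le> hex_bound m n" .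
qed

text \<open>
  The quadratic form \<open>m\<^sup>2 + m n + n\<^sup>2\<close> has a symmetry permuting \<open>m\<^sup>2\<close>, \<open>n\<^sup>2\<close> and \<open>(m + n)\<^sup>2\<close>, which therefore have equal
  weighted sums, and the summand is \<open>((m + n)\<^sup>2 + n\<^sup>2) / 2 - m\<^sup>2\<close>.
\<close>

lemma hex_moment_zero:
  fixes c :: real
  assumes c: "c \<ge> pi"
  shows "((\<lambda>(m, n). ((of_int n + of_int m / 2)\<^sup>2 - 3/4 * (of_int m)\<^sup>2) *
     exp (- c * ((of_int m)\<^sup>2 + of_int m * of_int n + (of_int n)\<^sup>2))) has_sum 0) (UNIV :: (int \<times> int) set)"
proof -
  define W where "W = (\<lambda>(m::int, n::int). exp (- c * ((of_int m)\<^sup>2 + of_int m * of_int n + (of_int n)\<^sup>2)) :: real)"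
  have "(\<lambda>(m::int, n::int). (of_int m)\<^sup>2 * W (m, n)) summable_on UNIV"
  proof (rule summable_on_comparison_test)
    obtain U where U: "((\<lambda>m::int. (of_int m)\<^sup>2 * exp (- pi * (1/2) * (of_int m)\<^sup>2)) has_sum U) UNIV"
      using gaussian_second_moment[of "1/2"] by auto
    have "((\<lambda>n::int. exp (- (pi / 2) * (of_int n + 0)\<^sup>2)) has_sum infsum (\<lambda>n::int. exp (- (pi / 2) * (of_int n + 0)\<^sup>2)) UNIV) UNIV"
      using summable_gaussian[of "pi / 2" 0] by (intro has_sum_infsum) simp
    from has_sum_product_nonneg[OF U this]
    show "(\<lambda>(m::int, n::int). ((of_int m)\<^sup>2 * exp (- pi * (1/2) * (of_int m)\<^sup>2)) * exp (- (pi / 2) * (of_int n + 0)\<^sup>2)) summable_on UNIV"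
      by (auto simp: summable_on_def)
    fix p :: "int \<times> int"
    obtain m n where p: "p = (m, n)" by (cases p)
    have "(of_int (m + n) :: real)\<^sup>2 \<ge> 0" by simp
    then have "((of_int m)\<^sup>2 + (of_int n)\<^sup>2) / 2 \<le> ((of_int m)\<^sup>2 + of_int m * of_int n + (of_int n)\<^sup>2 :: real)"
      by (simp add: power2_eq_square algebra_simps)
    then have "pi * (((of_int m)\<^sup>2 + (of_int n)\<^sup>2) / 2) \<le> c * ((of_int m)\<^sup>2 + of_int m * of_int n + (of_int n)\<^sup>2 :: real)"
      using c pi_gt_zero by (intro mult_mono order_trans[OF less_imp_le[OF pi_gt_zero] c]) auto
    then have "W (m, n) \<le> exp (- pi * (1/2) * (of_int m)\<^sup>2 + (- (pi / 2) * (of_int n + 0)\<^sup>2))"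
      by (simp add: W_def algebra_simps add_divide_distrib)
    also have "\<dots> = exp (- pi * (1/2) * (of_int m)\<^sup>2) * exp (- (pi / 2) * (of_int n + 0)\<^sup>2)" by (rule exp_add)
    finally show "(case p of (m, n) \<Rightarrow> (of_int m)\<^sup>2 * W (m, n)) \<le> (case p of (m, n) \<Rightarrow>
       ((of_int m)\<^sup>2 * exp (- pi * (1/2) * (of_int m)\<^sup>2)) * exp (- (pi / 2) * (of_int n + 0)\<^sup>2))"
      unfolding p prod.case mult.assoc by (rule mult_left_mono) simp
  qed (auto simp: W_def)
  then obtain S where S1: "((\<lambda>(m::int, n::int). (of_int m)\<^sup>2 * W (m, n)) has_sum S) UNIV"
    by (auto simp: summable_on_def)
  have S2: "((\<lambda>(m::int, n::int). (of_int n)\<^sup>2 * W (m, n)) has_sum S) UNIV"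
    using S1 by (rule has_sum_reindex_bij_witness[where i = prod.swap and j = prod.swap, THEN iffD1, rotated -1])
       (auto simp: W_def algebra_simps)
  \<comment> \<open>The involution (m, n) to (m + n, -n) preserves m^2 + m n + n^2.\<close>
  have S3: "((\<lambda>(m::int, n::int). (of_int (m + n))\<^sup>2 * W (m, n)) has_sum S) UNIV"
    using S1 by (rule has_sum_reindex_bij_witness[where i = "\<lambda>(m, n). (m + n, - n)" and j = "\<lambda>(m, n). (m + n, - n)", THEN iffD1, rotated -1])
       (auto simp: W_def algebra_simps power2_eq_square)
  have "((\<lambda>p. 1/2 * (case p of (m::int, n::int) \<Rightarrow> (of_int (m + n))\<^sup>2 * W (m, n)) +
      1/2 * (case p of (m::int, n::int) \<Rightarrow> (of_int n)\<^sup>2 * W (m, n)) - (case p of (m::int, n::int) \<Rightarrow> (of_int m)\<^sup>2 * W (m, n)))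
      has_sum (1/2 * S + 1/2 * S - S)) UNIV"
    by (intro has_sum_diff has_sum_add has_sum_cmult_right S1 S2 S3)
  also have "(\<lambda>p. 1/2 * (case p of (m::int, n::int) \<Rightarrow> (of_int (m + n))\<^sup>2 * W (m, n)) +
      1/2 * (case p of (m::int, n::int) \<Rightarrow> (of_int n)\<^sup>2 * W (m, n)) - (case p of (m::int, n::int) \<Rightarrow> (of_int m)\<^sup>2 * W (m, n)))
     = (\<lambda>(m, n). ((of_int n + of_int m / 2)\<^sup>2 - 3/4 * (of_int m)\<^sup>2) *
     exp (- c * ((of_int m)\<^sup>2 + of_int m * of_int n + (of_int n)\<^sup>2)))"
    by (auto simp: fun_eq_iff W_def power2_eq_square algebra_simps add_divide_distrib)
  finally show ?thesis by simp
qed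

text \<open>Let H be the gap at w between exp (-A u) and its tangent at w0. Every summand p lies
  above its tangent up to an error \<open>a p * H\<close>, while the pairs (0, 1) and (0, -1)
  contribute H each. The coefficients \<open>a p\<close> sum to 2 S / pi <= 5.8 / pi < 2, so a
  positive multiple of H survives, and H > 0 for w < w0 by strict convexity.\<close>

lemma lattice_theta_vertical:
  fixes \<alpha> y :: real
  assumes \<alpha>: "\<alpha> \<ge> 1" and y: "y > 0" "y\<^sup>2 \<ge> 3/4"
  obtains H where "H \<le> lattice_theta \<alpha> (Complex (1/2) y) - lattice_theta \<alpha> (Complex (1/2) (sqrt 3 / 2))"
    "H \<ge> 0" "y\<^sup>2 > 3/4 \<Longrightarrow> H > 0"
proof -
  define y0 where "y0 = sqrt 3 / 2"
  have y0: "y0 > 0" "y0\<^sup>2 = 3/4" by (auto simp: y0_def power_divide)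
  define w w0 A where "w = 1 / y" and "w0 = 1 / y0" and "A = pi * \<alpha>"
  have "y0 \<le> y"
    by (rule power2_le_imp_le) (unfold y0(2), use y in simp_all)
  then have w: "0 < w" "w \<le> w0" using y y0 by (auto simp: w_def w0_def frac_le)
  have w0: "w0 > 0" using w by simp
  have w0sq: "w0\<^sup>2 = 4/3" unfolding w0_def power_divide y0(2) by simp
  note w0 = w0 w0sq
  have w0': "w0 \<ge> 1" by (rule power2_le_imp_le) (unfold w0(2), use w0(1) in simp_all)
  have A: "A > 0" "A \<ge> pi" using \<alpha> by (auto simp: A_def)
  define M K where "M m = (of_int m :: real)\<^sup>2" and "K m n = (of_int n + of_int m / 2 :: real)\<^sup>2" for m n :: int
  define f where "f u = (\<lambda>(m::int, n::int). exp (- A * (M m / u + K m n * u)))" for u :: real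
  have theta: "(f (1 / v) has_sum lattice_theta \<alpha> (Complex (1/2) v)) UNIV" if "v > 0" for v
  proof -
    have "((\<lambda>p. exp (- pi * \<alpha> * qform (Complex (1/2) v) p)) has_sum lattice_theta \<alpha> (Complex (1/2) v)) UNIV"
      using \<alpha> that by (intro has_sum_lattice_theta) auto
    also have "(\<lambda>p. exp (- pi * \<alpha> * qform (Complex (1/2) v) p)) = f (1 / v)"
      using that by (auto simp: fun_eq_iff f_def qform_Complex A_def M_def K_def)
    finally show ?thesis .
  qed
  define f' where "f' = (\<lambda>(m::int, n::int). - A * (K m n - M m / w0\<^sup>2) * exp (- A * (M m / w0 + K m n * w0)))"
  have f': "(f' has_sum 0) UNIV"
  proof -
    have "A * w0 \<ge> pi" using A w0' mult_mono[of pi A 1 w0] by simp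
    from has_sum_cmult_right[OF hex_moment_zero[OF this], of "- A"]
    have "((\<lambda>p. - A * (case p of (m, n) \<Rightarrow> ((of_int n + of_int m / 2)\<^sup>2 - 3/4 * (of_int m)\<^sup>2) *
       exp (- (A * w0) * ((of_int m)\<^sup>2 + of_int m * of_int n + (of_int n)\<^sup>2)))) has_sum 0) (UNIV :: (int \<times> int) set)"
      by simp
    also have "(\<lambda>p. - A * (case p of (m, n) \<Rightarrow> ((of_int n + of_int m / 2)\<^sup>2 - 3/4 * (of_int m)\<^sup>2) *
       exp (- (A * w0) * ((of_int m)\<^sup>2 + of_int m * of_int n + (of_int n)\<^sup>2)))) = f'"
    proof (intro ext, clarify)
      fix m n :: int
      have 1: "M m / w0\<^sup>2 = 3/4 * (of_int m)\<^sup>2" by (simp add: w0 M_def)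
      have "1 / w0 = 3/4 * w0" using w0 by (simp add: field_simps power2_eq_square)
      then have "M m / w0 = 3/4 * w0 * M m" by (metis mult.commute mult_1 times_divide_eq_right)
      then have 2: "M m / w0 + K m n * w0 = w0 * ((of_int m)\<^sup>2 + of_int m * of_int n + (of_int n)\<^sup>2)"
        unfolding \<open>M m / w0 = 3/4 * w0 * M m\<close> by (simp add: M_def K_def power2_eq_square algebra_simps)
      show "- A * (((of_int n + of_int m / 2)\<^sup>2 - 3/4 * (of_int m)\<^sup>2) *
       exp (- (A * w0) * ((of_int m)\<^sup>2 + of_int m * of_int n + (of_int n)\<^sup>2))) = f' (m, n)"
        unfolding f'_def prod.case 1 2 by (simp add: K_def mult_ac)
    qed
    finally show ?thesis .
  qed
  define H where "H = exp (- A * w) - exp (- A * w0) - (w - w0) * (- A * exp (- A * w0))"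
  have H: "H \<ge> exp (- A * w0) * (A * (w0 - w))\<^sup>2 / 2"
  proof -
    have "exp (A * (w0 - w)) \<ge> 1 + A * (w0 - w) + (A * (w0 - w))\<^sup>2 / 2"
      using A w by (intro exp_lower_Taylor_quadratic) auto
    then have "exp (- A * w0) * exp (A * (w0 - w)) \<ge> exp (- A * w0) * (1 + A * (w0 - w) + (A * (w0 - w))\<^sup>2 / 2)"
      by (intro mult_left_mono) auto
    also have "exp (- A * w0) * exp (A * (w0 - w)) = exp (- A * w)"
      unfolding exp_add[symmetric] by (simp add: algebra_simps)
    finally show ?thesis by (simp add: H_def algebra_simps)
  qed
  have H0: "H \<ge> 0" using H by (rule order_trans[rotated]) auto
  obtain S where S: "((\<lambda>(m, n). hex_bound m n) has_sum S) UNIV" "S \<le> 2.9"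
    by (rule hex_bound_sum)
  \<comment> \<open>On Re = 1/2 row m is shifted by m / 2 = m div 2 + (m mod 2) / 2; moving n by m
    div 2 leaves the shift used in \<open>hex_bound\<close>. The factor 2 / pi comes from 2 M / u^3
    on one side and A >= pi on the other.\<close>
  define a where "a = (\<lambda>(m, n). 2 / pi * hex_bound m (n + m div 2))"
  have a: "(a has_sum (2 / pi * S)) UNIV"
    using has_sum_cmult_right[OF S(1), of "2 / pi"]
    by (rule has_sum_reindex_bij_witness[where i = "\<lambda>(m, n). (m, n + m div 2)" and j = "\<lambda>(m, n). (m, n - m div 2)", THEN iffD1, rotated -1])
       (auto simp: a_def)
  define b where "b = (\<lambda>(m::int, n::int). if m = 0 \<and> \<bar>n\<bar> = 1 then H else (0::real))"
  have b: "(b has_sum (2 * H)) UNIV"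
    by (rule has_sum_finite_neutralI[where B = "{(0,1),(0,-1)}"]) (auto simp: b_def abs_if split: if_splits)
  have ineq: "b p - a p * H \<le> f w p - f w0 p - (w - w0) * f' p" for p
  proof -
    obtain m n where p: "p = (m, n)" by (cases p)
    show ?thesis
    proof (cases "m = 0")
      case True
      have a0: "a p = 0" using True by (simp add: p a_def hex_bound_def)
      show ?thesis
      proof (cases "\<bar>n\<bar> = 1")
        case n1: True
        then have "n = 1 \<or> n = -1" by auto
        then have "K m n = 1" using True by (auto simp: K_def)
        then show ?thesis using True a0 n1 by (simp add: p b_def f_def f'_def M_def H_def)
      next
        case False
        have "exp (- A * (0 / w + K m n * w)) - exp (- A * (0 / w0 + K m n * w0)) - (w - w0) * (- A * (K m n - 0 / w0\<^sup>2) * exp (- A * (0 / w0 + K m n * w0)))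
          \<ge> - 0 * (exp (- A * w) - exp (- A * w0) - (w - w0) * (- A * exp (- A * w0)))"
          by (rule exp_tangent) (use A w in auto)
        then show ?thesis using True a0 False by (simp add: p b_def f_def f'_def M_def)
      qed
    next
      case False
      define k where "k = (of_int n + of_int m / 2 :: real)"
      have k: "k = of_int (n + m div 2) + of_int (m mod 2) / 2"
      proof -
        have "(of_int m :: real) = of_int (2 * (m div 2) + m mod 2)" by simp
        then show ?thesis unfolding k_def by (simp only: of_int_add of_int_mult) (simp add: field_simps)
      qed
      have bnd: "(of_int m)\<^sup>2 * v + (k\<^sup>2 - 1) / v \<ge> 0 \<and> (of_int m)\<^sup>2 * v ^ 3 * exp (- pi * ((of_int m)\<^sup>2 * v + (k\<^sup>2 - 1) / v)) \<le> hex_bound m (n + m div 2)"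
        if v: "v > 0" "v\<^sup>2 \<ge> 3/4" for v
      proof (cases "\<bar>m\<bar> = 1 \<and> (n + m div 2 = 0 \<or> n + m div 2 = -1)")
        case True
        then have "m = 1 \<or> m = -1" by auto
        then have mm: "m mod 2 = 1" "(of_int m :: real)\<^sup>2 = 1" by auto
        have "k = 1/2 \<or> k = -1/2" using True unfolding k mm by auto
        then have "2 * k = 1 \<or> 2 * k = -1" by auto
        then have "(2 * k)\<^sup>2 = 1" by (metis power2_minus power_one)
        then have "k\<^sup>2 = 1/4" by (simp add: power_mult_distrib)
        then have e: "(of_int m)\<^sup>2 * v + (k\<^sup>2 - 1) / v = v - 3 / (4 * v)" using v by (simp add: mm field_simps)
        have "v - 3 / (4 * v) = (v\<^sup>2 - 3/4) / v" using v by (simp add: field_simps power2_eq_square)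
        then have "v - 3 / (4 * v) \<ge> 0" using v by simp
        then show ?thesis unfolding e using hex_main_term_le[OF v] True False by (simp add: mm hex_bound_def)
      next
        case ne: False
        show ?thesis using hex_other_term_le[OF v False ne] unfolding k by blast
      qed
      have "exp (- A * (M m / w + K m n * w)) - exp (- A * (M m / w0 + K m n * w0)) - (w - w0) * (- A * (K m n - M m / w0\<^sup>2) * exp (- A * (M m / w0 + K m n * w0)))
          \<ge> - a p * (exp (- A * w) - exp (- A * w0) - (w - w0) * (- A * exp (- A * w0)))"
      proof (rule exp_tangent)
        fix u assume u: "0 < u" "u \<le> w0"
        define v where "v = 1 / u"
        have "v \<ge> y0" using u w0 y0 by (simp add: v_def w0_def field_simps)
        then have v: "v > 0" "v\<^sup>2 \<ge> 3/4"
          using y0(1) power_mono[OF \<open>v \<ge> y0\<close> less_imp_le[OF y0(1)], of 2] unfolding y0(2) by auto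
        define E where "E = (of_int m)\<^sup>2 * v + (k\<^sup>2 - 1) / v"
        have E0: "E \<ge> 0" and E1: "(of_int m)\<^sup>2 * v ^ 3 * exp (- pi * E) \<le> hex_bound m (n + m div 2)"
          using bnd[OF v] by (auto simp: E_def)
        have EE: "M m / u + (K m n - 1) * u = E" using u by (simp add: E_def v_def M_def K_def k_def)
        have u3: "2 * M m / u ^ 3 = 2 * ((of_int m)\<^sup>2 * v ^ 3)" by (simp add: v_def M_def power_divide)
        \<comment> \<open>Here \<alpha> at least 1 enters: A >= pi and E >= 0 reduce every \<alpha>
          to the bounds proved with pi.\<close>
        have "exp (- A * E) \<le> exp (- pi * E)" using mult_right_mono[OF A(2) E0] by simp
        then have "2 * ((of_int m)\<^sup>2 * v ^ 3) * exp (- A * E) \<le> 2 * ((of_int m)\<^sup>2 * v ^ 3) * exp (- pi * E)"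
          using v by (intro mult_left_mono) auto
        also have "\<dots> \<le> 2 * hex_bound m (n + m div 2)" using E1 by simp
        also have "\<dots> = a p * pi" by (simp add: p a_def)
        also have "\<dots> \<le> a p * A"
          using A by (intro mult_left_mono) (auto simp: p a_def hex_bound_def)
        finally show "2 * M m / u ^ 3 * exp (- A * (M m / u + (K m n - 1) * u)) \<le> a p * A"
          unfolding EE u3 .
      qed (use A w in \<open>auto simp: M_def\<close>)
      then show ?thesis using False by (simp add: p b_def f_def f'_def H_def)
    qed
  qed
  have th: "(f w has_sum lattice_theta \<alpha> (Complex (1/2) y)) UNIV"
    "(f w0 has_sum lattice_theta \<alpha> (Complex (1/2) y0)) UNIV"
    using theta[of y] theta[of y0] y y0 by (auto simp: w_def w0_def)
  have "2 * H - 2 / pi * S * H \<le> lattice_theta \<alpha> (Complex (1/2) y) - lattice_theta \<alpha> (Complex (1/2) y0) - (w - w0) * 0"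
  proof (rule has_sum_mono)
    show "((\<lambda>p. b p - a p * H) has_sum (2 * H - 2 / pi * S * H)) UNIV"
      by (intro has_sum_diff b has_sum_cmult_left a)
    show "((\<lambda>p. f w p - f w0 p - (w - w0) * f' p) has_sum
       (lattice_theta \<alpha> (Complex (1/2) y) - lattice_theta \<alpha> (Complex (1/2) y0) - (w - w0) * 0)) UNIV"
      by (intro has_sum_diff has_sum_cmult_right th f')
  qed (rule ineq)
  moreover have "2 - 2 / pi * S > 0"
  proof -
    have "2 / pi * S \<le> 2 / pi * 2.9" using S(2) by (intro mult_left_mono) auto
    also have "\<dots> < 2" using pi_gt3 by (simp add: field_simps)
    finally show ?thesis by simp
  qed
  then have c: "2 * H - 2 / pi * S * H = (2 - 2 / pi * S) * H" "2 - 2 / pi * S > 0" by (auto simp: algebra_simps)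
  ultimately show ?thesis
  proof (intro that[of "(2 - 2 / pi * S) * H"])
    show "(2 - 2 / pi * S) * H \<ge> 0" using c H0 by (intro mult_nonneg_nonneg) auto
    assume "y\<^sup>2 > 3/4"
    then have "y \<noteq> y0" using y0 by auto
    then have "y0 < y" using \<open>y0 \<le> y\<close> by simp
    then have "w0 - w > 0" using y0(1) by (simp add: w_def w0_def frac_less2)
    then have "exp (- A * w0) * (A * (w0 - w))\<^sup>2 / 2 > 0" using A by simp
    then show "(2 - 2 / pi * S) * H > 0" using c H by (intro mult_pos_pos) linarith+
  qed (auto simp: y0_def)
qed

definition hex :: complex where "hex = Complex (1/2) (sqrt 3 / 2)"

lemma lattice_theta_horizontal:
  fixes \<alpha> x y :: real
  assumes \<alpha>: "\<alpha> \<ge> 1" and y: "y > 0" "y\<^sup>2 \<ge> 3/4" and x: "0 \<le> x" "x \<le> 1"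
  shows "lattice_theta \<alpha> (Complex (1/2) y) \<le> lattice_theta \<alpha> (Complex x y)"
    and "x \<noteq> 1/2 \<Longrightarrow> lattice_theta \<alpha> (Complex (1/2) y) < lattice_theta \<alpha> (Complex x y)"
proof -
  have "\<exists>D. D \<ge> 0 \<and> (x \<noteq> 1/2 \<longrightarrow> D > 0) \<and> D \<le> lattice_theta \<alpha> (Complex x y) - lattice_theta \<alpha> (Complex (1/2) y)"
  proof (cases "y / \<alpha> \<ge> 1/2")
    case True
    have "y \<ge> 1/2" by (rule power2_le_imp_le) (use y in \<open>auto simp: power2_eq_square\<close>)
    then have "y * \<alpha> \<ge> 1/2 * 1" using \<alpha> by (intro mult_mono) auto
    with True \<alpha> obtain c where c: "c > 0" "c * (1 + cos (2 * pi * x)) \<le> lattice_theta \<alpha> (Complex x y) - lattice_theta \<alpha> (Complex (1/2) y)"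
      using lattice_theta_horizontal_large[of \<alpha> y x] by auto
    have "1 + cos (2 * pi * x) = 2 * (cos (pi * x))\<^sup>2"
      using cos_double_cos[of "pi * x"] by (simp add: mult.assoc)
    moreover have "cos (pi * x) \<noteq> 0" if "x \<noteq> 1/2"
    proof
      assume "cos (pi * x) = 0"
      then have eq: "cos (pi * x) = cos (pi / 2)" by simp
      have "pi * x = pi / 2"
        by (rule cos_inj_pi[OF _ _ _ _ eq]) (use x mult_left_mono[of x 1 pi] in simp_all)
      then show False using that by (simp add: field_simps)
    qed
    ultimately show ?thesis using c by (intro exI[of _ "c * (1 + cos (2 * pi * x))"]) auto
  next
    case False
    then obtain c where "c > 0" "c * (x - 1/2)\<^sup>2 \<le> lattice_theta \<alpha> (Complex x y) - lattice_theta \<alpha> (Complex (1/2) y)"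
      using lattice_theta_horizontal_small[of \<alpha> y x] y x \<alpha> by auto
    then show ?thesis by (intro exI[of _ "c * (x - 1/2)\<^sup>2"]) auto
  qed
  then show "lattice_theta \<alpha> (Complex (1/2) y) \<le> lattice_theta \<alpha> (Complex x y)"
    "x \<noteq> 1/2 \<Longrightarrow> lattice_theta \<alpha> (Complex (1/2) y) < lattice_theta \<alpha> (Complex x y)" by auto
qed

lemma lattice_theta_minimum_strip:
  fixes \<alpha> x y :: real
  assumes \<alpha>: "\<alpha> > 0" and y: "y > 0" "y\<^sup>2 \<ge> 3/4" and x: "0 \<le> x" "x \<le> 1"
  shows "lattice_theta \<alpha> hex \<le> lattice_theta \<alpha> (Complex x y)"
    and "Complex x y \<noteq> hex \<Longrightarrow> lattice_theta \<alpha> hex < lattice_theta \<alpha> (Complex x y)"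
proof -
  have *: "lattice_theta \<beta> hex \<le> lattice_theta \<beta> (Complex x y) \<and>
     (Complex x y \<noteq> hex \<longrightarrow> lattice_theta \<beta> hex < lattice_theta \<beta> (Complex x y))" if b1: "\<beta> \<ge> 1" for \<beta>
  proof -
    obtain H where H: "H \<le> lattice_theta \<beta> (Complex (1/2) y) - lattice_theta \<beta> hex"
      "H \<ge> 0" "y\<^sup>2 > 3/4 \<Longrightarrow> H > 0"
      using lattice_theta_vertical[OF b1 y] unfolding hex_def by metis
    note h = lattice_theta_horizontal[OF b1 y x]
    show ?thesis
    proof (cases "x = 1/2")
      case True
      have "y\<^sup>2 > 3/4" if "Complex x y \<noteq> hex"
      proof (rule ccontr)
        assume "\<not> y\<^sup>2 > 3/4"
        then have "y\<^sup>2 = (sqrt 3 / 2)\<^sup>2" using y by (simp add: power_divide)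
        then have "y = sqrt 3 / 2" using y by (subst (asm) power2_eq_iff_nonneg) auto
        then show False using that True by (simp add: hex_def)
      qed
      then show ?thesis using H h by force
    next
      case False
      then show ?thesis using H h by auto
    qed
  qed
  have "lattice_theta \<alpha> hex \<le> lattice_theta \<alpha> (Complex x y) \<and>
     (Complex x y \<noteq> hex \<longrightarrow> lattice_theta \<alpha> hex < lattice_theta \<alpha> (Complex x y))"
  proof (cases "\<alpha> \<ge> 1")
    case False
    then have "1 / \<alpha> \<ge> 1" using \<alpha> by simp
    from *[OF this] show ?thesis
      using lattice_theta_inverse[of hex \<alpha>] lattice_theta_inverse[of "Complex x y" \<alpha>] \<alpha> y by (auto simp: hex_def)
  qed (use * in auto)
  then show "lattice_theta \<alpha> hex \<le> lattice_theta \<alpha> (Complex x y)"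
    "Complex x y \<noteq> hex \<Longrightarrow> lattice_theta \<alpha> hex < lattice_theta \<alpha> (Complex x y)" by auto
qed

lemma hex_eq: "hexagonal_point = hex"
  by (simp add: hexagonal_point_def hex_def complex_eq_iff Re_exp Im_exp cos_60 sin_60)

subsection \<open>The modular group\<close>

definition mat2 :: "int \<Rightarrow> int \<Rightarrow> int \<Rightarrow> int \<Rightarrow> int ^ 2 ^ 2" where
  "mat2 a b c d = (\<chi> i j. if i = 1 then (if j = 1 then a else b) else (if j = 1 then c else d))"

lemma mat2_nth [simp]: "mat2 a b c d $ 1 $ 1 = a" "mat2 a b c d $ 1 $ 2 = b" "mat2 a b c d $ 2 $ 1 = c" "mat2 a b c d $ 2 $ 2 = d"
  by (auto simp: mat2_def)

lemma mat2_in_SL2Z: "mat2 a b c d \<in> SL2Z \<longleftrightarrow> a * d - b * c = 1"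
  by (simp add: SL2Z_def det_2)

lemma moebius_mat2: "moebius_action (mat2 a b c d) z = (of_int a * z + of_int b) / (of_int c * z + of_int d)"
  by (simp add: moebius_action_def)

lemma SL2Z_cases:
  assumes "A \<in> SL2Z"
  obtains a b c d where "A = mat2 a b c d" "a * d - b * c = 1"
proof (rule that)
  show "A = mat2 (A $ 1 $ 1) (A $ 1 $ 2) (A $ 2 $ 1) (A $ 2 $ 2)"
    by (auto simp: mat2_def vec_eq_iff forall_2)
  show "A $ 1 $ 1 * A $ 2 $ 2 - A $ 1 $ 2 * A $ 2 $ 1 = 1"
    using assms by (simp add: SL2Z_def det_2)
qed

lemma denom_nonzero:
  assumes "Im z > 0" "(c, d) \<noteq> (0, 0::int)"
  shows "of_int c * z + of_int d \<noteq> 0"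
  using assms by (auto simp: complex_eq_iff)

lemma moebius_Im:
  assumes z: "Im z > 0" and A: "a * d - b * c = 1"
  defines "w \<equiv> (of_int a * z + of_int b) / (of_int c * z + of_int d)"
  shows "Im w = Im z / (cmod (of_int c * z + of_int d))\<^sup>2" "Im w > 0"
proof -
  have nz: "of_int c * z + of_int d \<noteq> 0" using A z by (intro denom_nonzero) auto
  have "w = (of_int a * z + of_int b) * cnj (of_int c * z + of_int d) / (cmod (of_int c * z + of_int d))\<^sup>2"
    unfolding w_def by (rule complex_div_cnj)
  then have "Im w = Im ((of_int a * z + of_int b) * cnj (of_int c * z + of_int d)) / (cmod (of_int c * z + of_int d))\<^sup>2"
    by (simp only: Im_divide_of_real)
  also have "Im ((of_int a * z + of_int b) * cnj (of_int c * z + of_int d)) = of_int (a * d - b * c) * Im z"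
    by (simp add: algebra_simps)
  finally show 1: "Im w = Im z / (cmod (of_int c * z + of_int d))\<^sup>2" using A by simp
  then show "Im w > 0" using nz z by simp
qed

text \<open>After clearing the denominator, m w + n is a lattice vector of z divided by c z + d, and
  the squared norm of the same factor divides the imaginary part.\<close>

lemma qform_moebius:
  assumes z: "Im z > 0" and A: "a * d - b * c = 1"
  defines "w \<equiv> (of_int a * z + of_int b) / (of_int c * z + of_int d)"
  shows "qform w (m, n) = qform z (m * a + n * c, m * b + n * d)"
proof -
  have nz: "of_int c * z + of_int d \<noteq> 0" using A z by (intro denom_nonzero) auto
  have "of_int m * w + of_int n = (of_int (m * a + n * c) * z + of_int (m * b + n * d)) / (of_int c * z + of_int d)"
    unfolding w_def using nz by (simp add: field_simps)
  then show ?thesis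
    unfolding qform_def fst_conv snd_conv moebius_Im(1)[OF z A, folded w_def] using nz z
    by (simp add: norm_divide power_divide)
qed

lemma qform_sum_moebius:
  assumes z: "Im z > 0" and A: "a * d - b * c = 1"
  defines "w \<equiv> (of_int a * z + of_int b) / (of_int c * z + of_int d)"
  shows "(\<Sum>\<^sub>\<infinity>p\<in>UNIV. f (qform w p)) = (\<Sum>\<^sub>\<infinity>p\<in>UNIV. f (qform z p))"
    and "(\<Sum>\<^sub>\<infinity>p\<in>UNIV - {(0,0)}. f (qform w p)) = (\<Sum>\<^sub>\<infinity>p\<in>UNIV - {(0,0)}. f (qform z p))"
proof -
  \<comment> \<open>The map \<open>?i\<close> comes from the inverse matrix.\<close>
  let ?j = "\<lambda>(m, n). (m * a + n * c, m * b + n * d)" and ?i = "\<lambda>(m, n). (m * d - n * c, n * a - m * b)"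
  have ij: "?i (?j p) = p" "?j (?i p) = p" for p
  proof -
    obtain m n where p: "p = (m, n)" by (cases p)
    have "(m * a + n * c) * d - (m * b + n * d) * c = m * (a * d - b * c)"
         "(m * b + n * d) * a - (m * a + n * c) * b = n * (a * d - b * c)"
         "(m * d - n * c) * a + (n * a - m * b) * c = m * (a * d - b * c)"
         "(m * d - n * c) * b + (n * a - m * b) * d = n * (a * d - b * c)"
      by (auto simp: algebra_simps)
    then show "?i (?j p) = p" "?j (?i p) = p" using A by (auto simp: p)
  qed
  have z0: "?i (0,0) = (0,0)" "?j (0,0) = (0,0)" by auto
  have q: "qform w p = qform z (?j p)" for p
    using qform_moebius[OF z A, folded w_def] by (cases p) auto
  show "(\<Sum>\<^sub>\<infinity>p\<in>UNIV. f (qform w p)) = (\<Sum>\<^sub>\<infinity>p\<in>UNIV. f (qform z p))"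
    by (rule infsum_reindex_bij_witness[where i = ?i and j = ?j]) (simp_all only: ij q UNIV_I)
  show "(\<Sum>\<^sub>\<infinity>p\<in>UNIV - {(0,0)}. f (qform w p)) = (\<Sum>\<^sub>\<infinity>p\<in>UNIV - {(0,0)}. f (qform z p))"
  proof (rule infsum_reindex_bij_witness[where i = ?i and j = ?j])
    show "?j p \<in> UNIV - {(0,0)}" if "p \<in> UNIV - {(0,0)}" for p
    proof -
      have "?j p \<noteq> (0, 0)"
      proof
        assume "?j p = (0, 0)"
        then have "?i (?j p) = ?i (0, 0)" by (rule arg_cong)
        then have "p = (0, 0)" unfolding ij z0 .
        with that show False by simp
      qed
      then show ?thesis by (simp only: DiffI UNIV_I singleton_iff not_False_eq_True)
    qed
    show "?i p \<in> UNIV - {(0,0)}" if "p \<in> UNIV - {(0,0)}" for p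
    proof -
      have "?i p \<noteq> (0, 0)"
      proof
        assume "?i p = (0, 0)"
        then have "?j (?i p) = ?j (0, 0)" by (rule arg_cong)
        then have "p = (0, 0)" unfolding ij z0 .
        with that show False by simp
      qed
      then show ?thesis by (simp only: DiffI UNIV_I singleton_iff not_False_eq_True)
    qed
  qed (simp_all only: ij q)
qed

lemma lattice_theta_moebius:
  assumes "Im z > 0" "A \<in> SL2Z"
  shows "lattice_theta \<alpha> (moebius_action A z) = lattice_theta \<alpha> z"
proof -
  obtain a b c d where A: "A = mat2 a b c d" "a * d - b * c = 1" using SL2Z_cases[OF assms(2)] .
  show ?thesis
    unfolding lattice_theta_qform A(1) moebius_mat2 by (rule qform_sum_moebius(1)[OF assms(1) A(2)])
qed

lemma qform_zero: "qform z (0, 0) = 0"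
  by (simp add: qform_def)

lemma qform_pos:
  assumes "Im z > 0" "p \<noteq> (0, 0)"
  shows "qform z p > 0"
proof -
  have "of_int (fst p) * z + of_int (snd p) \<noteq> 0"
    using assms by (intro denom_nonzero) (auto simp: prod_eq_iff)
  then show ?thesis using assms by (simp add: qform_def)
qed

lemma epstein_zeta_qform:
  assumes "Im z > 0"
  shows "epstein_zeta s z = (\<Sum>\<^sub>\<infinity>p\<in>UNIV - {(0,0)}. qform z p powr (- s))"
  unfolding epstein_zeta_def
proof (rule infsum_cong)
  fix p :: "int \<times> int" assume p: "p \<in> UNIV - {(0, 0)}"
  obtain m n where mn: "p = (m, n)" by (cases p)
  have "(m, n) \<noteq> (0, 0)" using p mn by simp
  then have nz: "cmod (of_int m * z + of_int n) > 0" using denom_nonzero[OF assms] by simp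
  have "qform z (m, n) powr (- s) = (cmod (of_int m * z + of_int n) powr 2 / Im z) powr (- s)"
    using nz by (simp add: qform_def)
  also have "\<dots> = (cmod (of_int m * z + of_int n) powr 2) powr (- s) / Im z powr (- s)"
    by (rule powr_divide)
  also have "\<dots> = Im z powr s / cmod (of_int m * z + of_int n) powr (2 * s)"
    unfolding powr_powr using assms by (simp add: powr_minus divide_inverse mult.commute)
  finally show "(case p of (m, n) \<Rightarrow> Im z powr s / cmod (of_int m * z + of_int n) powr (2 * s)) = qform z p powr (- s)"
    by (simp add: mn)
qed

lemma epstein_zeta_moebius:
  assumes "Im z > 0" "A \<in> SL2Z"
  shows "epstein_zeta s (moebius_action A z) = epstein_zeta s z"
proof -
  obtain a b c d where A: "A = mat2 a b c d" "a * d - b * c = 1" using SL2Z_cases[OF assms(2)] .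
  have "Im (moebius_action A z) > 0" unfolding A(1) moebius_mat2 by (rule moebius_Im(2)[OF assms(1) A(2)])
  then show ?thesis
    unfolding epstein_zeta_qform[OF \<open>Im (moebius_action A z) > 0\<close>] epstein_zeta_qform[OF assms(1)]
    unfolding A(1) moebius_mat2 by (intro qform_sum_moebius(2)[OF assms(1) A(2)])
qed

text \<open>A shortest nonzero lattice vector (c, d) is primitive, as dividing by a common factor
  would shorten it, and so it is the bottom row of a matrix of determinant 1. A translation puts the
  real part into [0, 1). For the image point (0, 1) is a shortest vector, which keeps the imaginary
  part large.\<close>

lemma modular_reduction:
  assumes z: "Im z > 0"
  obtains A where "A \<in> SL2Z" "Im (moebius_action A z) > 0" "(Im (moebius_action A z))\<^sup>2 \<ge> 3/4"
    "0 \<le> Re (moebius_action A z)" "Re (moebius_action A z) < 1"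
proof -
  obtain \<kappa> where \<kappa>: "\<kappa> > 0" "\<And>m n. \<kappa> * (of_int m ^ 2 + of_int n ^ 2) \<le> qform z (m, n)"
    using qform_lower_bound[OF z] by blast
  define X where "X = {p. p \<noteq> (0,0) \<and> qform z p \<le> qform z (1, 0)}"
  have "finite X"
  proof (rule finite_subset)
    define N where "N = \<lceil>qform z (1, 0) / \<kappa>\<rceil>"
    show "X \<subseteq> {-N..N} \<times> {-N..N}"
    proof
      fix p assume "p \<in> X"
      then obtain m n where p: "p = (m, n)" "qform z (m, n) \<le> qform z (1, 0)" by (cases p) (auto simp: X_def)
      have "\<kappa> * (of_int m ^ 2 + of_int n ^ 2) \<le> qform z (1, 0)" using \<kappa>(2)[of m n] p by linarith
      then have "of_int m ^ 2 + of_int n ^ 2 \<le> qform z (1, 0) / \<kappa>" using \<kappa>(1) by (simp add: field_simps)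
      also have "\<dots> \<le> of_int N" by (simp add: N_def)
      finally have "of_int (m ^ 2 + n ^ 2) \<le> (of_int N :: real)" by simp
      then have le: "m ^ 2 + n ^ 2 \<le> N" by (simp only: of_int_le_iff)
      have "\<bar>k\<bar> \<le> k ^ 2" for k :: int
      proof (cases "k = 0")
        case False
        then have "\<bar>k\<bar> * 1 \<le> \<bar>k\<bar> * \<bar>k\<bar>" by (intro mult_left_mono) auto
        then show ?thesis by (simp add: power2_eq_square)
      qed simp
      from this[of m] this[of n] le have "\<bar>m\<bar> \<le> N" "\<bar>n\<bar> \<le> N"
        using zero_le_power2[of m] zero_le_power2[of n] by linarith+
      then show "p \<in> {-N..N} \<times> {-N..N}" by (auto simp: p)
    qed
  qed auto
  moreover have "(1, 0) \<in> X" by (simp add: X_def)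
  ultimately have "Min (qform z ` X) \<in> qform z ` X" by (intro Min_in) auto
  then obtain p where p: "p \<in> X" "qform z p = Min (qform z ` X)" by auto
  then have p: "p \<in> X" "\<And>q. q \<in> X \<Longrightarrow> qform z p \<le> qform z q"
    using \<open>finite X\<close> by auto
  obtain c d where cd: "p = (c, d)" by (cases p)
  have p0: "(c, d) \<noteq> (0, 0)" using p cd by (simp add: X_def)
  have min: "qform z (c, d) \<le> qform z q" if "q \<noteq> (0,0)" for q
  proof (cases "q \<in> X")
    case True
    then show ?thesis using p(2) cd by simp
  next
    case False
    then have "qform z (1, 0) < qform z q" using that by (simp add: X_def)
    moreover have "qform z (c, d) \<le> qform z (1, 0)" using p(1) cd by (simp add: X_def)
    ultimately show ?thesis by linarith
  qed
  have "coprime c d"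
  proof (rule ccontr)
    assume "\<not> coprime c d"
    define g where "g = gcd c d"
    have g: "g \<ge> 2"
    proof -
      have "g \<noteq> 1" using \<open>\<not> coprime c d\<close> unfolding g_def by (simp add: coprime_iff_gcd_eq_1)
      moreover have "g > 0" unfolding g_def using p0 by (auto simp: gcd_pos_int)
      ultimately show ?thesis by linarith
    qed
    define c' d' where "c' = c div g" and "d' = d div g"
    have c': "c = g * c'" "d = g * d'" by (auto simp: c'_def d'_def g_def)
    have nz: "(c', d') \<noteq> (0, 0)" using p0 c' by auto
    have "qform z (c, d) = (of_int g)\<^sup>2 * qform z (c', d')"
      unfolding qform_eq[OF z] c' using z by (simp add: field_simps power2_eq_square)
    moreover have "(of_int g)\<^sup>2 \<ge> (2\<^sup>2 :: real)" using g by (intro power_mono) auto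
    moreover have "qform z (c', d') > 0" by (rule qform_pos[OF z nz])
    ultimately have "qform z (c, d) \<ge> 4 * qform z (c', d')" by (auto intro!: mult_right_mono)
    with min[OF nz] \<open>qform z (c', d') > 0\<close> show False by linarith
  qed
  then obtain u v where "u * c + v * d = 1" using bezout_int[of c d] by auto
  then have det: "v * d - (- u) * c = 1" by (simp add: algebra_simps)
  define w where "w = (of_int v * z + of_int (- u)) / (of_int c * z + of_int d)"
  have w: "Im w > 0" unfolding w_def by (rule moebius_Im(2)[OF z det])
  define k where "k = \<lfloor>Re w\<rfloor>"
  have det': "(v - k * c) * d - (- u - k * d) * c = 1" using det by (simp add: algebra_simps)
  define A where "A = mat2 (v - k * c) (- u - k * d) c d"
  have nz: "of_int c * z + of_int d \<noteq> 0" by (rule denom_nonzero[OF z p0])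
  have Aw: "moebius_action A z = w - of_int k"
    unfolding A_def moebius_mat2 w_def using nz by (simp add: field_simps)
  have qw: "qform (w - of_int k) (m, n) \<ge> qform (w - of_int k) (0, 1)" if "(m, n) \<noteq> (0, 0)" for m n
  proof -
    have e: "qform (w - of_int k) (m, n) = qform z (m * (v - k * c) + n * c, m * (- u - k * d) + n * d)" for m n
      using qform_moebius[OF z det', of m n] Aw unfolding A_def moebius_mat2 by simp
    have "qform (w - of_int k) (m, n) > 0" using that w by (intro qform_pos) auto
    then have "(m * (v - k * c) + n * c, m * (- u - k * d) + n * d) \<noteq> (0, 0)"
      unfolding e by (metis qform_zero less_irrefl)
    from min[OF this] show ?thesis unfolding e by simp
  qed
  define w' where "w' = w - of_int k"
  have w': "Im w' > 0" "0 \<le> Re w'" "Re w' < 1" using w by (auto simp: w'_def k_def) linarith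
  have "(Im w')\<^sup>2 \<ge> 3/4"
  \<comment> \<open>The vectors (1, 0) and (1, -1) say that the point has distance at least 1 from 0
    and from 1; the nearer of the two differs from it by at most 1/2 in the real part.\<close>
  proof (cases "Re w' \<le> 1/2")
    case True
    have "qform w' (1, 0) \<ge> qform w' (0, 1)" unfolding w'_def by (rule qw) auto
    then have "(Im w')\<^sup>2 + (Re w')\<^sup>2 \<ge> 1" unfolding qform_eq[OF w'(1)] using w' by (simp add: field_simps power2_eq_square)
    moreover have "(Re w')\<^sup>2 \<le> (1/2)\<^sup>2" using w' True by (intro power_mono) auto
    ultimately show ?thesis by (simp add: power2_eq_square)
  next
    case False
    have "qform w' (1, -1) \<ge> qform w' (0, 1)" unfolding w'_def by (rule qw) auto
    then have "(Im w')\<^sup>2 + (1 - Re w')\<^sup>2 \<ge> 1" unfolding qform_eq[OF w'(1)] using w' by (simp add: field_simps power2_eq_square)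
    moreover have "(1 - Re w')\<^sup>2 \<le> (1/2)\<^sup>2" using w' False by (intro power_mono) auto
    ultimately show ?thesis by (simp add: power2_eq_square)
  qed
  moreover have "A \<in> SL2Z" using det' by (simp add: A_def mat2_in_SL2Z)
  ultimately show ?thesis using w' by (intro that[of A]) (auto simp: Aw w'_def)
qed

subsection \<open>Epstein zeta functions\<close>

lemma summable_int_powr:
  fixes s :: real
  assumes "s > 1"
  shows "(\<lambda>m::int. (1 + \<bar>of_int m\<bar>) powr (- s)) summable_on UNIV"
proof -
  have "summable (\<lambda>n. real n powr (- s))" using assms by (simp add: summable_real_powr_iff)
  then have "summable (\<lambda>n. real (Suc n) powr (- s))" by (subst summable_Suc_iff)
  then have "(\<lambda>n. real (Suc n) powr (- s)) summable_on UNIV"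
    by (intro summable_nonneg_imp_summable_on) auto
  then have "(\<lambda>n. real (Suc n) powr (- s)) summable_on {1..}"
    by (rule summable_on_subset_banach) auto
  then obtain a where a: "((\<lambda>n. real (Suc n) powr (- s)) has_sum a) {1..}" by (auto simp: summable_on_def)
  have "((\<lambda>m::int. (1 + \<bar>of_int m\<bar>) powr (- s)) has_sum ((1 + \<bar>of_int 0\<bar>) powr (- s) + (a + a))) UNIV"
    by (rule has_sum_int_split) (use a in simp_all)
  then show ?thesis by (auto simp: summable_on_def)
qed

text \<open>Since (1 + |m|) (1 + |n|) <= 4 (m^2 + n^2) away from the origin, the series is dominated
  by a product of two one-variable series, each convergent for s > 1.\<close>

lemma summable_epstein_zeta:
  assumes z: "Im z > 0" and s: "s > 1"
  shows "(\<lambda>p. qform z p powr (- s)) summable_on (UNIV - {(0, 0)})"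
proof -
  obtain c where c: "c > 0" "\<And>m n. c * (of_int m ^ 2 + of_int n ^ 2) \<le> qform z (m, n)"
    using qform_lower_bound[OF z] by blast
  obtain a where a: "((\<lambda>m::int. (1 + \<bar>of_int m\<bar>) powr (- s)) has_sum a) UNIV"
    using summable_int_powr[OF s] by (auto simp: summable_on_def)
  have "((\<lambda>(m, n). (1 + \<bar>of_int m\<bar>) powr (- s) * (1 + \<bar>of_int n\<bar>) powr (- s)) has_sum a * a) (UNIV \<times> UNIV :: (int \<times> int) set)"
    using has_sum_product_nonneg[OF a a] by simp
  from has_sum_cmult_right[OF this, of "(c / 4) powr (- s)"]
  have "(\<lambda>p. (c / 4) powr (- s) * (case p of (m, n) \<Rightarrow> (1 + \<bar>of_int m\<bar>) powr (- s) * (1 + \<bar>of_int n\<bar>) powr (- s))) summable_on (UNIV :: (int \<times> int) set)"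
    by (auto simp: summable_on_def)
  then have "(\<lambda>p. (c / 4) powr (- s) * (case p of (m, n) \<Rightarrow> (1 + \<bar>of_int m\<bar>) powr (- s) * (1 + \<bar>of_int n\<bar>) powr (- s))) summable_on (UNIV - {(0, 0)} :: (int \<times> int) set)"
    by (rule summable_on_subset_banach) auto
  then show ?thesis
  proof (rule summable_on_comparison_test)
    fix p :: "int \<times> int" assume "p \<in> UNIV - {(0, 0)}"
    then obtain m n where p: "p = (m, n)" "(m, n) \<noteq> (0, 0)" by (cases p) auto
    define M where "M = max \<bar>m\<bar> \<bar>n\<bar>"
    have M: "M \<ge> 1" "\<bar>m\<bar> \<le> M" "\<bar>n\<bar> \<le> M" using p(2) by (auto simp: M_def)
    have "(1 + \<bar>of_int m\<bar>) * (1 + \<bar>of_int n\<bar>) \<le> (2 * of_int M) * (2 * of_int M :: real)"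
      using M by (intro mult_mono) linarith+
    also have "\<dots> = 4 * (of_int M)\<^sup>2" by (simp add: power2_eq_square)
    also have "(of_int M :: real)\<^sup>2 \<le> of_int m ^ 2 + of_int n ^ 2" by (auto simp: M_def max_def)
    finally have "c / 4 * ((1 + \<bar>of_int m\<bar>) * (1 + \<bar>of_int n\<bar>)) \<le> c / 4 * (4 * (of_int m ^ 2 + of_int n ^ 2))"
      using c by (intro mult_left_mono) auto
    also have "\<dots> = c * (of_int m ^ 2 + of_int n ^ 2)" by simp
    also have "\<dots> \<le> qform z (m, n)" by (rule c(2))
    finally have "qform z (m, n) powr (- s) \<le> (c / 4 * ((1 + \<bar>of_int m\<bar>) * (1 + \<bar>of_int n\<bar>))) powr (- s)"
      using c s by (intro powr_mono2') auto
    also have "\<dots> = (c / 4) powr (- s) * ((1 + \<bar>of_int m\<bar>) powr (- s) * (1 + \<bar>of_int n\<bar>) powr (- s))"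
      by (simp only: powr_mult)
    finally show "qform z p powr (- s) \<le> (c / 4) powr (- s) * (case p of (m, n) \<Rightarrow> (1 + \<bar>of_int m\<bar>) powr (- s) * (1 + \<bar>of_int n\<bar>) powr (- s))"
      by (simp add: p)
  qed auto
qed

lemma has_sum_epstein_zeta:
  assumes "Im z > 0" "s > 1"
  shows "((\<lambda>p. qform z p powr (- s)) has_sum epstein_zeta s z) (UNIV - {(0, 0)})"
  using summable_epstein_zeta[OF assms] assms by (simp add: epstein_zeta_qform)

section \<open>The Mellin transform from theta to zeta\<close>

lemma Gamma_scaled_nn_integral:
  fixes s c :: real
  assumes s: "s > 0" and c: "c > 0"
  shows "(\<integral>\<^sup>+t. ennreal (indicator {0<..} t * (t powr (s - 1) * exp (- c * t))) \<partial>lborel) = ennreal (Gamma s * c powr (- s))"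
proof -
  let ?g = "\<lambda>t. ennreal (indicator {0..} t * t powr (s - 1) / exp t)"
  let ?h = "\<lambda>t. ennreal (indicator {0<..} t * (t powr (s - 1) * exp (- c * t)))"
  have eq: "?g (0 + c * t) = ennreal (c powr (s - 1)) * ?h t" for t
  proof (cases "t > 0")
    case True
    then show ?thesis using c
      by (simp add: indicator_def powr_mult exp_minus divide_inverse ennreal_mult[symmetric] mult_ac)
  next
    case False
    \<comment> \<open>The two indicators differ at t = 0 only, where
      \<open>0 powr (s - 1) = 0\<close>.\<close>
    then have "c * t < 0 \<or> t = 0" using c by (auto simp: mult_less_0_iff)
    then show ?thesis using False c by (auto simp: indicator_def)
  qed
  have "ennreal (Gamma s) = ennreal \<bar>c\<bar> * (\<integral>\<^sup>+t. ?g (0 + c * t) \<partial>lborel)"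
    unfolding Gamma_conv_nn_integral_real[OF s] using c by (intro nn_integral_real_affine) auto
  also have "\<dots> = ennreal c * (ennreal (c powr (s - 1)) * (\<integral>\<^sup>+t. ?h t \<partial>lborel))"
    unfolding eq using c by (subst nn_integral_cmult) auto
  also have "\<dots> = ennreal (c powr s) * (\<integral>\<^sup>+t. ?h t \<partial>lborel)"
    using c by (simp add: mult.assoc[symmetric] ennreal_mult[symmetric] powr_mult_base)
  finally have "ennreal (c powr (- s)) * ennreal (Gamma s) = ennreal (c powr (- s)) * (ennreal (c powr s) * (\<integral>\<^sup>+t. ?h t \<partial>lborel))"
    by simp
  also have "\<dots> = (\<integral>\<^sup>+t. ?h t \<partial>lborel)"
    using c by (simp add: mult.assoc[symmetric] ennreal_mult[symmetric] powr_minus)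
  finally show ?thesis using s by (simp add: ennreal_mult[symmetric] mult.commute Gamma_real_nonneg)
qed

lemma lattice_theta_punctured:
  assumes "Im z > 0" "\<alpha> > 0"
  shows "((\<lambda>p. exp (- pi * \<alpha> * qform z p)) has_sum (lattice_theta \<alpha> z - 1)) (UNIV - {(0, 0)})"
  using assms by (intro has_sum_Diff has_sum_lattice_theta has_sum_finiteI) (auto simp: qform_zero)

text \<open>The Gamma integral of each exponential is a power of the quadratic form. G is built as a
  series over an enumeration of the nonzero pairs, which gives measurability in \<alpha> and allows
  sum and nonnegative integral to be exchanged.\<close>

lemma epstein_zeta_Mellin:
  assumes z: "Im z > 0" and s: "s > 1"
  obtains G where "G \<in> borel_measurable lborel"
    "\<And>\<alpha>. \<alpha> > 0 \<Longrightarrow> G \<alpha> = ennreal (\<alpha> powr (s - 1) * (lattice_theta \<alpha> z - 1))"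
    "\<And>\<alpha>. \<alpha> \<le> 0 \<Longrightarrow> G \<alpha> = 0"
    "(\<integral>\<^sup>+\<alpha>. G \<alpha> \<partial>lborel) = ennreal (Gamma s * pi powr (- s) * epstein_zeta s z)"
proof -
  let ?X = "UNIV - {(0, 0)} :: (int \<times> int) set"
  have "countable ?X" "infinite ?X" by (auto simp: finite_prod)
  then have e: "bij_betw (from_nat_into ?X) UNIV ?X" by (rule bij_betw_from_nat_into)
  define Q where "Q n = qform z (from_nat_into ?X n)" for n
  have Q: "Q n > 0" for n
    unfolding Q_def using bij_betwE[OF e] by (intro qform_pos z) blast
  define k where "k n \<alpha> = indicator {0<..} \<alpha> * (\<alpha> powr (s - 1) * exp (- (pi * Q n) * \<alpha>))" for n and \<alpha> :: real
  define G where "G \<alpha> = (\<Sum>n. ennreal (k n \<alpha>))" for \<alpha>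
  show ?thesis
  proof (rule that)
    show "G \<in> borel_measurable lborel" unfolding G_def[abs_def] k_def by measurable
    show "G \<alpha> = 0" if "\<alpha> \<le> 0" for \<alpha> using that by (simp add: G_def k_def)
    show "G \<alpha> = ennreal (\<alpha> powr (s - 1) * (lattice_theta \<alpha> z - 1))" if "\<alpha> > 0" for \<alpha>
    proof -
      have "((\<lambda>p. \<alpha> powr (s - 1) * exp (- pi * \<alpha> * qform z p)) has_sum (\<alpha> powr (s - 1) * (lattice_theta \<alpha> z - 1))) ?X"
        by (intro has_sum_cmult_right lattice_theta_punctured z that)
      then have "((\<lambda>n. \<alpha> powr (s - 1) * exp (- pi * \<alpha> * qform z (from_nat_into ?X n))) has_sum (\<alpha> powr (s - 1) * (lattice_theta \<alpha> z - 1))) UNIV"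
        by (subst has_sum_reindex_bij_betw[OF e])
      also have "(\<lambda>n. \<alpha> powr (s - 1) * exp (- pi * \<alpha> * qform z (from_nat_into ?X n))) = (\<lambda>n. k n \<alpha>)"
        using that by (simp add: k_def Q_def fun_eq_iff mult_ac)
      finally have "(\<lambda>n. k n \<alpha>) sums (\<alpha> powr (s - 1) * (lattice_theta \<alpha> z - 1))" by (rule has_sum_imp_sums)
      then show ?thesis unfolding G_def by (intro suminf_ennreal_eq) (auto simp: k_def)
    qed
    have "(\<integral>\<^sup>+\<alpha>. G \<alpha> \<partial>lborel) = (\<Sum>n. \<integral>\<^sup>+\<alpha>. ennreal (k n \<alpha>) \<partial>lborel)"
      unfolding G_def k_def by (rule nn_integral_suminf) measurable
    also have "\<dots> = (\<Sum>n. ennreal (Gamma s * (pi * Q n) powr (- s)))"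
      unfolding k_def using s Q by (intro suminf_cong Gamma_scaled_nn_integral) auto
    also have "\<dots> = ennreal (Gamma s * pi powr (- s) * epstein_zeta s z)"
    proof (rule suminf_ennreal_eq)
      show "0 \<le> Gamma s * (pi * Q n) powr (- s)" for n using s by (simp add: Gamma_real_nonneg)
      have "((\<lambda>p. Gamma s * pi powr (- s) * qform z p powr (- s)) has_sum (Gamma s * pi powr (- s) * epstein_zeta s z)) ?X"
        by (intro has_sum_cmult_right has_sum_epstein_zeta z s)
      then have "((\<lambda>n. Gamma s * pi powr (- s) * qform z (from_nat_into ?X n) powr (- s)) has_sum (Gamma s * pi powr (- s) * epstein_zeta s z)) UNIV"
        by (subst has_sum_reindex_bij_betw[OF e])
      also have "(\<lambda>n. Gamma s * pi powr (- s) * qform z (from_nat_into ?X n) powr (- s)) = (\<lambda>n. Gamma s * (pi * Q n) powr (- s))"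
        using less_imp_le[OF Q] by (simp add: Q_def fun_eq_iff powr_mult)
      finally show "(\<lambda>n. Gamma s * (pi * Q n) powr (- s)) sums (Gamma s * pi powr (- s) * epstein_zeta s z)"
        by (rule has_sum_imp_sums)
    qed
    finally show "(\<integral>\<^sup>+\<alpha>. G \<alpha> \<partial>lborel) = ennreal (Gamma s * pi powr (- s) * epstein_zeta s z)" .
  qed
qed

lemma epstein_zeta_nonneg: "epstein_zeta s z \<ge> 0" if "Im z > 0"
  unfolding epstein_zeta_qform[OF that] by (rule infsum_nonneg) auto

lemma lattice_theta_ge_1: "lattice_theta \<alpha> z \<ge> 1" if "Im z > 0" "\<alpha> > 0"
  using has_sum_nonneg[OF lattice_theta_punctured[OF that]] by simp

lemma epstein_zeta_less:
  assumes z: "Im z > 0" "Im w > 0" and s: "s > 1"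
    and less: "\<And>\<alpha>. \<alpha> > 0 \<Longrightarrow> lattice_theta \<alpha> w < lattice_theta \<alpha> z"
  shows "epstein_zeta s w < epstein_zeta s z"
proof -
  obtain G where G: "G \<in> borel_measurable lborel"
    "\<And>\<alpha>. \<alpha> > 0 \<Longrightarrow> G \<alpha> = ennreal (\<alpha> powr (s - 1) * (lattice_theta \<alpha> z - 1))"
    "\<And>\<alpha>. \<alpha> \<le> 0 \<Longrightarrow> G \<alpha> = 0"
    "(\<integral>\<^sup>+\<alpha>. G \<alpha> \<partial>lborel) = ennreal (Gamma s * pi powr (- s) * epstein_zeta s z)"
    using epstein_zeta_Mellin[OF z(1) s] by blast
  obtain H where H: "H \<in> borel_measurable lborel"
    "\<And>\<alpha>. \<alpha> > 0 \<Longrightarrow> H \<alpha> = ennreal (\<alpha> powr (s - 1) * (lattice_theta \<alpha> w - 1))"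
    "\<And>\<alpha>. \<alpha> \<le> 0 \<Longrightarrow> H \<alpha> = 0"
    "(\<integral>\<^sup>+\<alpha>. H \<alpha> \<partial>lborel) = ennreal (Gamma s * pi powr (- s) * epstein_zeta s w)"
    using epstein_zeta_Mellin[OF z(2) s] by blast
  have lt: "H \<alpha> < G \<alpha>" if "\<alpha> > 0" for \<alpha>
    unfolding G(2)[OF that] H(2)[OF that]
    using that less[OF that] lattice_theta_ge_1[OF z(2) that]
    by (subst ennreal_less_iff) auto
  have le: "H \<alpha> \<le> G \<alpha>" for \<alpha>
    using lt[of \<alpha>] G(3)[of \<alpha>] H(3)[of \<alpha>] by (cases "\<alpha> > 0") auto
  have "(\<integral>\<^sup>+\<alpha>. H \<alpha> \<partial>lborel) < (\<integral>\<^sup>+\<alpha>. G \<alpha> \<partial>lborel)"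
  proof (rule nn_integral_less[OF H(1) G(1)])
    \<comment> \<open>The integrands differ at every point of (0, 1), which is not a null
      set.\<close>
    show "\<not> (AE \<alpha> in lborel. G \<alpha> \<le> H \<alpha>)"
    proof
      assume "AE \<alpha> in lborel. G \<alpha> \<le> H \<alpha>"
      then have "AE \<alpha> in lborel. \<alpha> \<notin> {0<..<1::real}"
        by eventually_elim (use lt in \<open>auto simp: not_le[symmetric]\<close>)
      then have "{0<..<1::real} \<in> null_sets lborel" by (subst AE_iff_null_sets) auto
      then show False by (auto simp: null_sets_def)
    qed
  qed (use H(4) le in auto)
  then have "Gamma s * pi powr (- s) * epstein_zeta s w < Gamma s * pi powr (- s) * epstein_zeta s z"
    unfolding G(4) H(4) using epstein_zeta_nonneg[OF z(2)] s
    by (subst (asm) ennreal_less_iff) (auto simp: Gamma_real_nonneg)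
  then show ?thesis using s by (simp add: mult_less_cancel_left_pos Gamma_real_pos)
qed

subsection \<open>Kronecker's limit formula\<close>

text \<open>
  Up to the factor \<open>m\<close> to the power \<open>- s\<close>, row \<open>m\<close> of the zeta sum is \<open>row_sum s (m x) (m y)\<close>; replacing the sum by
  an integral gives \<open>(m y)\<close> to the power \<open>1 - s\<close> times \<open>row_const s\<close>.
\<close>

definition row_sum :: "real \<Rightarrow> real \<Rightarrow> real \<Rightarrow> real" where
  "row_sum s x Y = (\<Sum>\<^sub>\<infinity>n\<in>(UNIV::int set). (Y / ((of_int n + x)\<^sup>2 + Y\<^sup>2)) powr s)"

definition row_const :: "real \<Rightarrow> real" where
  "row_const s = (\<integral>v. (1 / (1 + v\<^sup>2)) powr s \<partial>lborel)"

text \<open>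
  The error is bounded by the total variation of \<open>\<phi>\<close>, which is \<open>2 \<phi>(0)\<close> for an even unimodal function.
\<close>

lemma sum_integral_comparison:
  fixes \<phi> :: "real \<Rightarrow> real"
  assumes even: "\<And>u. \<phi> (- u) = \<phi> u" and nonneg: "\<And>u. \<phi> u \<ge> 0"
    and anti: "\<And>u v. 0 \<le> u \<Longrightarrow> u \<le> v \<Longrightarrow> \<phi> v \<le> \<phi> u"
    and cont: "continuous_on UNIV \<phi>"
    and int: "(\<phi> has_integral I) UNIV"
    and summ: "(\<lambda>n::int. \<phi> (of_int n)) summable_on UNIV"
    and hs: "((\<lambda>n::int. \<phi> (of_int n + x)) has_sum R) UNIV"
    and x: "0 \<le> x" "x \<le> 1"
  shows "\<bar>R - I\<bar> \<le> 2 * \<phi> 0"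
proof -
  define c where "c n = integral {0..1} (\<lambda>b. \<phi> (of_int n + b))" for n :: int
  have contn: "continuous_on {0..1} (\<lambda>b. \<phi> (of_int n + b))" for n :: int
    by (rule continuous_on_compose2[OF cont]) (auto intro!: continuous_intros)
  have c: "((\<lambda>b. \<phi> (of_int n + b)) has_integral c n) {0..1}" for n :: int
    unfolding c_def by (intro integrable_integral integrable_continuous_real contn)
  \<comment> \<open>The function is monotone on [n, n + 1], so d n is its oscillation there and
    bounds the distance of any of its values from the mean c n.\<close>
  define d where "d n = \<bar>\<phi> (of_int n) - \<phi> (of_int n + 1)\<bar>" for n :: int
  have neg: "\<phi> u \<le> \<phi> v" if "u \<le> v" "v \<le> 0" for u v
    using anti[of "- v" "- u"] that by (simp add: even)
  have between: "\<bar>\<phi> (of_int n + b) - \<phi> (of_int n + b')\<bar> \<le> d n" if "0 \<le> b" "b \<le> 1" "0 \<le> b'" "b' \<le> 1" for n :: int and b b'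
  proof (cases "n \<ge> 0")
    case True
    have "\<phi> (of_int n + u) \<le> \<phi> (of_int n) \<and> \<phi> (of_int n + 1) \<le> \<phi> (of_int n + u)" if "0 \<le> u" "u \<le> 1" for u
      using True that by (auto intro!: anti)
    from this[of b] this[of b'] that show ?thesis unfolding d_def by linarith
  next
    case False
    then have "of_int n + 1 \<le> (0::real)" by linarith
    then have "\<phi> (of_int n + u) \<ge> \<phi> (of_int n) \<and> \<phi> (of_int n + 1) \<ge> \<phi> (of_int n + u)" if "0 \<le> u" "u \<le> 1" for u
      using that by (auto intro!: neg)
    from this[of b] this[of b'] that show ?thesis unfolding d_def by linarith
  qed
  have cd: "\<bar>\<phi> (of_int n + x) - c n\<bar> \<le> d n" for n
  proof -
    have "((\<lambda>b. \<phi> (of_int n + x) - \<phi> (of_int n + b)) has_integral (\<phi> (of_int n + x) - c n)) {0..1}"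
      using has_integral_diff[OF has_integral_const_real[of "\<phi> (of_int n + x)" 0 1] c[of n]] by simp
    from has_integral_bound_real[of "d n" "{}", OF _ _ this] show ?thesis
      using between[of x _ n] x by (simp add: d_def)
  qed
  have summ1: "(\<lambda>n::int. \<phi> (of_int n + 1)) summable_on UNIV"
    using summ by (subst summable_on_reindex_bij_witness[where i = "\<lambda>n. n - 1" and j = "\<lambda>n. n + 1" and T = UNIV and h = "\<lambda>n::int. \<phi> (of_int n)"]) auto
  have "d summable_on UNIV"
  proof (rule summable_on_comparison_test)
    show "(\<lambda>n::int. \<phi> (of_int n) + \<phi> (of_int n + 1)) summable_on UNIV"
      by (intro summable_on_add summ summ1)
    show "d n \<le> \<phi> (of_int n) + \<phi> (of_int n + 1)" for n
      unfolding d_def using nonneg[of "of_int n"] nonneg[of "of_int n + 1"] by linarith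
  qed (auto simp: d_def)
  then obtain D where D: "(d has_sum D) UNIV" by (auto simp: summable_on_def)
  \<comment> \<open>By evenness n and -n - 1 have the same oscillation, and each half
    telescopes.\<close>
  have part: "(\<Sum>n\<in>{- int N..<int N}. d n) = 2 * (\<phi> 0 - \<phi> (real N))" for N
  proof (induction N)
    case (Suc N)
    have "{- int (Suc N)..<int (Suc N)} = insert (- int N - 1) (insert (int N) {- int N..<int N})"
      by auto
    then have s: "(\<Sum>n\<in>{- int (Suc N)..<int (Suc N)}. d n) = d (- int N - 1) + (d (int N) + (\<Sum>n\<in>{- int N..<int N}. d n))"
      by simp
    have "d (int N) = \<phi> (real N) - \<phi> (real N + 1)"
      using anti[of "real N" "real N + 1"] by (simp add: d_def)
    moreover have "d (- int N - 1) = \<phi> (real N) - \<phi> (real N + 1)"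
      using anti[of "real N" "real N + 1"] even[of "real N + 1"] even[of "real N"] by (simp add: d_def)
    ultimately show ?case unfolding s Suc by (simp add: add.commute)
  qed simp
  have D2: "D \<le> 2 * \<phi> 0"
  proof (rule LIMSEQ_le_const2[OF has_sum_int_intervals_limit[OF D]])
    show "\<exists>N. \<forall>n\<ge>N. (\<Sum>n\<in>{- int n..<int n}. d n) \<le> 2 * \<phi> 0"
      unfolding part using nonneg by auto
  qed
  have "(\<lambda>n. \<phi> (of_int n + x) - c n) summable_on UNIV"
    by (rule abs_summable_summable, rule Infinite_Sum.abs_summable_on_comparison_test'[OF \<open>d summable_on UNIV\<close>])
       (use cd in simp)
  then obtain T where T: "((\<lambda>n. \<phi> (of_int n + x) - c n) has_sum T) UNIV" by (auto simp: summable_on_def)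
  have "((\<lambda>n. \<phi> (of_int n + x) - (\<phi> (of_int n + x) - c n)) has_sum (R - T)) UNIV"
    by (intro has_sum_diff hs T)
  then have "(c has_sum (R - T)) UNIV" by simp
  from has_sum_unit_interval_integrals[OF int c this] have "R - I = T" by simp
  moreover have "norm T \<le> D" by (rule norm_infsum_le[OF T D]) (use cd in simp)
  ultimately show ?thesis using D2 by simp
qed

lemma integrable_inverse_quadratic: "integrable lborel (\<lambda>v::real. 1 / (1 + v\<^sup>2))"
  and integral_inverse_quadratic: "(\<integral>v. 1 / (1 + v\<^sup>2) \<partial>lborel) = pi"
proof -
  have "einterval (-\<infinity>) \<infinity> = UNIV" by (auto simp: einterval_def)
  then show "integrable lborel (\<lambda>v::real. 1 / (1 + v\<^sup>2))" "(\<integral>v. 1 / (1 + v\<^sup>2) \<partial>lborel) = pi"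
    using integrable_inverse_1_plus_square LBINT_inverse_1_plus_square
    by (auto simp: set_integrable_def interval_lebesgue_integral_def set_lebesgue_integral_def inverse_eq_divide)
qed

lemma inverse_quadratic_bounds: "0 < 1 / (1 + v\<^sup>2)" "1 / (1 + v\<^sup>2) \<le> (1::real)"
  by (auto simp: add_pos_nonneg)

lemma inverse_quadratic_powr_le:
  assumes "s \<ge> 1"
  shows "(1 / (1 + v\<^sup>2)) powr s \<le> 1 / (1 + v\<^sup>2 :: real)"
proof -
  have "(1 / (1 + v\<^sup>2)) powr s \<le> (1 / (1 + v\<^sup>2)) powr 1"
    using assms inverse_quadratic_bounds[of v] by (intro powr_mono') auto
  then show ?thesis using inverse_quadratic_bounds(1)[of v] by simp
qed

lemma integrable_row_const:
  assumes "s \<ge> 1"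
  shows "integrable lborel (\<lambda>v::real. (1 / (1 + v\<^sup>2)) powr s)"
  by (rule Bochner_Integration.integrable_bound[OF integrable_inverse_quadratic])
     (use inverse_quadratic_powr_le[OF assms] in auto)

lemma row_const_limit:
  assumes "s \<longlonglongrightarrow> 1" "\<And>k. s k \<ge> 1"
  shows "(\<lambda>k. row_const (s k)) \<longlonglongrightarrow> pi"
proof -
  have "(\<lambda>k. row_const (s k)) \<longlonglongrightarrow> (\<integral>v. 1 / (1 + v\<^sup>2) \<partial>lborel)"
    unfolding row_const_def
  proof (rule integral_dominated_convergence[where w = "\<lambda>v. 1 / (1 + v\<^sup>2)"])
    show "AE v in lborel. (\<lambda>k. (1 / (1 + v\<^sup>2)) powr s k) \<longlonglongrightarrow> 1 / (1 + v\<^sup>2)"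
    proof (intro AE_I2)
      fix v :: real
      have "(\<lambda>k. (1 / (1 + v\<^sup>2)) powr s k) \<longlonglongrightarrow> (1 / (1 + v\<^sup>2)) powr 1"
        using inverse_quadratic_bounds(1)[of v] by (intro tendsto_powr tendsto_const assms) auto
      then show "(\<lambda>k. (1 / (1 + v\<^sup>2)) powr s k) \<longlonglongrightarrow> 1 / (1 + v\<^sup>2)"
        using inverse_quadratic_bounds(1)[of v] by simp
    qed
    show "AE v in lborel. norm ((1 / (1 + v\<^sup>2)) powr s k) \<le> 1 / (1 + v\<^sup>2)" for k
      using inverse_quadratic_powr_le[OF assms(2)] by auto
  qed (auto intro: integrable_inverse_quadratic)
  then show ?thesis by (simp add: integral_inverse_quadratic)
qed

lemma row_has_integral:
  assumes "s \<ge> 1" "Y > 0"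
  shows "((\<lambda>u. (Y / (u\<^sup>2 + Y\<^sup>2)) powr s) has_integral (Y powr (1 - s) * row_const s)) UNIV"
proof -
  let ?f = "\<lambda>v::real. (1 / (1 + v\<^sup>2)) powr s"
  have eq: "(Y / (u\<^sup>2 + Y\<^sup>2)) powr s = Y powr (- s) * ?f (0 + (1 / Y) * u)" for u
  proof -
    have "Y / (u\<^sup>2 + Y\<^sup>2) = (1 / Y) * (1 / (1 + (u / Y)\<^sup>2))"
      using assms by (simp add: power_divide field_simps power2_eq_square)
    then have "(Y / (u\<^sup>2 + Y\<^sup>2)) powr s = (1 / Y) powr s * ?f (u / Y)" by (simp only: powr_mult)
    also have "(1 / Y) powr s = Y powr (- s)" by (simp only: powr_divide powr_one_eq_one powr_minus_divide)
    finally show ?thesis by simp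
  qed
  have 1: "integrable lborel (\<lambda>u. ?f (0 + (1 / Y) * u))"
    by (rule lborel_integrable_real_affine[OF integrable_row_const[OF assms(1)]]) (use assms in simp)
  have "row_const s = \<bar>1 / Y\<bar> *\<^sub>R (\<integral>u. ?f (0 + (1 / Y) * u) \<partial>lborel)"
    unfolding row_const_def by (rule lborel_integral_real_affine) (use assms in simp)
  moreover have "r = \<bar>1 / Y\<bar> *\<^sub>R J \<Longrightarrow> J = Y * r" for r J :: real
    using assms by simp
  ultimately have 2: "(\<integral>u. ?f (0 + (1 / Y) * u) \<partial>lborel) = Y * row_const s" by blast
  have "integrable lborel (\<lambda>u. (Y / (u\<^sup>2 + Y\<^sup>2)) powr s)"
    unfolding eq using 1 by (rule integrable_mult_right)
  moreover have "(\<integral>u. (Y / (u\<^sup>2 + Y\<^sup>2)) powr s \<partial>lborel) = Y powr (1 - s) * row_const s"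
    unfolding eq unfolding Bochner_Integration.integral_mult_right_zero 2
    using assms by (simp add: powr_diff powr_minus divide_inverse)
  ultimately show ?thesis using has_integral_integral_lborel by metis
qed

lemma row_base_summable:
  fixes x Y :: real
  assumes "Y > 0"
  shows "(\<lambda>n::int. Y / ((of_int n + x)\<^sup>2 + Y\<^sup>2)) summable_on UNIV"
proof -
  obtain c where c: "c > 0" "\<And>m n. c * (of_int m ^ 2 + of_int n ^ 2) \<le> qform (Complex x Y) (m, n)"
    using qform_lower_bound[of "Complex x Y"] assms by auto
  show ?thesis
  proof (rule summable_on_comparison_test)
    show "(\<lambda>n::int. 2 / c * (1 + \<bar>of_int n\<bar>) powr (- 2)) summable_on UNIV"
      by (intro summable_on_cmult_right summable_int_powr) simp
    fix n :: int
    have "(1 + \<bar>of_int n\<bar>)\<^sup>2 \<le> 2 * (1 + (of_int n)\<^sup>2 :: real)"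
      using zero_le_power2[of "1 - \<bar>of_int n :: real\<bar>"] by (simp add: power2_eq_square algebra_simps)
    then have "c / 2 * (1 + \<bar>of_int n\<bar>)\<^sup>2 \<le> c / 2 * (2 * (1 + (of_int n)\<^sup>2))"
      using c by (intro mult_left_mono) auto
    also have "\<dots> = c * (1 + (of_int n)\<^sup>2)" by simp
    also have "\<dots> \<le> qform (Complex x Y) (1, n)" using c(2)[of 1 n] by simp
    also have "\<dots> = ((of_int n + x)\<^sup>2 + Y\<^sup>2) / Y"
      using assms by (simp add: qform_Complex field_simps power2_eq_square)
    finally have le: "c / 2 * (1 + \<bar>of_int n\<bar>)\<^sup>2 \<le> ((of_int n + x)\<^sup>2 + Y\<^sup>2) / Y" .
    have pos: "c / 2 * (1 + \<bar>of_int n\<bar>)\<^sup>2 > 0" using c by (intro mult_pos_pos zero_less_power) auto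
    have "Y / ((of_int n + x)\<^sup>2 + Y\<^sup>2) = 1 / (((of_int n + x)\<^sup>2 + Y\<^sup>2) / Y)" by simp
    also have "\<dots> \<le> 1 / (c / 2 * (1 + \<bar>of_int n\<bar>)\<^sup>2)"
      by (rule divide_left_mono[OF le _ mult_pos_pos[OF order_less_le_trans[OF pos le] pos]]) simp
    also have "\<dots> = 2 / c * (1 + \<bar>of_int n\<bar>) powr (- 2)"
    proof -
      have "a powr (- 2) = 1 / a\<^sup>2" if "a > 0" for a :: real
        using that by (simp add: powr_minus_divide)
      from this[of "1 + \<bar>of_int n\<bar>"] have "(1 + \<bar>of_int n\<bar>) powr (- 2) = 1 / (1 + \<bar>of_int n\<bar> :: real)\<^sup>2" by simp
      then show ?thesis by (simp only:) simp
    qed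
    finally show "Y / ((of_int n + x)\<^sup>2 + Y\<^sup>2) \<le> 2 / c * (1 + \<bar>of_int n\<bar>) powr (- 2)" .
  qed (use assms in auto)
qed

lemma row_base_bounds:
  fixes u Y :: real
  assumes "Y > 0"
  shows "0 < Y / (u\<^sup>2 + Y\<^sup>2)" "Y / (u\<^sup>2 + Y\<^sup>2) \<le> 1 / Y"
proof -
  have p: "u\<^sup>2 + Y\<^sup>2 > 0" using assms by (simp add: add_nonneg_pos)
  then show "0 < Y / (u\<^sup>2 + Y\<^sup>2)" using assms by simp
  show "Y / (u\<^sup>2 + Y\<^sup>2) \<le> 1 / Y" using assms p by (simp add: field_simps power2_eq_square)
qed

text \<open>A majorant uniform in s, as passing to the limit s = 1 inside a row requires: the base
  is at most 1 / Y, which bounds its excess power s - 1.\<close>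

lemma row_powr_le:
  fixes s u Y :: real
  assumes "Y > 0" "1 \<le> s" "s \<le> 2"
  shows "(Y / (u\<^sup>2 + Y\<^sup>2)) powr s \<le> (1 + 1 / Y) * (Y / (u\<^sup>2 + Y\<^sup>2))"
proof -
  define U where "U = Y / (u\<^sup>2 + Y\<^sup>2)"
  have U: "0 < U" "U \<le> 1 / Y" using row_base_bounds[OF assms(1)] by (auto simp: U_def)
  have 1: "U powr s = U * U powr (s - 1)" using U by (simp add: powr_mult_base)
  have "U powr (s - 1) \<le> 1 + 1 / Y"
  proof (cases "U \<le> 1")
    case True
    then have "U powr (s - 1) \<le> 1" using U assms by (intro powr_le1) auto
    then show ?thesis using assms by (simp add: add_increasing2)
  next
    case False
    then have "U powr (s - 1) \<le> U powr 1" using assms by (intro powr_mono) auto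
    then show ?thesis using U by simp
  qed
  then have "U * U powr (s - 1) \<le> U * (1 + 1 / Y)" using U by (intro mult_left_mono) auto
  then show ?thesis unfolding U_def[symmetric] 1 by (simp only: mult.commute)
qed

lemma has_sum_row:
  assumes "Y > 0" "1 \<le> s" "s \<le> 2"
  shows "((\<lambda>n::int. (Y / ((of_int n + x)\<^sup>2 + Y\<^sup>2)) powr s) has_sum row_sum s x Y) UNIV"
  unfolding row_sum_def
proof (rule has_sum_infsum, rule summable_on_comparison_test)
  show "(\<lambda>n::int. (1 + 1 / Y) * (Y / ((of_int n + x)\<^sup>2 + Y\<^sup>2))) summable_on UNIV"
    by (intro summable_on_cmult_right row_base_summable assms)
qed (use row_powr_le[OF assms] in auto)

lemma row_sum_periodic: "row_sum s (x + of_int k) Y = row_sum s x Y"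
  unfolding row_sum_def
  by (rule infsum_reindex_bij_witness[where i = "\<lambda>n. n - k" and j = "\<lambda>n. n + k"]) (auto simp: algebra_simps)

lemma row_sum_minus: "row_sum s (- x) Y = row_sum s x Y"
  unfolding row_sum_def
  by (rule infsum_reindex_bij_witness[where i = uminus and j = uminus]) (auto simp: power2_eq_square algebra_simps)

lemma row_sum_comparison:
  assumes Y: "Y > 0" and s: "1 \<le> s" "s \<le> 2"
  shows "\<bar>row_sum s x Y - Y powr (1 - s) * row_const s\<bar> \<le> 2 * Y powr (- s)"
proof -
  let ?\<phi> = "\<lambda>u. (Y / (u\<^sup>2 + Y\<^sup>2)) powr s"
  have pos: "u\<^sup>2 + Y\<^sup>2 > 0" for u :: real using Y by (simp add: add_nonneg_pos)
  have "\<bar>row_sum s (frac x) Y - Y powr (1 - s) * row_const s\<bar> \<le> 2 * ?\<phi> 0"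
  proof (rule sum_integral_comparison)
    show "?\<phi> v \<le> ?\<phi> u" if "0 \<le> u" "u \<le> v" for u v
      using that Y s pos by (intro powr_mono2 divide_left_mono add_right_mono power_mono mult_pos_pos) auto
    show "continuous_on UNIV ?\<phi>"
      using Y pos by (intro continuous_intros) (auto simp: less_imp_neq[THEN not_sym])
    show "(?\<phi> has_integral Y powr (1 - s) * row_const s) UNIV" by (rule row_has_integral[OF s(1) Y])
    show "(\<lambda>n::int. ?\<phi> (of_int n)) summable_on UNIV"
      using has_sum_row[OF Y s, of 0] by (auto simp: summable_on_def)
    show "((\<lambda>n::int. ?\<phi> (of_int n + frac x)) has_sum row_sum s (frac x) Y) UNIV"
      by (rule has_sum_row[OF Y s])
  qed (auto simp: less_imp_le[OF frac_lt_1])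
  moreover have "row_sum s (frac x) Y = row_sum s x Y"
    using row_sum_periodic[of s x "- \<lfloor>x\<rfloor>" Y] by (simp add: frac_def)
  moreover have "?\<phi> 0 = Y powr (- s)"
  proof -
    have "Y / (0\<^sup>2 + Y\<^sup>2) = 1 / Y" using Y by (simp add: power2_eq_square)
    then show ?thesis by (simp only: powr_divide powr_one_eq_one powr_minus_divide)
  qed
  ultimately show ?thesis by simp
qed

lemma row_sum_limit:
  assumes Y: "Y > 0" and s: "s \<longlonglongrightarrow> 1" "\<And>k. 1 \<le> s k" "\<And>k. s k \<le> 2"
  shows "(\<lambda>k. row_sum (s k) x Y) \<longlonglongrightarrow> row_sum 1 x Y"
proof -
  let ?U = "\<lambda>n::int. Y / ((of_int n + x)\<^sup>2 + Y\<^sup>2)"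
  have e: "bij_betw int_decode UNIV UNIV" by (rule bij_int_decode)
  have nat: "(\<lambda>n. ?U (int_decode n) powr t) sums row_sum t x Y" if "1 \<le> t" "t \<le> 2" for t
    using has_sum_row[OF Y that, of x] by (intro has_sum_imp_sums) (subst has_sum_reindex_bij_betw[OF e])
  have "(\<lambda>n. (1 + 1 / Y) * ?U n) summable_on UNIV"
    by (intro summable_on_cmult_right row_base_summable Y)
  then have "(\<lambda>n. (1 + 1 / Y) * ?U (int_decode n)) summable_on UNIV"
    by (subst summable_on_reindex_bij_betw[OF e])
  then have M: "summable (\<lambda>n. (1 + 1 / Y) * ?U (int_decode n))" by (rule summable_on_imp_summable)
  have "(\<lambda>k. \<Sum>n. ?U (int_decode n) powr s k) \<longlonglongrightarrow> (\<Sum>n. ?U (int_decode n) powr 1)"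
  proof (rule tannerys_theorem[where M = "\<lambda>n. (1 + 1 / Y) * ?U (int_decode n)", THEN conjunct2, THEN conjunct2])
    show "(\<lambda>k. ?U (int_decode n) powr s k) \<longlonglongrightarrow> ?U (int_decode n) powr 1" for n
      using row_base_bounds(1)[OF Y, of "of_int (int_decode n) + x"] by (intro tendsto_powr tendsto_const s) auto
    show "\<forall>\<^sub>F (n, k) in sequentially \<times>\<^sub>F sequentially. norm (?U (int_decode n) powr s k) \<le> (1 + 1 / Y) * ?U (int_decode n)"
      using row_powr_le[OF Y s(2,3)] by (intro always_eventually) auto
  qed (use M in auto)
  then show ?thesis using nat[of "s _"] nat[of 1] s by (simp add: sums_iff)
qed

section \<open>Rows at exponent one: the cotangent series\<close>

lemma Digamma_reflection_complex:
  fixes w :: complex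
  assumes w: "w \<notin> \<int>"
  shows "Digamma w - Digamma (1 - w) = - (of_real pi * cos (of_real pi * w) / sin (of_real pi * w))"
proof -
  have s0: "sin (of_real pi * w) \<noteq> 0"
  proof
    assume "sin (of_real pi * w) = 0"
    then obtain n :: int where "of_real pi * w = of_int n * of_real pi" by (auto simp: sin_eq_0)
    then have "w = of_int n" by (simp add: mult.commute)
    with w show False by simp
  qed
  have w1: "w \<notin> \<int>\<^sub>\<le>\<^sub>0" "1 - w \<notin> \<int>\<^sub>\<le>\<^sub>0"
  proof -
    show "w \<notin> \<int>\<^sub>\<le>\<^sub>0" using w nonpos_Ints_Int by blast
    show "1 - w \<notin> \<int>\<^sub>\<le>\<^sub>0"
    proof
      assume "1 - w \<in> \<int>\<^sub>\<le>\<^sub>0"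
      then have "1 - w \<in> \<int>" by (rule nonpos_Ints_Int)
      then have "1 - (1 - w) \<in> \<int>" by (intro Ints_diff) auto
      with w show False by simp
    qed
  qed
  \<comment> \<open>The claim is the logarithmic derivative of the reflection formula for
    Gamma.\<close>
  have "((\<lambda>z. Gamma z * Gamma (1 - z)) has_field_derivative (Gamma w * Gamma (1 - w) * (Digamma w - Digamma (1 - w)))) (at w)"
    using w1 by (auto intro!: derivative_eq_intros simp: algebra_simps)
  moreover have "(\<lambda>z. Gamma z * Gamma (1 - z)) = (\<lambda>z::complex. of_real pi / sin (of_real pi * z))"
    using Gamma_reflection_complex by (intro ext)
  moreover have "((\<lambda>z. of_real pi / sin (of_real pi * z)) has_field_derivative
      - (of_real pi * (cos (of_real pi * w) * of_real pi)) / (sin (of_real pi * w))\<^sup>2) (at w)"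
    using s0 by (auto intro!: derivative_eq_intros simp: power2_eq_square)
  ultimately have "Gamma w * Gamma (1 - w) * (Digamma w - Digamma (1 - w)) =
      - (of_real pi * (cos (of_real pi * w) * of_real pi)) / (sin (of_real pi * w))\<^sup>2"
    using DERIV_unique by metis
  then have "of_real pi / sin (of_real pi * w) * (Digamma w - Digamma (1 - w)) =
      of_real pi / sin (of_real pi * w) * - (of_real pi * cos (of_real pi * w) / sin (of_real pi * w))"
    by (simp add: Gamma_reflection_complex power2_eq_square)
  then show ?thesis using s0 by (subst (asm) mult_cancel_left) auto
qed

text \<open>With w = x + i Y the summand is -Im (1 / (w + n)). Splitting n >= 0 from n < 0 produces
  the partial sums of Digamma at w and at 1 - w, in whose difference the logarithms cancel.
  Reflection turns the limit into Im (-pi cot (pi w)), a rational expression in q.\<close>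

lemma row_sum_one:
  fixes x Y :: real
  assumes Y: "Y > 0"
  defines "q \<equiv> exp (2 * of_real pi * \<i> * Complex x Y)"
  shows "row_sum 1 x Y = pi * (1 + 2 * Re (q / (1 - q)))"
proof (rule LIMSEQ_unique)
  define w where "w = Complex x Y"
  have wI: "w \<notin> \<int>" using Y by (auto simp: w_def Ints_def complex_eq_iff)
  have "((\<lambda>n::int. (Y / ((of_int n + x)\<^sup>2 + Y\<^sup>2)) powr 1) has_sum row_sum 1 x Y) UNIV"
    by (rule has_sum_row[OF Y]) auto
  moreover have "(Y / ((of_int n + x)\<^sup>2 + Y\<^sup>2)) powr 1 = Y / ((of_int n + x)\<^sup>2 + Y\<^sup>2)" for n :: int
    using row_base_bounds(1)[OF Y, of "of_int n + x"] by (intro powr_one) simp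
  ultimately have "((\<lambda>n::int. Y / ((of_int n + x)\<^sup>2 + Y\<^sup>2)) has_sum row_sum 1 x Y) UNIV" by (simp only:)
  then show "(\<lambda>N. \<Sum>n\<in>{- int N..<int N}. Y / ((of_int n + x)\<^sup>2 + Y\<^sup>2)) \<longlonglongrightarrow> row_sum 1 x Y"
    by (rule has_sum_int_intervals_limit)
  have nz: "w \<noteq> 0" "1 - w \<noteq> 0" using wI by auto
  have "(\<lambda>m. Im ((of_real (ln (real m)) - (\<Sum>n<m. inverse (w + of_nat n))) - (of_real (ln (real m)) - (\<Sum>n<m. inverse (1 - w + of_nat n)))))
      \<longlonglongrightarrow> Im (Digamma w - Digamma (1 - w))"
    by (intro tendsto_intros Digamma_LIMSEQ nz)
  also have "(\<lambda>m. Im ((of_real (ln (real m)) - (\<Sum>n<m. inverse (w + of_nat n))) - (of_real (ln (real m)) - (\<Sum>n<m. inverse (1 - w + of_nat n)))))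
     = (\<lambda>N. \<Sum>n\<in>{- int N..<int N}. Y / ((of_int n + x)\<^sup>2 + Y\<^sup>2))"
  proof
    fix N
    show "Im ((of_real (ln (real N)) - (\<Sum>n<N. inverse (w + of_nat n))) - (of_real (ln (real N)) - (\<Sum>n<N. inverse (1 - w + of_nat n))))
       = (\<Sum>n\<in>{- int N..<int N}. Y / ((of_int n + x)\<^sup>2 + Y\<^sup>2))"
    proof (induction N)
      case (Suc N)
      have "{- int (Suc N)..<int (Suc N)} = insert (- int N - 1) (insert (int N) {- int N..<int N})" by auto
      then have s: "(\<Sum>n\<in>{- int (Suc N)..<int (Suc N)}. Y / ((of_int n + x)\<^sup>2 + Y\<^sup>2)) =
        Y / ((- real N - 1 + x)\<^sup>2 + Y\<^sup>2) + (Y / ((real N + x)\<^sup>2 + Y\<^sup>2) + (\<Sum>n\<in>{- int N..<int N}. Y / ((of_int n + x)\<^sup>2 + Y\<^sup>2)))"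
        by simp
      have "(- real N - 1 + x)\<^sup>2 = (1 - x + real N)\<^sup>2" by (simp add: power2_eq_square algebra_simps)
      then show ?case unfolding s using Suc.IH
        by (simp add: w_def add.commute)
    qed simp
  qed
  finally show "(\<lambda>N. \<Sum>n\<in>{- int N..<int N}. Y / ((of_int n + x)\<^sup>2 + Y\<^sup>2)) \<longlonglongrightarrow> pi * (1 + 2 * Re (q / (1 - q)))"
  proof (rule back_subst[of "\<lambda>l. _ \<longlonglongrightarrow> l"])
    define E where "E = exp (\<i> * (of_real pi * w))"
    have E: "E \<noteq> 0" by (simp add: E_def)
    have qE: "q = E\<^sup>2" by (simp add: q_def E_def w_def exp_of_nat_mult[symmetric] mult_ac)
    have "norm q < 1" using Y by (simp add: q_def norm_exp_eq_Re)
    then have q1: "1 - q \<noteq> 0" by auto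
    then have q2: "E\<^sup>2 - 1 \<noteq> 0" by (simp add: qE)
    have "cos (of_real pi * w) / sin (of_real pi * w) = ((E + inverse E) / 2) / ((E - inverse E) / (2 * \<i>))"
      unfolding sin_exp_eq cos_exp_eq E_def by (simp add: exp_minus)
    also have "\<dots> = \<i> * ((E + inverse E) / (E - inverse E))"
    proof -
      have "(a / 2) / (b / (2 * \<i>)) = \<i> * (a / b)" for a b :: complex
        by (cases "b = 0") (simp_all add: field_simps)
      then show ?thesis .
    qed
    also have "(E + inverse E) / (E - inverse E) = (E * (E + inverse E)) / (E * (E - inverse E))"
      using E by simp
    also have "E * (E + inverse E) = q + 1"
      using E by (simp add: qE algebra_simps power2_eq_square)
    also have "E * (E - inverse E) = q - 1"
      using E by (simp add: qE algebra_simps power2_eq_square)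
    finally have "Digamma w - Digamma (1 - w) = - (of_real pi * (\<i> * ((q + 1) / (q - 1))))"
      unfolding Digamma_reflection_complex[OF wI] times_divide_eq_right[symmetric] by simp
    also have "(q + 1) / (q - 1) = - (1 + 2 * (q / (1 - q)))"
    proof -
      have "q - 1 \<noteq> 0" using q1 by auto
      then show ?thesis using q1 by (simp add: divide_simps) (simp add: algebra_simps)
    qed
    finally have "Digamma w - Digamma (1 - w) = \<i> * of_real pi * (1 + 2 * (q / (1 - q)))" by (simp add: algebra_simps)
    moreover have "Im (\<i> * of_real pi * (1 + 2 * u)) = pi * (1 + 2 * Re u)" for u by simp
    ultimately show "Im (Digamma w - Digamma (1 - w)) = pi * (1 + 2 * Re (q / (1 - q)))"
      by (simp only:)
  qed
qed

lemma has_sum_Suc_iff: "((\<lambda>n. h (Suc n)) has_sum a) UNIV \<longleftrightarrow> (h has_sum a) {1..}"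
  by (rule has_sum_reindex_bij_witness[where i = "\<lambda>n. n - 1" and j = Suc]) auto

text \<open>A is the Riemann zeta value at 2 s, coming from the row m = 0. Rows m and -m agree
  because \<open>row_sum\<close> is even in x, and taking m out of the quadratic form leaves
  \<open>row_sum\<close> at (m x, m y).\<close>

lemma epstein_zeta_rows:
  assumes y: "y > 0" and s: "1 < s" "s \<le> 2"
  obtains A B where
    "((\<lambda>n. real (Suc n) powr (- 2 * s)) has_sum A) UNIV"
    "((\<lambda>m. real (Suc m) powr (- s) * row_sum s (real (Suc m) * x) (real (Suc m) * y)) has_sum B) UNIV"
    "epstein_zeta s (Complex x y) = 2 * y powr s * A + 2 * B"
proof -
  define z where "z = Complex x y"
  have z: "Im z > 0" using y by (simp add: z_def)
  define f where "f p = (if p = (0,0) then 0 else qform z p powr (- s))" for p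
  have f: "(f has_sum epstein_zeta s z) UNIV"
    by (rule has_sum_cong_neutral[THEN iffD1, OF _ _ _ has_sum_epstein_zeta[OF z s(1)]]) (auto simp: f_def)
  have "summable (\<lambda>n. real n powr (- 2 * s))" using s by (simp add: summable_real_powr_iff)
  then have "summable (\<lambda>n. real (Suc n) powr (- 2 * s))" by (subst summable_Suc_iff)
  then have "(\<lambda>n. real (Suc n) powr (- 2 * s)) summable_on UNIV"
    by (intro summable_nonneg_imp_summable_on) auto
  then obtain A where A: "((\<lambda>n. real (Suc n) powr (- 2 * s)) has_sum A) UNIV" by (auto simp: summable_on_def)
  define g where "g m = (if m = 0 then 2 * y powr s * A else \<bar>of_int m\<bar> powr (- s) * row_sum s (\<bar>of_int m\<bar> * x) (\<bar>of_int m\<bar> * y))" for m :: int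
  have rows: "((\<lambda>n. f (m, n)) has_sum g m) UNIV" for m
  proof (cases "m = 0")
    case True
    have fz: "f (0, n) = y powr s * real k powr (- 2 * s)" if "\<bar>n\<bar> = int k" "k \<ge> 1" for n k
    proof -
      have "n \<noteq> 0" using that by auto
      have "qform z (0, n) = (real k)\<^sup>2 / y"
        using y that(1) by (simp add: z_def qform_Complex) (metis of_int_abs of_int_of_nat_eq power2_abs)
      then have "f (0, n) = ((real k) powr 2 / y) powr (- s)" using \<open>n \<noteq> 0\<close> that by (simp add: f_def)
      also have "\<dots> = (real k powr 2) powr (- s) / y powr (- s)" by (rule powr_divide)
      finally show ?thesis unfolding powr_powr by (simp add: powr_minus divide_inverse mult.commute)
    qed
    have "((\<lambda>n. y powr s * real n powr (- 2 * s)) has_sum (y powr s * A)) {1..}"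
      using A unfolding has_sum_Suc_iff[of "\<lambda>n. real n powr (- 2 * s)"] by (rule has_sum_cmult_right)
    moreover have "((\<lambda>n. f (0, int n)) has_sum (y powr s * A)) {1..} \<longleftrightarrow> ((\<lambda>n. y powr s * real n powr (- 2 * s)) has_sum (y powr s * A)) {1..}"
    proof (rule has_sum_cong)
      fix n :: nat assume "n \<in> {1..}"
      then show "f (0, int n) = y powr s * real n powr (- 2 * s)" by (intro fz) auto
    qed
    moreover have "((\<lambda>n. f (0, - int n)) has_sum (y powr s * A)) {1..} \<longleftrightarrow> ((\<lambda>n. y powr s * real n powr (- 2 * s)) has_sum (y powr s * A)) {1..}"
    proof (rule has_sum_cong)
      fix n :: nat assume "n \<in> {1..}"
      then show "f (0, - int n) = y powr s * real n powr (- 2 * s)" by (intro fz) auto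
    qed
    ultimately have "((\<lambda>n. f (0, int n)) has_sum (y powr s * A)) {1..}" "((\<lambda>n. f (0, - int n)) has_sum (y powr s * A)) {1..}"
      by blast+
    from has_sum_int_split[of "\<lambda>n. f (0, n)", OF this] show ?thesis
      using True by (simp add: g_def f_def mult_ac)
  next
    case False
    define M where "M = \<bar>of_int m :: real\<bar>"
    have M: "M > 0" using False by (simp add: M_def)
    have "((\<lambda>n::int. M powr (- s) * (M * y / ((of_int n + of_int m * x)\<^sup>2 + (M * y)\<^sup>2)) powr s) has_sum
       (M powr (- s) * row_sum s (of_int m * x) (M * y))) UNIV"
      using s y M by (intro has_sum_cmult_right has_sum_row) auto
    also have "row_sum s (of_int m * x) (M * y) = row_sum s (M * x) (M * y)"
      using row_sum_minus[of s "M * x" "M * y"] by (cases "m \<ge> 0") (auto simp: M_def)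
    also have "(\<lambda>n::int. M powr (- s) * (M * y / ((of_int n + of_int m * x)\<^sup>2 + (M * y)\<^sup>2)) powr s) = (\<lambda>n. f (m, n))"
    proof
      fix n :: int
      have q: "qform z (m, n) = ((of_int n + of_int m * x)\<^sup>2 + (M * y)\<^sup>2) / y"
        using y by (simp add: z_def qform_Complex M_def power_mult_distrib field_simps power2_eq_square)
      have "M powr (- s) * (M * y / ((of_int n + of_int m * x)\<^sup>2 + (M * y)\<^sup>2)) powr s
        = M powr (- s) * (M powr s * (y / ((of_int n + of_int m * x)\<^sup>2 + (M * y)\<^sup>2)) powr s)"
        by (simp only: times_divide_eq_right[symmetric] powr_mult)
      also have "\<dots> = (1 / qform z (m, n)) powr s"
        using M by (simp add: q powr_minus)
      also have "\<dots> = qform z (m, n) powr (- s)" by (simp only: powr_divide powr_one_eq_one powr_minus_divide)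
      finally show "M powr (- s) * (M * y / ((of_int n + of_int m * x)\<^sup>2 + (M * y)\<^sup>2)) powr s = f (m, n)"
        using False by (simp add: f_def)
    qed
    finally show ?thesis using False by (simp add: g_def M_def)
  qed
  have g: "(g has_sum epstein_zeta s z) UNIV"
    by (rule has_sum_SigmaD[where B = "\<lambda>_. UNIV" and f = f]) (use f rows in simp_all)
  have "(\<lambda>n. g (int n)) summable_on {1..}"
  proof -
    have "g summable_on UNIV" using g unfolding summable_on_def by blast
    then have "g summable_on (int ` {1..})" by (rule summable_on_subset_banach) simp
    then have "(g \<circ> int) summable_on {1..}" by (subst (asm) summable_on_reindex) simp_all
    then show ?thesis by (simp only: o_def)
  qed
  then obtain B where B: "((\<lambda>n. g (int n)) has_sum B) {1..}" by (auto simp: summable_on_def)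
  have "g (- m) = g m" for m by (simp add: g_def)
  then have "(g has_sum (g 0 + (B + B))) UNIV" using B by (intro has_sum_int_split) auto
  then have "epstein_zeta s z = 2 * y powr s * A + 2 * B" using has_sum_unique[OF g] by (simp add: g_def)
  moreover have "((\<lambda>m. real (Suc m) powr (- s) * row_sum s (real (Suc m) * x) (real (Suc m) * y)) has_sum B) UNIV"
    using B unfolding has_sum_Suc_iff[symmetric] by (simp add: g_def)
  ultimately show ?thesis using A that by (simp add: z_def)
qed

text \<open>An elementary form of the pole of zeta at 1 with residue 1. The differences of n powr
  (-d) telescope to 1, and the mean value theorem encloses them between consecutive terms d n powr
  (-1 - d). The first term, which the lower enclosure omits, accounts for the + d.\<close>

lemma zeta_sum_bounds:
  fixes d :: real
  assumes d: "d > 0"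
  shows "summable (\<lambda>m. real (Suc m) powr (- 1 - d))"
    and "1 \<le> d * (\<Sum>m. real (Suc m) powr (- 1 - d))"
    and "d * (\<Sum>m. real (Suc m) powr (- 1 - d)) \<le> 1 + d"
proof -
  have "summable (\<lambda>n. real n powr (- 1 - d))" using d by (simp add: summable_real_powr_iff)
  then show S: "summable (\<lambda>m. real (Suc m) powr (- 1 - d))" by (subst summable_Suc_iff)
  let ?f = "\<lambda>m. real (Suc m) powr (- d)"
  have "?f \<longlonglongrightarrow> 0"
  proof -
    have "filterlim (\<lambda>m. real (Suc m)) at_top sequentially"
      by (rule filterlim_compose[OF filterlim_real_sequentially filterlim_Suc])
    then show ?thesis by (rule tendsto_neg_powr[rotated]) (use d in simp)
  qed
  from telescope_sums'[OF this] have T: "(\<lambda>m. ?f m - ?f (Suc m)) sums 1" by simp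
  have mvt: "d * real (Suc (Suc m)) powr (- 1 - d) \<le> ?f m - ?f (Suc m) \<and> ?f m - ?f (Suc m) \<le> d * real (Suc m) powr (- 1 - d)" for m
  proof -
    have "\<exists>\<xi>>real (Suc m). \<xi> < real (Suc (Suc m)) \<and>
       real (Suc (Suc m)) powr (- d) - real (Suc m) powr (- d) = (real (Suc (Suc m)) - real (Suc m)) * (- d * \<xi> powr (- d - 1))"
    proof (rule MVT2)
      fix u assume "real (Suc m) \<le> u" "u \<le> real (Suc (Suc m))"
      then have "u > 0" by simp
      then show "((\<lambda>u. u powr (- d)) has_real_derivative (- d * u powr (- d - 1))) (at u)"
        by (rule has_real_derivative_powr)
    qed simp
    then obtain \<xi> where \<xi>: "real (Suc m) < \<xi>" "\<xi> < real (Suc (Suc m))"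
      "?f (Suc m) - ?f m = (real (Suc (Suc m)) - real (Suc m)) * (- d * \<xi> powr (- d - 1))" by blast
    have "?f m - ?f (Suc m) = d * \<xi> powr (- 1 - d)"
    proof -
      have "- d - 1 = - 1 - d" by simp
      with \<xi>(3) have "?f (Suc m) - ?f m = - (d * \<xi> powr (- 1 - d))" by (simp only:) simp
      then show ?thesis by linarith
    qed
    note \<xi> = \<xi>(1,2) this
    have "\<xi> powr (- 1 - d) \<le> real (Suc m) powr (- 1 - d)" using \<xi> d by (intro powr_mono2') auto
    moreover have "real (Suc (Suc m)) powr (- 1 - d) \<le> \<xi> powr (- 1 - d)" using \<xi> d by (intro powr_mono2') auto
    ultimately show ?thesis unfolding \<xi>(3) using d by auto
  qed
  have "(\<Sum>m. ?f m - ?f (Suc m)) \<le> (\<Sum>m. d * real (Suc m) powr (- 1 - d))"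
    using T mvt S by (intro suminf_le) (auto simp: sums_iff intro!: summable_mult)
  then show "1 \<le> d * (\<Sum>m. real (Suc m) powr (- 1 - d))"
    using T S by (simp add: sums_iff suminf_mult)
  have S2: "summable (\<lambda>m. real (Suc (Suc m)) powr (- 1 - d))" using S by (subst summable_Suc_iff)
  have "(\<Sum>m. d * real (Suc (Suc m)) powr (- 1 - d)) \<le> (\<Sum>m. ?f m - ?f (Suc m))"
    using T mvt S2 by (intro suminf_le) (auto simp: sums_iff intro!: summable_mult)
  then have "d * (\<Sum>m. real (Suc (Suc m)) powr (- 1 - d)) \<le> 1"
    using T S2 by (simp add: sums_iff suminf_mult)
  moreover have "(\<Sum>m. real (Suc m) powr (- 1 - d)) = 1 + (\<Sum>m. real (Suc (Suc m)) powr (- 1 - d))"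
    using suminf_split_head[OF S] by simp
  ultimately show "d * (\<Sum>m. real (Suc m) powr (- 1 - d)) \<le> 1 + d" by (simp add: algebra_simps)
qed

text \<open>This is q = exp (2 pi i z), the variable of the eta product, not the nome exp (pi i z)
  of elliptic function theory.\<close>

definition nome :: "complex \<Rightarrow> complex" where "nome z = exp (2 * of_real pi * \<i> * z)"

definition eta_height :: "complex \<Rightarrow> real" where
  "eta_height z = sqrt (Im z) * (cmod (dedekind_eta z))\<^sup>2"

lemma norm_nome: "norm (nome z) = exp (- 2 * pi * Im z)"
  by (simp add: nome_def norm_exp_eq_Re)

lemma norm_nome_less_1: "Im z > 0 \<Longrightarrow> norm (nome z) < 1"
  by (simp add: norm_nome)

lemma nome_power: "nome z ^ Suc m = exp (2 * of_real pi * \<i> * Complex (real (Suc m) * Re z) (real (Suc m) * Im z))"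
proof -
  have "Complex (real (Suc m) * Re z) (real (Suc m) * Im z) = of_nat (Suc m) * z"
    by (simp add: complex_eq_iff)
  then show ?thesis unfolding nome_def exp_of_nat_mult[symmetric] by (simp add: mult_ac)
qed

text \<open>Both are iterated sums of the absolutely convergent double series of q^(m k) / m over m,
  k >= 1: geometric in k, logarithmic in m. The first form arises from the rows of zeta, the second
  from the eta product.\<close>

lemma lambert_series:
  assumes z: "Im z > 0"
  obtains T where
    "((\<lambda>m. nome z ^ Suc m / (1 - nome z ^ Suc m) / of_nat (Suc m)) has_sum T) UNIV"
    "((\<lambda>k. - Ln (1 - nome z ^ Suc k)) has_sum T) UNIV"
proof -
  define q r where "q = nome z" and "r = norm q"
  have r: "0 \<le> r" "r < 1" using norm_nome_less_1[OF z] by (auto simp: r_def q_def)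
  define a where "a = (\<lambda>(m, k). q ^ (Suc m * Suc k) / of_nat (Suc m))"
  have "(\<lambda>n. r ^ n) summable_on UNIV"
    using r by (intro norm_summable_imp_summable_on) (auto simp: norm_power intro!: summable_geometric)
  then obtain g where g: "((\<lambda>n. r ^ n) has_sum g) UNIV" by (auto simp: summable_on_def)
  have rr: "(\<lambda>(m, k). r ^ m * r ^ k) summable_on (UNIV :: (nat \<times> nat) set)"
    using has_sum_product_nonneg[OF g g] r by (auto simp: summable_on_def)
  have asum: "a summable_on UNIV"
  proof (rule abs_summable_summable, rule Infinite_Sum.abs_summable_on_comparison_test'[OF rr])
    fix p :: "nat \<times> nat"
    obtain m k where p: "p = (m, k)" by (cases p)
    have "norm (a p) = r ^ (Suc m * Suc k) / real (Suc m)"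
      by (simp add: a_def p norm_divide norm_power r_def del: power_Suc mult_Suc mult_Suc_right of_nat_Suc)
    also have "\<dots> \<le> r ^ (Suc m * Suc k) / 1" using r by (intro divide_left_mono) auto
    also have "\<dots> \<le> r ^ (m + k)" using r by (simp del: power_Suc) (intro power_decreasing; simp)
    finally show "norm (a p) \<le> (case p of (m, k) \<Rightarrow> r ^ m * r ^ k)" by (simp add: p power_add)
  qed
  then obtain T where T: "(a has_sum T) UNIV" by (auto simp: summable_on_def)
  have qm: "norm (q ^ Suc m) < 1" for m
  proof -
    have "r ^ Suc m < 1" using r by (intro power_less_one_iff[THEN iffD2]) auto
    then show ?thesis by (simp only: norm_power r_def)
  qed
  have row: "((\<lambda>k. a (m, k)) has_sum (q ^ Suc m / (1 - q ^ Suc m) / of_nat (Suc m))) UNIV" for m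
  proof -
    have "((\<lambda>k. (q ^ Suc m) ^ Suc k) has_sum (q ^ Suc m / (1 - q ^ Suc m))) UNIV"
      unfolding has_sum_Suc_iff by (rule has_sum_geometric_from_1[OF qm])
    from has_sum_divide_const[OF this, of "of_nat (Suc m)"] show ?thesis
      by (simp add: a_def power_mult del: power_Suc mult_Suc mult_Suc_right of_nat_Suc)
  qed
  have col: "((\<lambda>m. a (m, k)) has_sum (- Ln (1 - q ^ Suc k))) UNIV" for k
  proof -
    have "(\<lambda>m. a (m, k)) summable_on UNIV"
      using summable_on_SigmaD1[of "\<lambda>k m. a (m, k)" UNIV "\<lambda>_. UNIV" k] asum
      by (subst (asm) summable_on_swap[of _ UNIV UNIV, simplified]) auto
    then obtain c where c: "((\<lambda>m. a (m, k)) has_sum c) UNIV" by (auto simp: summable_on_def)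
    have "(\<lambda>n. - ((- (- (q ^ Suc k))) ^ n) / of_nat n) sums ln (1 + - (q ^ Suc k))"
      by (rule Ln_series') (use qm in simp)
    then have "(\<lambda>n. - ((q ^ Suc k) ^ n / of_nat n)) sums Ln (1 - q ^ Suc k)" by simp
    then have "(\<lambda>n. (q ^ Suc k) ^ n / of_nat n) sums - Ln (1 - q ^ Suc k)"
      using sums_minus by fastforce
    then have "(\<lambda>n. (q ^ Suc k) ^ Suc n / of_nat (Suc n)) sums - Ln (1 - q ^ Suc k)"
      by (subst sums_Suc_iff) simp
    moreover have "(\<lambda>n. (q ^ Suc k) ^ Suc n / of_nat (Suc n)) = (\<lambda>m. a (m, k))"
      by (simp add: a_def power_mult[symmetric] mult.commute del: power_Suc mult_Suc mult_Suc_right of_nat_Suc)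
    ultimately have "c = - Ln (1 - q ^ Suc k)" using has_sum_imp_sums[OF c] sums_unique2 by metis
    with c show ?thesis by simp
  qed
  have "((\<lambda>m. q ^ Suc m / (1 - q ^ Suc m) / of_nat (Suc m)) has_sum T) UNIV"
    by (rule has_sum_SigmaD[where B = "\<lambda>_. UNIV" and f = a]) (use T row in simp_all)
  moreover have "((\<lambda>k. - Ln (1 - q ^ Suc k)) has_sum T) UNIV"
  proof (rule has_sum_SigmaD[where B = "\<lambda>_. UNIV" and f = "\<lambda>(k, m). a (m, k)"])
    show "((\<lambda>(k, m). a (m, k)) has_sum T) (UNIV \<times> UNIV)"
      using T has_sum_swap[where f = a and S = T and A = UNIV and B = UNIV] by simp
  qed (use col in simp)
  ultimately show ?thesis using that by (simp add: q_def)
qed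

text \<open>Only norms are compared: Re (Ln u) = ln |u|, so partial products become exponentials of
  partial sums without any branch correction.\<close>

lemma norm_dedekind_eta:
  assumes z: "Im z > 0" and T: "((\<lambda>k. - Ln (1 - nome z ^ Suc k)) has_sum T) UNIV"
  shows "cmod (dedekind_eta z) = exp (- pi * Im z / 12 - Re T)"
proof -
  define q where "q = nome z"
  have r: "norm q < 1" using norm_nome_less_1[OF z] by (simp add: q_def)
  have ne: "1 - q ^ Suc k \<noteq> 0" for k
  proof -
    have "norm q ^ Suc k < 1" using r by (intro power_less_one_iff[THEN iffD2]) auto
    then have "norm (q ^ Suc k) < 1" by (simp only: norm_power)
    then show ?thesis by (metis eq_iff_diff_eq_0 less_irrefl norm_one)
  qed
  have "summable (\<lambda>n. norm (q ^ Suc n))"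
    using r by (subst summable_Suc_iff) (auto simp: norm_power intro!: summable_geometric)
  then have "summable (\<lambda>n. norm (1 - q ^ Suc n - 1))" by simp
  then have "convergent_prod (\<lambda>n. 1 - q ^ Suc n)"
    by (intro abs_convergent_prod_imp_convergent_prod summable_imp_abs_convergent_prod)
  then have "(\<lambda>n. \<Prod>i\<le>n. 1 - q ^ Suc i) \<longlonglongrightarrow> (\<Prod>n. 1 - q ^ Suc n)" by (rule convergent_prod_LIMSEQ)
  then have 1: "(\<lambda>n. norm (\<Prod>i\<le>n. 1 - q ^ Suc i)) \<longlonglongrightarrow> norm (\<Prod>n. 1 - q ^ Suc n)" by (rule tendsto_norm)
  have "norm (\<Prod>i\<le>n. 1 - q ^ Suc i) = exp (- Re (\<Sum>i\<le>n. - Ln (1 - q ^ Suc i)))" for n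
  proof -
    have "- Re (\<Sum>i\<le>n. - Ln (1 - q ^ Suc i)) = (\<Sum>i\<le>n. ln (norm (1 - q ^ Suc i)))"
      using ne by (simp add: Re_Ln sum_negf del: power_Suc)
    then show ?thesis using ne by (simp add: exp_sum prod_norm[symmetric] del: power_Suc)
  qed
  moreover have "(\<lambda>n. \<Sum>i\<le>n. - Ln (1 - q ^ Suc i)) \<longlonglongrightarrow> T"
    using has_sum_imp_sums[OF T] unfolding q_def sums_def_le .
  then have "(\<lambda>n. exp (- Re (\<Sum>i\<le>n. - Ln (1 - q ^ Suc i)))) \<longlonglongrightarrow> exp (- Re T)"
    by (intro tendsto_intros)
  ultimately have "norm (\<Prod>n. 1 - q ^ Suc n) = exp (- Re T)"
    using 1 LIMSEQ_unique by simp
  moreover have "dedekind_eta z = exp (2 * of_real pi * \<i> * z / 24) * (\<Prod>n. 1 - q ^ Suc n)"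
    by (simp add: dedekind_eta_def q_def nome_def)
  moreover have "norm (exp (2 * of_real pi * \<i> * z / 24)) = exp (- pi * Im z / 12)"
    by (simp add: norm_exp_eq_Re)
  ultimately have "cmod (dedekind_eta z) = exp (- pi * Im z / 12) * exp (- Re T)" by (simp only: norm_mult)
  then show ?thesis by (simp only: exp_add[symmetric] diff_conv_add_uminus)
qed

lemma eta_height_pos: "Im z > 0 \<Longrightarrow> eta_height z > 0"
  using lambert_series[of z] norm_dedekind_eta[of z] unfolding eta_height_def
  by (metis exp_gt_zero mult_pos_pos real_sqrt_gt_zero zero_less_power)

lemma ln_eta_height:
  assumes z: "Im z > 0" and T: "((\<lambda>k. - Ln (1 - nome z ^ Suc k)) has_sum T) UNIV"
  shows "ln (eta_height z) = ln (Im z) / 2 - pi * Im z / 6 - 2 * Re T"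
  using z unfolding eta_height_def norm_dedekind_eta[OF z T]
  by (simp add: ln_mult ln_sqrt exp_of_nat_mult[symmetric] algebra_simps)

text \<open>A sequence tending to 1 inside (1, 2], the range in which the row estimates are uniform.
  Sequences suit dominated convergence and Tannery's theorem.\<close>

definition kronecker_exponent :: "nat \<Rightarrow> real" where
  "kronecker_exponent k = 1 + 1 / real (Suc k)"

text \<open>
  The part of zeta that diverges as \<open>s \<rightarrow> 1\<close>. It does not depend on \<open>z\<close>, so no closed form is needed.
\<close>

definition kronecker_pole :: "nat \<Rightarrow> real" where
  "kronecker_pole k = 2 * row_const (kronecker_exponent k) * (\<Sum>m. real (Suc m) powr (1 - 2 * kronecker_exponent k))"

lemma kronecker_exponent_limit: "kronecker_exponent \<longlonglongrightarrow> 1"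
proof -
  have "(\<lambda>k. 1 + 1 / real (Suc k)) \<longlonglongrightarrow> 1 + 0"
    using LIMSEQ_Suc[OF lim_1_over_n] by (intro tendsto_intros) auto
  then show ?thesis by (simp add: kronecker_exponent_def[abs_def])
qed

text \<open>Zeta minus the pole splits into the row m = 0, the deviations of the other rows from
  their integrals, and what the integrals leave over. The limits are pi^2 y / 3, 4 pi Re T and -pi
  ln y, where T is the Lambert series; they add up to -2 pi ln h by the product for eta.\<close>

theorem kronecker_limit:
  assumes z: "Im z > 0"
  shows "(\<lambda>k. epstein_zeta (kronecker_exponent k) z - kronecker_pole k) \<longlonglongrightarrow> - 2 * pi * ln (eta_height z)"
proof -
  define x y where "x = Re z" and "y = Im z"
  have y: "y > 0" using z by (simp add: y_def)
  have zxy: "z = Complex x y" by (simp add: x_def y_def)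
  let ?s = kronecker_exponent
  have s: "1 < ?s k" "1 \<le> ?s k" "?s k \<le> 2" for k by (auto simp: kronecker_exponent_def)
  note sl = kronecker_exponent_limit
  obtain T where T: "((\<lambda>m. nome z ^ Suc m / (1 - nome z ^ Suc m) / of_nat (Suc m)) has_sum T) UNIV"
    "((\<lambda>k. - Ln (1 - nome z ^ Suc k)) has_sum T) UNIV"
    using lambert_series[OF z] by blast
  define A where "A k = (\<Sum>n. real (Suc n) powr (- 2 * ?s k))" for k
  define R where "R k m = row_sum (?s k) (real (Suc m) * x) (real (Suc m) * y)" for k m
  define Z where "Z k = (\<Sum>m. real (Suc m) powr (1 - 2 * ?s k))" for k
  \<comment> \<open>The weighted deviation of row m + 1 from its integral. By
    \<open>row_sum_comparison\<close> it is of order (m + 1)^(-2) uniformly in k, which is what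
    Tannery's theorem asks for.\<close>
  define D where "D m k = real (Suc m) powr (- ?s k) * (R k m - (real (Suc m) * y) powr (1 - ?s k) * row_const (?s k))" for m k
  have S2: "summable (\<lambda>n. real (Suc n) powr (- 2))"
  proof -
    have "summable (\<lambda>n. real n powr (- 2))" by (simp add: summable_real_powr_iff)
    then show ?thesis by (subst summable_Suc_iff)
  qed
  have e: "1 - 2 * ?s k = - 1 - 2 / real (Suc k)" for k by (simp add: kronecker_exponent_def)
  have Zb: "summable (\<lambda>m. real (Suc m) powr (1 - 2 * ?s k))" "1 \<le> 2 / real (Suc k) * Z k" "2 / real (Suc k) * Z k \<le> 1 + 2 / real (Suc k)" for k
    unfolding Z_def e by (rule zeta_sum_bounds; simp)+
  have D_le: "norm (D m k) \<le> 2 * (1 / y + 1 / y\<^sup>2) * real (Suc m) powr (- 2)" for m k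
  proof -
    have "\<bar>R k m - (real (Suc m) * y) powr (1 - ?s k) * row_const (?s k)\<bar> \<le> 2 * (real (Suc m) * y) powr (- ?s k)"
      unfolding R_def by (rule row_sum_comparison) (use y s in auto)
    then have "norm (D m k) \<le> real (Suc m) powr (- ?s k) * (2 * (real (Suc m) * y) powr (- ?s k))"
      unfolding D_def real_norm_def abs_mult by (intro mult_mono) auto
    also have "\<dots> = 2 * y powr (- ?s k) * (real (Suc m) powr (- ?s k) * real (Suc m) powr (- ?s k))"
      by (simp only: powr_mult mult_ac)
    also have "real (Suc m) powr (- ?s k) * real (Suc m) powr (- ?s k) = real (Suc m) powr (- 2 * ?s k)"
      unfolding powr_add[symmetric] by simp
    also have "2 * y powr (- ?s k) * real (Suc m) powr (- 2 * ?s k) \<le> 2 * (1 / y + 1 / y\<^sup>2) * real (Suc m) powr (- 2)"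
    proof (intro mult_mono)
      show "real (Suc m) powr (- 2 * ?s k) \<le> real (Suc m) powr (- 2)" using s[of k] by (intro powr_mono) auto
      have y1: "y powr (- 1) = 1 / y" "y powr (- 2) = 1 / y\<^sup>2" using y by (simp_all add: powr_minus_divide)
      \<comment> \<open>The exponent lies between 1 and 2: 1 / y covers y >= 1, and 1 / y^2 covers y
        < 1.\<close>
      show "y powr (- ?s k) \<le> 1 / y + 1 / y\<^sup>2"
      proof (cases "y \<ge> 1")
        case True
        then have "y powr (- ?s k) \<le> y powr (- 1)" using s[of k] by (intro powr_mono) auto
        then show ?thesis unfolding y1 using y by (simp add: add_increasing2)
      next
        case False
        then have "y powr (- ?s k) \<le> y powr (- 2)" using s[of k] y by (intro powr_mono') auto
        then show ?thesis unfolding y1 using y by (simp add: add_increasing)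
      qed
    qed (use y in auto)
    finally show ?thesis .
  qed
  have Sum_bound: "summable (\<lambda>m. 2 * (1 / y + 1 / y\<^sup>2) * real (Suc m) powr (- 2))"
    by (intro summable_mult S2)
  have D_summable: "summable (\<lambda>m. D m k)" for k
    by (rule summable_comparison_test'[OF Sum_bound]) (use D_le in auto)
  \<comment> \<open>The row integrals sum to a multiple of y powr (1 - s) times Z, and the pole is
    the same multiple of Z. In the difference, y powr (1 - s) - 1 vanishes as fast as Z
    grows.\<close>
  have decomp: "epstein_zeta (?s k) z - kronecker_pole k =
     2 * y powr ?s k * A k + 2 * (\<Sum>m. D m k) + 2 * row_const (?s k) * ((y powr (1 - ?s k) - 1) * Z k)" for k
  proof -
    obtain A' B where AB: "((\<lambda>n. real (Suc n) powr (- 2 * ?s k)) has_sum A') UNIV"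
      "((\<lambda>m. real (Suc m) powr (- ?s k) * R k m) has_sum B) UNIV"
      "epstein_zeta (?s k) z = 2 * y powr ?s k * A' + 2 * B"
      unfolding zxy R_def by (rule epstein_zeta_rows[OF y s(1) s(3)])
    have A': "A' = A k" using has_sum_imp_sums[OF AB(1)] by (simp add: A_def sums_iff)
    have "(\<lambda>m. D m k + y powr (1 - ?s k) * row_const (?s k) * real (Suc m) powr (1 - 2 * ?s k)) sums
       ((\<Sum>m. D m k) + y powr (1 - ?s k) * row_const (?s k) * Z k)"
      unfolding Z_def by (intro sums_add sums_mult summable_sums D_summable Zb(1))
    also have "(\<lambda>m. D m k + y powr (1 - ?s k) * row_const (?s k) * real (Suc m) powr (1 - 2 * ?s k)) = (\<lambda>m. real (Suc m) powr (- ?s k) * R k m)"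
    proof
      fix m
      have "real (Suc m) powr (- ?s k) * real (Suc m) powr (1 - ?s k) = real (Suc m) powr (1 - 2 * ?s k)"
        unfolding powr_add[symmetric] by (rule arg_cong[of _ _ "(powr) (real (Suc m))"]) simp
      then show "D m k + y powr (1 - ?s k) * row_const (?s k) * real (Suc m) powr (1 - 2 * ?s k) = real (Suc m) powr (- ?s k) * R k m"
        unfolding D_def powr_mult by (simp only: right_diff_distrib) (simp add: mult_ac del: of_nat_Suc)
    qed
    finally have "B = (\<Sum>m. D m k) + y powr (1 - ?s k) * row_const (?s k) * Z k"
      using has_sum_imp_sums[OF AB(2)] sums_unique2 by blast
    then show ?thesis unfolding AB(3) A' kronecker_pole_def Z_def[symmetric] by (simp add: algebra_simps)
  qed
  have lim1: "(\<lambda>k. 2 * y powr ?s k * A k) \<longlonglongrightarrow> 2 * y powr 1 * (pi\<^sup>2 / 6)"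
  proof (intro tendsto_intros sl)
    have "A \<longlonglongrightarrow> (\<Sum>n. real (Suc n) powr (- 2 * 1))" unfolding A_def[abs_def]
    proof (rule tannerys_theorem[where M = "\<lambda>n. real (Suc n) powr (- 2)", THEN conjunct2, THEN conjunct2])
      show "(\<lambda>k. real (Suc n) powr (- 2 * ?s k)) \<longlonglongrightarrow> real (Suc n) powr (- 2 * 1)" for n
        by (intro tendsto_intros sl) auto
      have "real (Suc n) powr (- 2 * ?s k) \<le> real (Suc n) powr (- 2)" for n k
        using s[of k] by (intro powr_mono) auto
      then show "\<forall>\<^sub>F (n, k) in sequentially \<times>\<^sub>F sequentially. norm (real (Suc n) powr (- 2 * ?s k)) \<le> real (Suc n) powr (- 2)"
        by (intro always_eventually) auto
    qed (use S2 in auto)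
    also have "(\<lambda>n. real (Suc n) powr (- 2 * 1)) = (\<lambda>n. 1 / (real n + 1)\<^sup>2)"
      by (simp add: fun_eq_iff powr_minus_divide add.commute)
    also have "(\<Sum>n. 1 / (real n + 1)\<^sup>2) = pi\<^sup>2 / 6" using inverse_squares_sums by (simp add: sums_iff add.commute)
    finally show "A \<longlonglongrightarrow> pi\<^sup>2 / 6" .
  qed (use y in auto)
  have lim2: "(\<lambda>k. \<Sum>m. D m k) \<longlonglongrightarrow> 2 * pi * Re T"
  proof -
    have "(\<lambda>k. \<Sum>m. D m k) \<longlonglongrightarrow> (\<Sum>m. 2 * pi * Re (nome z ^ Suc m / (1 - nome z ^ Suc m) / of_nat (Suc m)))"
    proof (rule tannerys_theorem[where M = "\<lambda>m. 2 * (1 / y + 1 / y\<^sup>2) * real (Suc m) powr (- 2)", THEN conjunct2, THEN conjunct2])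
      fix m
      have my: "real (Suc m) * y > 0" using y by simp
      have "D m \<longlonglongrightarrow> real (Suc m) powr (- 1) * (row_sum 1 (real (Suc m) * x) (real (Suc m) * y) - (real (Suc m) * y) powr (1 - 1) * pi)"
        unfolding D_def[abs_def] R_def using my y
        by (intro tendsto_intros sl row_sum_limit[OF my sl s(2,3)] row_const_limit[OF sl s(2)]) auto
      also have "real (Suc m) powr (- 1) * (row_sum 1 (real (Suc m) * x) (real (Suc m) * y) - (real (Suc m) * y) powr (1 - 1) * pi)
        = 2 * pi * Re (nome z ^ Suc m / (1 - nome z ^ Suc m) / of_nat (Suc m))"
      proof -
        have "real (Suc m) powr (- 1) = 1 / real (Suc m)" by (simp add: powr_minus_divide)
        moreover have "(real (Suc m) * y) powr (1 - 1) = 1" using y by simp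
        moreover have "row_sum 1 (real (Suc m) * x) (real (Suc m) * y) = pi * (1 + 2 * Re (nome z ^ Suc m / (1 - nome z ^ Suc m)))"
          unfolding nome_power x_def[symmetric] y_def[symmetric] by (rule row_sum_one[OF my])
        moreover have "Re (u / of_nat (Suc m)) = Re u / real (Suc m)" for u
          by (metis Re_divide_of_real of_real_of_nat_eq)
        ultimately show ?thesis by (simp only:) (simp add: algebra_simps del: of_nat_Suc power_Suc)
      qed
      finally show "D m \<longlonglongrightarrow> 2 * pi * Re (nome z ^ Suc m / (1 - nome z ^ Suc m) / of_nat (Suc m))" .
    next
      show "\<forall>\<^sub>F (m, k) in sequentially \<times>\<^sub>F sequentially. norm (D m k) \<le> 2 * (1 / y + 1 / y\<^sup>2) * real (Suc m) powr (- 2)"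
        using D_le by (intro always_eventually) auto
    qed (use Sum_bound in auto)
    moreover have "(\<lambda>m. 2 * pi * Re (nome z ^ Suc m / (1 - nome z ^ Suc m) / of_nat (Suc m))) sums (2 * pi * Re T)"
      by (intro sums_mult has_sum_imp_sums has_sum_Re T)
    ultimately show ?thesis by (simp only: sums_iff)
  qed
  \<comment> \<open>\<open>Z k\<close> is zeta (1 + d) with d = 2 / (k + 1), so
    \<open>d * Z k\<close> tends to 1. With h = 1 - s = -1 / (k + 1) the quotient (y powr h - 1) / h
    tends to the derivative ln y, and h / d = -1/2.\<close>
  have lim3: "(\<lambda>k. (y powr (1 - ?s k) - 1) * Z k) \<longlonglongrightarrow> - ln y / 2"
  proof -
    have h: "filterlim (\<lambda>k. - 1 / real (Suc k)) (at 0) sequentially"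
    proof -
      have "(\<lambda>k. - 1 / real (Suc k)) \<longlonglongrightarrow> 0" using LIMSEQ_Suc[OF lim_const_over_n[of "-1"]] by simp
      then show ?thesis by (auto simp: filterlim_at)
    qed
    have "((\<lambda>h. y powr h) has_real_derivative y powr 0 * ln y) (at 0)"
      using y by (auto intro!: derivative_eq_intros)
    then have "((\<lambda>h. (y powr (0 + h) - y powr 0) / h) \<longlongrightarrow> y powr 0 * ln y) (at 0)"
      by (simp add: DERIV_def)
    from filterlim_compose[OF this h]
    have 1: "(\<lambda>k. (y powr (- 1 / real (Suc k)) - 1) / (- 1 / real (Suc k))) \<longlonglongrightarrow> ln y" using y by simp
    have 2: "(\<lambda>k. 2 / real (Suc k) * Z k) \<longlonglongrightarrow> 1"
    proof (rule real_tendsto_sandwich[where f = "\<lambda>_. 1" and h = "\<lambda>k. 1 + 2 / real (Suc k)"])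
      show "(\<lambda>k. 1 + 2 / real (Suc k)) \<longlonglongrightarrow> 1"
        using tendsto_add[OF tendsto_const LIMSEQ_Suc[OF lim_const_over_n[of "2::real"]], of 1] by simp
    qed (use Zb(2,3) in \<open>auto intro!: always_eventually simp del: of_nat_Suc\<close>)
    have "(\<lambda>k. (y powr (- 1 / real (Suc k)) - 1) / (- 1 / real (Suc k)) * (2 / real (Suc k) * Z k) * (- (1 / 2))) \<longlonglongrightarrow> ln y * 1 * (- (1 / 2))"
      by (intro tendsto_intros 1 2)
    also have "(\<lambda>k. (y powr (- 1 / real (Suc k)) - 1) / (- 1 / real (Suc k)) * (2 / real (Suc k) * Z k) * (- (1 / 2))) = (\<lambda>k. (y powr (1 - ?s k) - 1) * Z k)"
    proof
      fix k
      have "1 - ?s k = - 1 / real (Suc k)" by (simp add: kronecker_exponent_def)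
      then show "(y powr (- 1 / real (Suc k)) - 1) / (- 1 / real (Suc k)) * (2 / real (Suc k) * Z k) * (- (1 / 2)) = (y powr (1 - ?s k) - 1) * Z k"
        by (simp only:) (simp add: field_simps)
    qed
    finally show ?thesis by simp
  qed
  have "(\<lambda>k. epstein_zeta (?s k) z - kronecker_pole k) \<longlonglongrightarrow>
      2 * y powr 1 * (pi\<^sup>2 / 6) + 2 * (2 * pi * Re T) + 2 * pi * (- ln y / 2)"
    unfolding decomp by (intro tendsto_add lim1 tendsto_mult lim2 lim3 tendsto_const row_const_limit[OF sl s(2)])
  also have "2 * y powr 1 * (pi\<^sup>2 / 6) + 2 * (2 * pi * Re T) + 2 * pi * (- ln y / 2) = - 2 * pi * ln (eta_height z)"
    unfolding ln_eta_height[OF z T(2)] y_def[symmetric] using y by (simp add: power2_eq_square algebra_simps)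
  finally show ?thesis .
qed

subsection \<open>Minimality\<close>

lemma hex_upper: "Im hex > 0"
  by (simp add: hex_def)

text \<open>The alternative depends only on whether the reduced point is the hexagonal one, so the
  strict inequality holds for all \<alpha> at once, as \<open>epstein_zeta_less\<close>
  requires.\<close>

lemma hex_orbit_or_reduced:
  assumes z: "Im z > 0"
  shows "(\<exists>A\<in>SL2Z. z = moebius_action A hex) \<or> (\<forall>\<alpha>>0. lattice_theta \<alpha> hex < lattice_theta \<alpha> z)"
proof -
  obtain A where A: "A \<in> SL2Z" "Im (moebius_action A z) > 0" "(Im (moebius_action A z))\<^sup>2 \<ge> 3/4"
    "0 \<le> Re (moebius_action A z)" "Re (moebius_action A z) < 1"
    using modular_reduction[OF z] by blast
  define w where "w = moebius_action A z"
  show ?thesis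
  proof (cases "w = hex")
    case True
    obtain a b c d where abcd: "A = mat2 a b c d" "a * d - b * c = 1" using SL2Z_cases[OF A(1)] .
    have nz: "of_int c * z + of_int d \<noteq> 0" using abcd(2) z by (intro denom_nonzero) auto
    have det: "of_int a * of_int d - of_int b * of_int c = (1 :: complex)"
      using abcd(2) by (metis of_int_1 of_int_diff of_int_mult)
    define B where "B = mat2 d (- b) (- c) a"
    have "B \<in> SL2Z" using abcd(2) by (simp add: B_def mat2_in_SL2Z mult.commute)
    moreover have "moebius_action B w = z"
    proof -
      have w: "w = (of_int a * z + of_int b) / (of_int c * z + of_int d)"
        by (simp add: w_def abcd(1) moebius_mat2)
      have "of_int d * w - of_int b = (of_int a * of_int d - of_int b * of_int c) * z / (of_int c * z + of_int d)"
        unfolding w using nz by (simp add: field_simps)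
      moreover have "- of_int c * w + of_int a = (of_int a * of_int d - of_int b * of_int c) / (of_int c * z + of_int d)"
        unfolding w using nz by (simp add: field_simps)
      ultimately show ?thesis using nz unfolding B_def moebius_mat2 det by simp
    qed
    ultimately show ?thesis using True by metis
  next
    case False
    have "lattice_theta \<alpha> hex < lattice_theta \<alpha> z" if "\<alpha> > 0" for \<alpha>
    proof -
      have "lattice_theta \<alpha> hex < lattice_theta \<alpha> (Complex (Re w) (Im w))"
        by (rule lattice_theta_minimum_strip(2)) (use A that False in \<open>auto simp: w_def\<close>)
      also have "\<dots> = lattice_theta \<alpha> z"
        by (simp add: w_def lattice_theta_moebius[OF z A(1)])
      finally show ?thesis .
    qed
    then show ?thesis by blast
  qed
qed

lemma moebius_upper:
  assumes "Im z > 0" "A \<in> SL2Z"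
  shows "Im (moebius_action A z) > 0"
proof -
  obtain a b c d where A: "A = mat2 a b c d" "a * d - b * c = 1" using SL2Z_cases[OF assms(2)] .
  show ?thesis unfolding A(1) moebius_mat2 by (rule moebius_Im(2)[OF assms(1) A(2)])
qed

lemma kronecker_exponent_gt_1: "kronecker_exponent k > 1"
  by (simp add: kronecker_exponent_def)

lemma eta_height_moebius:
  assumes z: "Im z > 0" and A: "A \<in> SL2Z"
  shows "eta_height (moebius_action A z) = eta_height z"
proof -
  note w = moebius_upper[OF z A]
  have "(\<lambda>k. epstein_zeta (kronecker_exponent k) z - kronecker_pole k) \<longlonglongrightarrow> - 2 * pi * ln (eta_height (moebius_action A z))"
    using kronecker_limit[OF w] by (simp only: epstein_zeta_moebius[OF z A])
  then have "- 2 * pi * ln (eta_height (moebius_action A z)) = - 2 * pi * ln (eta_height z)"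
    using kronecker_limit[OF z] LIMSEQ_unique by blast
  then have "ln (eta_height (moebius_action A z)) = ln (eta_height z)" by simp
  then show ?thesis using eta_height_pos[OF z] eta_height_pos[OF w] by simp
qed

lemma epstein_zeta_hex_le:
  assumes z: "Im z > 0" and s: "s > 1"
  shows "epstein_zeta s hex \<le> epstein_zeta s z"
  using hex_orbit_or_reduced[OF z]
proof
  assume "\<exists>A\<in>SL2Z. z = moebius_action A hex"
  then show ?thesis using epstein_zeta_moebius[OF hex_upper] by auto
next
  assume "\<forall>\<alpha>>0. lattice_theta \<alpha> hex < lattice_theta \<alpha> z"
  then show ?thesis using epstein_zeta_less[OF z hex_upper s] by (intro less_imp_le) blast
qed

lemma eta_height_le_hex:
  assumes z: "Im z > 0"
  shows "eta_height z \<le> eta_height hex"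
proof -
  have "- 2 * pi * ln (eta_height hex) \<le> - 2 * pi * ln (eta_height z)"
  proof (rule LIMSEQ_le[OF kronecker_limit[OF hex_upper] kronecker_limit[OF z]])
    show "\<exists>N. \<forall>k\<ge>N. epstein_zeta (kronecker_exponent k) hex - kronecker_pole k \<le> epstein_zeta (kronecker_exponent k) z - kronecker_pole k"
      using epstein_zeta_hex_le[OF z kronecker_exponent_gt_1] by auto
  qed
  then have "ln (eta_height z) \<le> ln (eta_height hex)" by simp
  then show ?thesis using eta_height_pos[OF z] eta_height_pos[OF hex_upper] by simp
qed

lemma minimizes_on_half_plane_iff:
  "minimizes_on_half_plane f \<tau> \<longleftrightarrow> Im \<tau> > 0 \<and> (\<forall>z. Im z > 0 \<longrightarrow> f \<tau> \<le> f z)"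
  unfolding minimizes_on_half_plane_def is_arg_min_def upper_half_plane_def mem_Collect_eq
  by (metis not_less)

lemma minimizes_hex_orbit:
  fixes f :: "complex \<Rightarrow> real"
  assumes inv: "\<And>A. A \<in> SL2Z \<Longrightarrow> f (moebius_action A hex) = f hex"
    and less: "\<And>z. Im z > 0 \<Longrightarrow> \<nexists>A. A \<in> SL2Z \<and> z = moebius_action A hex \<Longrightarrow> f hex < f z"
  shows "minimizes_on_half_plane f hexagonal_point"
    and "minimizes_on_half_plane f \<tau> \<longleftrightarrow> (\<exists>A\<in>SL2Z. \<tau> = moebius_action A hexagonal_point)"
proof -
  have le: "f hex \<le> f z" if "Im z > 0" for z
    using inv less[OF that] by (cases "\<exists>A. A \<in> SL2Z \<and> z = moebius_action A hex") (auto simp: less_imp_le)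
  note min = minimizes_on_half_plane_iff
  show "minimizes_on_half_plane f hexagonal_point"
    unfolding min hex_eq using le hex_upper by blast
  show "minimizes_on_half_plane f \<tau> \<longleftrightarrow> (\<exists>A\<in>SL2Z. \<tau> = moebius_action A hexagonal_point)"
  proof
    assume m: "minimizes_on_half_plane f \<tau>"
    show "\<exists>A\<in>SL2Z. \<tau> = moebius_action A hexagonal_point"
    proof (rule ccontr)
      assume "\<not> ?thesis"
      then have "f hex < f \<tau>" using m unfolding min hex_eq by (intro less) auto
      moreover have "f \<tau> \<le> f hex" using m hex_upper unfolding min by blast
      ultimately show False by simp
    qed
  next
    assume "\<exists>A\<in>SL2Z. \<tau> = moebius_action A hexagonal_point"
    then obtain A where A: "A \<in> SL2Z" "\<tau> = moebius_action A hex" by (auto simp: hex_eq)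
    then show "minimizes_on_half_plane f \<tau>"
      unfolding min using inv[OF A(1)] moebius_upper[OF hex_upper A(1)] le by simp
  qed
qed

lemma eta_quotient_invariant:
  assumes "A \<in> SL2Z" "g (moebius_action A hex) = g hex"
  shows "g (moebius_action A hex) / eta_height (moebius_action A hex) powr c = g hex / eta_height hex powr c"
  using assms eta_height_moebius[OF hex_upper] by simp

text \<open>The numerator is strictly smallest at the hexagonal point and the denominator is largest
  there, in the weak sense that survives the limit; together this is strict.\<close>

lemma eta_quotient_less:
  assumes z: "Im z > 0" and c: "c \<ge> 0" and g: "g hex < g z" "g hex \<ge> (0::real)"
  shows "g hex / eta_height hex powr c < g z / eta_height z powr c"
proof -
  have "g hex / eta_height hex powr c \<le> g hex / eta_height z powr c"
    using eta_height_le_hex[OF z] eta_height_pos[OF z] eta_height_pos[OF hex_upper] c g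
    by (intro divide_left_mono powr_mono2 mult_pos_pos) auto
  also have "\<dots> < g z / eta_height z powr c"
    using eta_height_pos[OF z] g by (intro divide_strict_right_mono) auto
  finally show ?thesis .
qed

lemma theta_eta_quotient_minimum:
  assumes "\<alpha> > 0" "c \<ge> 0"
  shows "minimizes_on_half_plane (\<lambda>\<tau>. lattice_theta \<alpha> \<tau> / eta_height \<tau> powr c) hexagonal_point"
    and "minimizes_on_half_plane (\<lambda>\<tau>. lattice_theta \<alpha> \<tau> / eta_height \<tau> powr c) \<tau>
      \<longleftrightarrow> (\<exists>A\<in>SL2Z. \<tau> = moebius_action A hexagonal_point)"
proof -
  have inv: "lattice_theta \<alpha> (moebius_action A hex) / eta_height (moebius_action A hex) powr c = lattice_theta \<alpha> hex / eta_height hex powr c"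
    if "A \<in> SL2Z" for A
    using that by (intro eta_quotient_invariant lattice_theta_moebius hex_upper)
  have less: "lattice_theta \<alpha> hex / eta_height hex powr c < lattice_theta \<alpha> z / eta_height z powr c"
    if "Im z > 0" "\<nexists>A. A \<in> SL2Z \<and> z = moebius_action A hex" for z
    using that hex_orbit_or_reduced[of z] assms lattice_theta_ge_1[OF hex_upper assms(1)]
    by (intro eta_quotient_less[where g = "lattice_theta \<alpha>"]) auto
  show "minimizes_on_half_plane (\<lambda>\<tau>. lattice_theta \<alpha> \<tau> / eta_height \<tau> powr c) hexagonal_point"
    using inv less by (rule minimizes_hex_orbit(1))
  show "minimizes_on_half_plane (\<lambda>\<tau>. lattice_theta \<alpha> \<tau> / eta_height \<tau> powr c) \<tau>
      \<longleftrightarrow> (\<exists>A\<in>SL2Z. \<tau> = moebius_action A hexagonal_point)"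
    using inv less by (rule minimizes_hex_orbit(2))
qed

lemma zeta_eta_quotient_minimum:
  assumes "s > 1" "c \<ge> 0"
  shows "minimizes_on_half_plane (\<lambda>\<tau>. epstein_zeta s \<tau> / eta_height \<tau> powr c) hexagonal_point"
    and "minimizes_on_half_plane (\<lambda>\<tau>. epstein_zeta s \<tau> / eta_height \<tau> powr c) \<tau>
      \<longleftrightarrow> (\<exists>A\<in>SL2Z. \<tau> = moebius_action A hexagonal_point)"
proof -
  have inv: "epstein_zeta s (moebius_action A hex) / eta_height (moebius_action A hex) powr c = epstein_zeta s hex / eta_height hex powr c"
    if "A \<in> SL2Z" for A
    using that by (intro eta_quotient_invariant epstein_zeta_moebius hex_upper)
  have less: "epstein_zeta s hex / eta_height hex powr c < epstein_zeta s z / eta_height z powr c"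
    if "Im z > 0" "\<nexists>A. A \<in> SL2Z \<and> z = moebius_action A hex" for z
  proof (rule eta_quotient_less[where g = "epstein_zeta s"])
    show "epstein_zeta s hex < epstein_zeta s z"
      using that hex_orbit_or_reduced[of z] assms(1) by (intro epstein_zeta_less hex_upper) auto
    show "epstein_zeta s hex \<ge> 0" by (rule epstein_zeta_nonneg[OF hex_upper])
  qed (use that assms in auto)
  show "minimizes_on_half_plane (\<lambda>\<tau>. epstein_zeta s \<tau> / eta_height \<tau> powr c) hexagonal_point"
    using inv less by (rule minimizes_hex_orbit(1))
  show "minimizes_on_half_plane (\<lambda>\<tau>. epstein_zeta s \<tau> / eta_height \<tau> powr c) \<tau>
      \<longleftrightarrow> (\<exists>A\<in>SL2Z. \<tau> = moebius_action A hexagonal_point)"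
    using inv less by (rule minimizes_hex_orbit(2))
qed

lemma partition_function_minimum:
  assumes "R > 0"
  shows "minimizes_on_half_plane (partition_function R) hexagonal_point"
proof -
  have "minimizes_on_half_plane (\<lambda>\<tau>. lattice_theta (R\<^sup>2 / 2) \<tau> / eta_height \<tau> powr 1) hexagonal_point"
    using assms by (intro theta_eta_quotient_minimum(1)) auto
  moreover have "partition_function R z = R / sqrt 2 * (lattice_theta (R\<^sup>2 / 2) z / eta_height z powr 1)" if "Im z > 0" for z
    unfolding partition_function_def eta_height_def[symmetric] using eta_height_pos[OF that] by simp
  ultimately show ?thesis
    unfolding minimizes_on_half_plane_iff using assms
    by (metis (no_types, lifting) divide_nonneg_pos less_imp_le mult_left_mono real_sqrt_gt_zero zero_less_numeral)
qed

theorem theoremD: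
  fixes \<alpha> s c :: real
  assumes "\<alpha> > 0" and "s > 1" and "c > 0"
  defines "F \<equiv> \<lambda>\<tau>. lattice_theta \<alpha> \<tau> / (sqrt (Im \<tau>) * (cmod (dedekind_eta \<tau>))\<^sup>2) powr c"
    and "G \<equiv> \<lambda>\<tau>. epstein_zeta s \<tau> / (sqrt (Im \<tau>) * (cmod (dedekind_eta \<tau>))\<^sup>2) powr c"
  shows "minimizes_on_half_plane F hexagonal_point \<and>
         (\<forall>\<tau>. minimizes_on_half_plane F \<tau> \<longleftrightarrow>
              (\<exists>A\<in>SL2Z. \<tau> = moebius_action A hexagonal_point)) \<and>
         minimizes_on_half_plane G hexagonal_point \<and>
         (\<forall>\<tau>. minimizes_on_half_plane G \<tau> \<longleftrightarrow>
              (\<exists>A\<in>SL2Z. \<tau> = moebius_action A hexagonal_point)) \<and>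
         (\<forall>R>0. minimizes_on_half_plane (partition_function R) hexagonal_point) \<and>
         (\<forall>d>2. minimizes_on_half_plane (torus_partition_function d) hexagonal_point)"
proof (intro conjI allI impI)
  have F: "F = (\<lambda>\<tau>. lattice_theta \<alpha> \<tau> / eta_height \<tau> powr c)"
    and G: "G = (\<lambda>\<tau>. epstein_zeta s \<tau> / eta_height \<tau> powr c)"
    by (simp_all add: F_def G_def eta_height_def)
  show "minimizes_on_half_plane F hexagonal_point"
    unfolding F using assms(1,3) by (intro theta_eta_quotient_minimum(1)) auto
  show "minimizes_on_half_plane F \<tau> \<longleftrightarrow> (\<exists>A\<in>SL2Z. \<tau> = moebius_action A hexagonal_point)" for \<tau>
    unfolding F using assms(1,3) by (intro theta_eta_quotient_minimum(2)) auto
  show "minimizes_on_half_plane G hexagonal_point"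
    unfolding G using assms(2,3) by (intro zeta_eta_quotient_minimum(1)) auto
  show "minimizes_on_half_plane G \<tau> \<longleftrightarrow> (\<exists>A\<in>SL2Z. \<tau> = moebius_action A hexagonal_point)" for \<tau>
    unfolding G using assms(2,3) by (intro zeta_eta_quotient_minimum(2)) auto
  show "minimizes_on_half_plane (partition_function R) hexagonal_point" if "R > 0" for R
    by (rule partition_function_minimum[OF that])
  show "minimizes_on_half_plane (torus_partition_function d) hexagonal_point" if "d > 2" for d
  proof -
    have "torus_partition_function d = (\<lambda>\<tau>. epstein_zeta (d / 2) \<tau> / eta_height \<tau> powr d)"
      by (simp add: torus_partition_function_def eta_height_def fun_eq_iff)
    then show ?thesis using that by (simp add: zeta_eta_quotient_minimum(1))
  qed
qed

end
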